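(* Let $\Omega$ be a commutative semigroup. The operad $\mathcal{PLF}$ of pre-Lie family algebras (over $\Omega$) is isomorphic to the operad $\mathcal{RTF}$ of $\Omega$-typed labeled rooted trees, via the operad isomorphism $\Phi:\mathcal{PLF}\to\mathcal{RTF}$ determined by sending, for each $\omega\in\Omega$, the generator $\rhd_\omega\in\mathcal{PLF}(\{a,b\})$ (the operation $x_a\rhd_\omega x_b$) to the two-vertex tree in $\mathcal{RTF}(\{a,b\})$ with root $b$, one child $a$ of the root, and the edge of type $\omega$.
   Context: $\mathbf{k}$ is a unitary commutative ring; operads are symmetric operads in $\mathbf{k}$-modules, indexed by finite sets (species $\mathcal{P}$ with unit and partial compositions $\circ_a:\mathcal{P}(A)\otimes\mathcal{P}(B)\to\mathcal{P}(A\sqcup B\setminus\{a\})$, $a\in A$, satisfying the sequential, parallel and unit axioms). The operad $\mathcal{PLF}$: let $\mathcal{F}_\Omega$ be the free operad on the species $E$ with $E_A=0$ if $|A|\neq2$ and $E_A=\mathbf{k}\Omega\otimes\mathbf{k}S_2$ if $|A|=2$; i.e. it is freely generated by binary operations $\rhd_\omega$, $\omega\in\Omega$, with no symmetry. Let $(R)$ be the operadic ideal generated by the elements, for $\alpha,\beta\in\Omega$, $$\rhd_\alpha\circ_b\rhd_\beta-\rhd_{\alpha\beta}\circ_a\rhd_\alpha-\tau_{12}\bigl(\rhd_\beta\circ_b\rhd_\alpha-\rhd_{\beta\alpha}\circ_a\rhd_\beta\bigr),$$ where $a$, $b$ are the first and second inputs of a generator and $\tau_{12}$ exchanges the first two of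 the three inputs; i.e. the relations expressing the pre-Lie family identity $x\rhd_\alpha(y\rhd_\beta z)-(x\rhd_\alpha y)\rhd_{\alpha\beta}z=y\rhd_\beta(x\rhd_\alpha z)-(y\rhd_\beta x)\rhd_{\beta\alpha}z$. Then $\mathcal{PLF}=\mathcal{F}_\Omega/(R)$. The operad $\mathcal{RTF}$: for a finite set $A$, $T_\Omega(A)$ is the set of $\Omega$-typed $A$-labeled rooted trees: non-planar rooted trees whose vertices are labeled bijectively by the elements of $A$, with each edge given a type in $\Omega$. $\mathcal{RTF}(A)$ is the free $\mathbf{k}$-module on $T_\Omega(A)$, bijections act by relabeling, and the unit is the one-vertex tree. For $T\in T_\Omega(A)$, $U\in T_\Omega(B)$ and $v\in A$, $T\circ_v U:=\sum_{f:\mathrm{In}(v)\to V(U)}T\circ_v^f U$, where $\mathrm{In}(v)$ is the set of incoming edges of $v$ in $T$ (edges joining $v$ to its children), and $T\circ_v^fU\in T_\Omega(A\sqcup B\setminus\{v\})$ is obtained by: replacing the vertex $v$ of $T$ by the tree $U$ (the edge leaving $v$ towards the root of $T$, if any, is attached to the root of $U$ with the same type); attaching each edge $a\in\mathrm{In}(v)$ to the vertex $f(a)$ of $U$, keeping its type; and, for each $a\in\mathrm{In}(v)$, multiplying by $\omega_a$ (the type of $a$) the type of every edge of $U$ below $f(a)$ (on the path from $f(a)$ to the root of $U$). All other types are unchanged. *)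

theory Defs
  imports
    "HOL-Algebra.Module"
    "HOL-Algebra.AbelCoset"
    "HOL-Library.Poly_Mapping"
    "HOL-Library.FuncSet"
    "HOL-Library.Infinite_Typeclass"
    "HOL-Combinatorics.Transposition"
begin

section \<open>Modules over a unital commutative ring\<close>

text \<open>
  The ground ring is a type of sort \<open>{comm_ring, comm_monoid_mult}\<close>, which is
  \<open>comm_ring_1\<close> without the axiom \<open>0 \<noteq> 1\<close>, so the zero ring is included.
\<close>

definition scalars :: "'k::{comm_ring,comm_monoid_mult} ring" where
  "scalars = \<lparr>carrier = UNIV, mult = (*), one = 1, zero = 0, add = (+)\<rparr>"

definition mod_hom ::
  "('k, 'r) ring_scheme \<Rightarrow> ('k, 'm, 'y) module_scheme \<Rightarrow> ('k, 'n, 'z) module_scheme \<Rightarrow> ('m \<Rightarrow> 'n) set"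
  where
  "mod_hom R M N = {h \<in> carrier M \<rightarrow> carrier N.
     (\<forall>x\<in>carrier M. \<forall>y\<in>carrier M. h (x \<oplus>\<^bsub>M\<^esub> y) = h x \<oplus>\<^bsub>N\<^esub> h y) \<and>
     (\<forall>c\<in>carrier R. \<forall>x\<in>carrier M. h (c \<odot>\<^bsub>M\<^esub> x) = c \<odot>\<^bsub>N\<^esub> h x)}"

definition scale :: "'k::{comm_ring,comm_monoid_mult} \<Rightarrow> ('x \<Rightarrow>\<^sub>0 'k) \<Rightarrow> ('x \<Rightarrow>\<^sub>0 'k)" where
  "scale c p = Poly_Mapping.map ((*) c) p"

text \<open>
  The free module on \<open>X\<close>. The fields \<open>mult\<close> and \<open>one\<close>, which the record type of modules
  inherits from that of rings, play no role in a module.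
\<close>

definition free_mod :: "'x set \<Rightarrow> ('k::{comm_ring,comm_monoid_mult}, 'x \<Rightarrow>\<^sub>0 'k) module" where
  "free_mod X = \<lparr>carrier = {p. Poly_Mapping.keys p \<subseteq> X}, mult = undefined, one = undefined,
     zero = 0, add = (+), smult = scale\<rparr>"

definition basis :: "'x \<Rightarrow> ('x \<Rightarrow>\<^sub>0 'k::{comm_ring,comm_monoid_mult})" where
  "basis x = Poly_Mapping.single x 1"

definition lin_ext ::
  "('x \<Rightarrow> ('y \<Rightarrow>\<^sub>0 'k)) \<Rightarrow> ('x \<Rightarrow>\<^sub>0 'k::{comm_ring,comm_monoid_mult}) \<Rightarrow> ('y \<Rightarrow>\<^sub>0 'k)" where
  "lin_ext f p = (\<Sum>x\<in>Poly_Mapping.keys p. scale (Poly_Mapping.lookup p x) (f x))"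


section \<open>Species and operads\<close>

text \<open>
  Species are taken on the finite subsets of a type \<open>'l\<close> of labels. A bijection from a
  finite set \<open>A\<close> onto another one is given by a function \<open>\<sigma>\<close> that is injective on \<open>A\<close>; it acts by
  \<open>relabel P \<sigma> A\<close>, from the component at \<open>A\<close> to the component at \<open>\<sigma> ` A\<close>. When \<open>'l\<close> is infinite,
  finite subsets of \<open>'l\<close> and bijections form a category equivalent to that of all finite
  sets and bijections. Values at infinite \<open>A\<close> are irrelevant throughout.
\<close>

record ('l, 'k, 'm) species =
  component :: "'l set \<Rightarrow> ('k, 'm) module"
  relabel :: "('l \<Rightarrow> 'l) \<Rightarrow> 'l set \<Rightarrow> 'm \<Rightarrow> 'm"

abbreviation elts :: "('l, 'k, 'm, 'z) species_scheme \<Rightarrow> 'l set \<Rightarrow> 'm set" where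
  "elts P A \<equiv> carrier (component P A)"

locale species =
  fixes P :: "('l, 'k::{comm_ring,comm_monoid_mult}, 'm, 'z) species_scheme"
  assumes module_component: "finite A \<Longrightarrow> Module.module scalars (component P A)"
    and relabel_hom: "\<lbrakk>finite A; inj_on \<sigma> A\<rbrakk> \<Longrightarrow>
      relabel P \<sigma> A \<in> mod_hom scalars (component P A) (component P (\<sigma> ` A))"
    and relabel_cong: "\<lbrakk>finite A; inj_on \<sigma> A; \<And>a. a \<in> A \<Longrightarrow> \<sigma> a = \<tau> a; x \<in> elts P A\<rbrakk> \<Longrightarrow>
      relabel P \<sigma> A x = relabel P \<tau> A x"
    and relabel_id: "\<lbrakk>finite A; x \<in> elts P A\<rbrakk> \<Longrightarrow> relabel P id A x = x"
    and relabel_comp: "\<lbrakk>finite A; inj_on \<sigma> A; inj_on \<tau> (\<sigma> ` A); x \<in> elts P A\<rbrakk> \<Longrightarrow>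
      relabel P \<tau> (\<sigma> ` A) (relabel P \<sigma> A x) = relabel P (\<tau> \<circ> \<sigma>) A x"

text \<open>
  \<open>pcomp P A a B\<close> is the partial composition of an element of the component at \<open>A\<close> with one of
  the component at \<open>B\<close>, along \<open>a \<in> A\<close>. It is only constrained for disjoint \<open>A\<close> and \<open>B\<close>, where the
  result lies in the component at \<open>(A - {a}) \<union> B\<close>. \<open>ident P a\<close> is the unit in the component
  at \<open>{a}\<close>.
\<close>

record ('l, 'k, 'm) operad = "('l, 'k, 'm) species" +
  ident :: "'l \<Rightarrow> 'm"
  pcomp :: "'l set \<Rightarrow> 'l \<Rightarrow> 'l set \<Rightarrow> 'm \<Rightarrow> 'm \<Rightarrow> 'm"

locale operad = species P
  for P :: "('l, 'k::{comm_ring,comm_monoid_mult}, 'm, 'z) operad_scheme" +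
  assumes pcomp_hom_left: "\<lbrakk>finite A; finite B; A \<inter> B = {}; a \<in> A; y \<in> elts P B\<rbrakk> \<Longrightarrow>
      (\<lambda>x. pcomp P A a B x y) \<in> mod_hom scalars (component P A) (component P (A - {a} \<union> B))"
    and pcomp_hom_right: "\<lbrakk>finite A; finite B; A \<inter> B = {}; a \<in> A; x \<in> elts P A\<rbrakk> \<Longrightarrow>
      pcomp P A a B x \<in> mod_hom scalars (component P B) (component P (A - {a} \<union> B))"
    and relabel_pcomp:
      "\<lbrakk>finite A; finite B; A \<inter> B = {}; a \<in> A; inj_on \<sigma> (A \<union> B); x \<in> elts P A; y \<in> elts P B\<rbrakk> \<Longrightarrow>
      relabel P \<sigma> (A - {a} \<union> B) (pcomp P A a B x y) =
        pcomp P (\<sigma> ` A) (\<sigma> a) (\<sigma> ` B) (relabel P \<sigma> A x) (relabel P \<sigma> B y)"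
    and pcomp_sequential:
      "\<lbrakk>finite A; finite B; finite C; A \<inter> B = {}; A \<inter> C = {}; B \<inter> C = {}; a \<in> A; b \<in> B;
        x \<in> elts P A; y \<in> elts P B; z \<in> elts P C\<rbrakk> \<Longrightarrow>
      pcomp P (A - {a} \<union> B) b C (pcomp P A a B x y) z =
        pcomp P A a (B - {b} \<union> C) x (pcomp P B b C y z)"
    and pcomp_parallel:
      "\<lbrakk>finite A; finite B; finite C; A \<inter> B = {}; A \<inter> C = {}; B \<inter> C = {}; a \<in> A; a' \<in> A; a \<noteq> a';
        x \<in> elts P A; y \<in> elts P B; z \<in> elts P C\<rbrakk> \<Longrightarrow>
      pcomp P (A - {a} \<union> B) a' C (pcomp P A a B x y) z =
        pcomp P (A - {a'} \<union> C) a B (pcomp P A a' C x z) y"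
    and ident_closed: "ident P a \<in> elts P {a}"
    and relabel_ident: "relabel P \<sigma> {a} (ident P a) = ident P (\<sigma> a)"
    and pcomp_ident_left: "\<lbrakk>finite B; a \<notin> B; y \<in> elts P B\<rbrakk> \<Longrightarrow> pcomp P {a} a B (ident P a) y = y"
    and pcomp_ident_right: "\<lbrakk>finite A; a \<in> A; b \<notin> A; x \<in> elts P A\<rbrakk> \<Longrightarrow>
      pcomp P A a {b} x (ident P b) = relabel P (id(a := b)) A x"

text \<open>A morphism is a family of maps indexed by the finite label sets.\<close>

definition species_hom ::
  "('l, 'k::{comm_ring,comm_monoid_mult}, 'm, 'y) species_scheme \<Rightarrow> ('l, 'k, 'n, 'z) species_scheme \<Rightarrow>
    ('l set \<Rightarrow> 'm \<Rightarrow> 'n) \<Rightarrow> bool" where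
  "species_hom P Q \<Phi> \<longleftrightarrow>
     (\<forall>A. finite A \<longrightarrow> \<Phi> A \<in> mod_hom scalars (component P A) (component Q A)) \<and>
     (\<forall>A \<sigma> x. finite A \<and> inj_on \<sigma> A \<and> x \<in> elts P A \<longrightarrow>
        \<Phi> (\<sigma> ` A) (relabel P \<sigma> A x) = relabel Q \<sigma> A (\<Phi> A x))"

definition operad_hom ::
  "('l, 'k::{comm_ring,comm_monoid_mult}, 'm, 'y) operad_scheme \<Rightarrow> ('l, 'k, 'n, 'z) operad_scheme \<Rightarrow>
    ('l set \<Rightarrow> 'm \<Rightarrow> 'n) \<Rightarrow> bool" where
  "operad_hom P Q \<Phi> \<longleftrightarrow> species_hom P Q \<Phi> \<and>
     (\<forall>a. \<Phi> {a} (ident P a) = ident Q a) \<and>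
     (\<forall>A B a x y. finite A \<and> finite B \<and> A \<inter> B = {} \<and> a \<in> A \<and> x \<in> elts P A \<and> y \<in> elts P B \<longrightarrow>
        \<Phi> (A - {a} \<union> B) (pcomp P A a B x y) = pcomp Q A a B (\<Phi> A x) (\<Phi> B y))"

definition operad_iso ::
  "('l, 'k::{comm_ring,comm_monoid_mult}, 'm, 'y) operad_scheme \<Rightarrow> ('l, 'k, 'n, 'z) operad_scheme \<Rightarrow>
    ('l set \<Rightarrow> 'm \<Rightarrow> 'n) \<Rightarrow> bool" where
  "operad_iso P Q \<Phi> \<longleftrightarrow> operad_hom P Q \<Phi> \<and>
     (\<forall>A. finite A \<longrightarrow> bij_betw (\<Phi> A) (elts P A) (elts Q A))"


section \<open>Operadic ideals and quotients\<close>

definition operad_ideal ::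
  "('l, 'k::{comm_ring,comm_monoid_mult}, 'm, 'z) operad_scheme \<Rightarrow> ('l set \<Rightarrow> 'm set) \<Rightarrow> bool" where
  "operad_ideal P I \<longleftrightarrow>
     (\<forall>A. finite A \<longrightarrow> submodule (I A) scalars (component P A)) \<and>
     (\<forall>A \<sigma> x. finite A \<and> inj_on \<sigma> A \<and> x \<in> I A \<longrightarrow> relabel P \<sigma> A x \<in> I (\<sigma> ` A)) \<and>
     (\<forall>A B a x y. finite A \<and> finite B \<and> A \<inter> B = {} \<and> a \<in> A \<and> x \<in> I A \<and> y \<in> elts P B \<longrightarrow>
        pcomp P A a B x y \<in> I (A - {a} \<union> B)) \<and>
     (\<forall>A B a x y. finite A \<and> finite B \<and> A \<inter> B = {} \<and> a \<in> A \<and> x \<in> elts P A \<and> y \<in> I B \<longrightarrow>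
        pcomp P A a B x y \<in> I (A - {a} \<union> B))"

definition generated_ideal ::
  "('l, 'k::{comm_ring,comm_monoid_mult}, 'm, 'z) operad_scheme \<Rightarrow> ('l set \<Rightarrow> 'm set) \<Rightarrow> 'l set \<Rightarrow> 'm set"
  where
  "generated_ideal P G A = \<Inter>{I A | I. operad_ideal P I \<and> (\<forall>B. finite B \<longrightarrow> G B \<subseteq> I B)}"

definition coset_of ::
  "('l, 'k, 'm, 'z) operad_scheme \<Rightarrow> ('l set \<Rightarrow> 'm set) \<Rightarrow> 'l set \<Rightarrow> 'm \<Rightarrow> 'm set" where
  "coset_of P I A x = I A +>\<^bsub>component P A\<^esub> x"

text \<open>
  The operations of the quotient are defined on representatives: for an ideal \<open>I\<close> each
  union below is a union of equal cosets.
\<close>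

definition quotient_operad ::
  "('l, 'k, 'm, 'z) operad_scheme \<Rightarrow> ('l set \<Rightarrow> 'm set) \<Rightarrow> ('l, 'k, 'm set) operad" where
  "quotient_operad P I = \<lparr>
     component = (\<lambda>A.
       \<lparr>carrier = a_rcosets\<^bsub>component P A\<^esub> (I A), mult = undefined, one = undefined,
        zero = I A, add = set_add (component P A),
        smult = (\<lambda>c X. \<Union>x\<in>X. coset_of P I A (c \<odot>\<^bsub>component P A\<^esub> x))\<rparr>),
     relabel = (\<lambda>\<sigma> A X. \<Union>x\<in>X. coset_of P I (\<sigma> ` A) (relabel P \<sigma> A x)),
     ident = (\<lambda>a. coset_of P I {a} (ident P a)),
     pcomp = (\<lambda>A a B X Y. \<Union>x\<in>X. \<Union>y\<in>Y. coset_of P I (A - {a} \<union> B) (pcomp P A a B x y))\<rparr>"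


section \<open>The free operad on binary operations without symmetry\<close>

text \<open>
  The species of generators: its component at \<open>A\<close> has as basis the operations \<open>\<omega>\<close> together with
  an ordering \<open>(a, b)\<close> of \<open>A\<close>, so it is zero unless \<open>A\<close> has two elements.
\<close>

definition gen_species ::
  "('l, 'k::{comm_ring,comm_monoid_mult}, ('w \<times> 'l \<times> 'l) \<Rightarrow>\<^sub>0 'k) species" where
  "gen_species = \<lparr>
     component = (\<lambda>A. free_mod {(\<omega>, a, b) | \<omega> a b. a \<noteq> b \<and> A = {a, b}}),
     relabel = (\<lambda>\<sigma> A. lin_ext (\<lambda>(\<omega>, a, b). basis (\<omega>, \<sigma> a, \<sigma> b)))\<rparr>"

text \<open>
  The free operad on this species is realised on planar binary trees whose leaves are
  labelled bijectively and whose inner nodes are decorated by operations; its universal property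
  is proved at the end of this theory (\<open>free_operad_is_free\<close>).
\<close>

datatype ('l, 'w) pbt = Leaf 'l | Node 'w "('l, 'w) pbt" "('l, 'w) pbt"

primrec leaves :: "('l, 'w) pbt \<Rightarrow> 'l list" where
  "leaves (Leaf a) = [a]"
| "leaves (Node \<omega> l r) = leaves l @ leaves r"

primrec subst_leaf :: "'l \<Rightarrow> ('l, 'w) pbt \<Rightarrow> ('l, 'w) pbt \<Rightarrow> ('l, 'w) pbt" where
  "subst_leaf a s (Leaf b) = (if b = a then s else Leaf b)"
| "subst_leaf a s (Node \<omega> l r) = Node \<omega> (subst_leaf a s l) (subst_leaf a s r)"

definition pbts :: "'l set \<Rightarrow> ('l, 'w) pbt set" where
  "pbts A = {t. distinct (leaves t) \<and> set (leaves t) = A}"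

definition free_operad ::
  "('l, 'k::{comm_ring,comm_monoid_mult}, ('l, 'w) pbt \<Rightarrow>\<^sub>0 'k) operad" where
  "free_operad = \<lparr>
     component = (\<lambda>A. free_mod (pbts A)),
     relabel = (\<lambda>\<sigma> A. lin_ext (\<lambda>t. basis (map_pbt \<sigma> id t))),
     ident = (\<lambda>a. basis (Leaf a)),
     pcomp = (\<lambda>A a B p q. lin_ext (\<lambda>t. lin_ext (\<lambda>s. basis (subst_leaf a s t)) q) p)\<rparr>"

definition free_operad_incl ::
  "'l set \<Rightarrow> (('w \<times> 'l \<times> 'l) \<Rightarrow>\<^sub>0 'k::{comm_ring,comm_monoid_mult}) \<Rightarrow> (('l, 'w) pbt \<Rightarrow>\<^sub>0 'k)" where
  "free_operad_incl A = lin_ext (\<lambda>(\<omega>, a, b). basis (Node \<omega> (Leaf a) (Leaf b)))"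

text \<open>The generator \<open>x\<^sub>a \<rhd>\<^sub>\<omega> x\<^sub>b\<close> in the component at \<open>{a, b}\<close>.\<close>

definition free_gen :: "'w \<Rightarrow> 'l \<Rightarrow> 'l \<Rightarrow> (('l, 'w) pbt \<Rightarrow>\<^sub>0 'k::{comm_ring,comm_monoid_mult})" where
  "free_gen \<omega> a b = free_operad_incl {a, b} (basis (\<omega>, a, b))"


section \<open>The operad of pre-Lie family algebras\<close>

text \<open>
  \<open>preLie_family_relator \<alpha> \<beta> x y z s\<close> is the relator with inputs \<open>x\<close>, \<open>y\<close>, \<open>z\<close> (in this order);
  \<open>s\<close> is the auxiliary label along which the generators are composed.
\<close>

definition assoc_family ::
  "'w::ab_semigroup_mult \<Rightarrow> 'w \<Rightarrow> 'l \<Rightarrow> 'l \<Rightarrow> 'l \<Rightarrow> 'l \<Rightarrow>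
    (('l, 'w) pbt \<Rightarrow>\<^sub>0 'k::{comm_ring,comm_monoid_mult})" where
  "assoc_family \<alpha> \<beta> x y z s =
     pcomp free_operad {x, s} s {y, z} (free_gen \<alpha> x s) (free_gen \<beta> y z) -
     pcomp free_operad {s, z} s {x, y} (free_gen (\<alpha> * \<beta>) s z) (free_gen \<alpha> x y)"

definition preLie_family_relator ::
  "'w::ab_semigroup_mult \<Rightarrow> 'w \<Rightarrow> 'l \<Rightarrow> 'l \<Rightarrow> 'l \<Rightarrow> 'l \<Rightarrow>
    (('l, 'w) pbt \<Rightarrow>\<^sub>0 'k::{comm_ring,comm_monoid_mult})" where
  "preLie_family_relator \<alpha> \<beta> x y z s =
     assoc_family \<alpha> \<beta> x y z s -
     relabel free_operad (transpose x y) {x, y, z} (assoc_family \<beta> \<alpha> x y z s)"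

definition PLF_ideal ::
  "'l set \<Rightarrow> (('l, 'w::ab_semigroup_mult) pbt \<Rightarrow>\<^sub>0 'k::{comm_ring,comm_monoid_mult}) set" where
  "PLF_ideal = generated_ideal free_operad
     (\<lambda>A. {preLie_family_relator \<alpha> \<beta> x y z s | \<alpha> \<beta> x y z s. distinct [x, y, z, s] \<and> A = {x, y, z}})"

definition PLF ::
  "('l, 'k::{comm_ring,comm_monoid_mult}, (('l, 'w::ab_semigroup_mult) pbt \<Rightarrow>\<^sub>0 'k) set) operad" where
  "PLF = quotient_operad free_operad PLF_ideal"

definition PLF_gen ::
  "'w::ab_semigroup_mult \<Rightarrow> 'l \<Rightarrow> 'l \<Rightarrow> (('l, 'w) pbt \<Rightarrow>\<^sub>0 'k::{comm_ring,comm_monoid_mult}) set" where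
  "PLF_gen \<omega> a b = coset_of free_operad PLF_ideal {a, b} (free_gen \<omega> a b)"


section \<open>The operad of typed labelled rooted trees\<close>

text \<open>
  A tree with vertex set \<open>A\<close> is given by its root and its set of edges; the edge
  \<open>(w, \<omega>, u)\<close> goes from the child \<open>w\<close> to its parent \<open>u\<close> and has type \<open>\<omega>\<close>. As vertices are labelled
  bijectively by \<open>A\<close>, they are identified with their labels.
\<close>

datatype ('l, 'w) rtree = RTree (rt_root: 'l) (rt_edges: "('l \<times> 'w \<times> 'l) set")

definition parent_rel :: "('l, 'w) rtree \<Rightarrow> ('l \<times> 'l) set" where
  "parent_rel T = {(w, u). \<exists>\<omega>. (w, \<omega>, u) \<in> rt_edges T}"

definition typed_trees :: "'l set \<Rightarrow> ('l, 'w) rtree set" where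
  "typed_trees A = {T. rt_root T \<in> A \<and>
     rt_edges T \<subseteq> (A - {rt_root T}) \<times> UNIV \<times> A \<and>
     (\<forall>w \<in> A - {rt_root T}. \<exists>!e. e \<in> rt_edges T \<and> fst e = w) \<and>
     (\<forall>w \<in> A. (w, rt_root T) \<in> (parent_rel T)\<^sup>*)}"

definition incoming :: "('l, 'w) rtree \<Rightarrow> 'l \<Rightarrow> ('l \<times> 'w \<times> 'l) set" where
  "incoming T v = {(w, \<omega>, u) \<in> rt_edges T. u = v}"

definition relabel_rtree :: "('l \<Rightarrow> 'l) \<Rightarrow> ('l, 'w) rtree \<Rightarrow> ('l, 'w) rtree" where
  "relabel_rtree \<sigma> T = RTree (\<sigma> (rt_root T)) ((\<lambda>(w, \<omega>, u). (\<sigma> w, \<omega>, \<sigma> u)) ` rt_edges T)"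

text \<open>
  An edge \<open>(w, \<omega>, u)\<close> of \<open>U\<close> lies below \<open>f e\<close> iff its child end \<open>w\<close> is reached from \<open>f e\<close> by
  following parents; \<open>twisted_type\<close> multiplies \<open>\<omega>\<close> by the types of all edges \<open>e\<close> entering \<open>v\<close> for
  which this holds. A fold is used because \<open>'w\<close> need not have a unit.
\<close>

definition twisted_type ::
  "('l, 'w::ab_semigroup_mult) rtree \<Rightarrow> 'l \<Rightarrow> (('l \<times> 'w \<times> 'l) \<Rightarrow> 'l) \<Rightarrow> ('l, 'w) rtree \<Rightarrow> 'l \<Rightarrow> 'w \<Rightarrow> 'w"
  where
  "twisted_type T v f U w \<omega> =
     Finite_Set.fold (\<lambda>e \<eta>. fst (snd e) * \<eta>) \<omega> {e \<in> incoming T v. (f e, w) \<in> (parent_rel U)\<^sup>*}"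

definition graft ::
  "('l, 'w::ab_semigroup_mult) rtree \<Rightarrow> 'l \<Rightarrow> (('l \<times> 'w \<times> 'l) \<Rightarrow> 'l) \<Rightarrow> ('l, 'w) rtree \<Rightarrow> ('l, 'w) rtree"
  where
  "graft T v f U = RTree (if rt_root T = v then rt_root U else rt_root T)
     ({(w, \<omega>, u) \<in> rt_edges T. w \<noteq> v \<and> u \<noteq> v} \<union>
      {(rt_root U, \<omega>, u) | \<omega> u. (v, \<omega>, u) \<in> rt_edges T} \<union>
      {(w, \<omega>, f (w, \<omega>, v)) | w \<omega>. (w, \<omega>, v) \<in> rt_edges T} \<union>
      {(w, twisted_type T v f U w \<omega>, u) | w \<omega> u. (w, \<omega>, u) \<in> rt_edges U})"

definition RTF ::
  "('l, 'k::{comm_ring,comm_monoid_mult}, ('l, 'w::ab_semigroup_mult) rtree \<Rightarrow>\<^sub>0 'k) operad" where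
  "RTF = \<lparr>
     component = (\<lambda>A. free_mod (typed_trees A)),
     relabel = (\<lambda>\<sigma> A. lin_ext (\<lambda>T. basis (relabel_rtree \<sigma> T))),
     ident = (\<lambda>a. basis (RTree a {})),
     pcomp = (\<lambda>A v B p q.
       lin_ext (\<lambda>T. lin_ext (\<lambda>U. \<Sum>f \<in> incoming T v \<rightarrow>\<^sub>E B. basis (graft T v f U)) q) p)\<rparr>"


section \<open>Universal property of the free operad\<close>

lemma scalars_simps [simp]:
  "carrier scalars = UNIV" "mult scalars = (*)" "one scalars = 1" "zero scalars = 0" "add scalars = (+)"
  by (simp_all add: scalars_def)

lemma cring_scalars: "cring (scalars :: 'k::{comm_ring,comm_monoid_mult} ring)"
proof (rule cringI)
  show "abelian_group (scalars :: 'k ring)"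
  proof (rule abelian_groupI)
    fix x :: 'k
    have "- x + x = 0" by simp
    then show "\<exists>y\<in>carrier (scalars :: 'k ring). y \<oplus>\<^bsub>scalars\<^esub> x = \<zero>\<^bsub>scalars\<^esub>"
      by (metis UNIV_I scalars_simps(1,4,5))
  qed (auto simp: algebra_simps)
  show "comm_monoid (scalars :: 'k ring)"
    by (rule comm_monoidI) (auto simp: algebra_simps)
qed (auto simp: algebra_simps)

lemma lookup_scale [simp]: "Poly_Mapping.lookup (scale c p) x = c * Poly_Mapping.lookup p x"
  by (simp add: scale_def Poly_Mapping.map.rep_eq when_def)

lemma keys_scale: "Poly_Mapping.keys (scale c p) \<subseteq> Poly_Mapping.keys p"
  by (auto simp: in_keys_iff)

lemma free_mod_simps [simp]:
  "carrier (free_mod X) = {p. Poly_Mapping.keys p \<subseteq> X}" "zero (free_mod X) = 0"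
  "add (free_mod X) = (+)" "smult (free_mod X) = scale"
  by (simp_all add: free_mod_def)

lemma scale_add_right: "scale c (p + q) = scale c p + scale c q"
  and scale_add_left: "scale (c + d) p = scale c p + scale d p"
  and scale_scale: "scale c (scale d p) = scale (c * d) p"
  and scale_one: "scale 1 p = p"
  and scale_zero_left [simp]: "scale 0 p = 0"
  and scale_zero_right [simp]: "scale c 0 = 0"
  by (auto intro!: poly_mapping_eqI simp: lookup_add algebra_simps)

lemma module_free_mod:
  "Module.module scalars (free_mod X :: ('k::{comm_ring,comm_monoid_mult}, 'x \<Rightarrow>\<^sub>0 'k) module)"
proof (rule moduleI)
  show "abelian_group (free_mod X :: ('k, 'x \<Rightarrow>\<^sub>0 'k) module)"
  proof (rule abelian_groupI)
    fix p q :: "'x \<Rightarrow>\<^sub>0 'k" assume "p \<in> carrier (free_mod X)" "q \<in> carrier (free_mod X)"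
    then show "p \<oplus>\<^bsub>free_mod X\<^esub> q \<in> carrier (free_mod X)"
      using Poly_Mapping.keys_add[of p q] by auto
  next
    fix p :: "'x \<Rightarrow>\<^sub>0 'k" assume "p \<in> carrier (free_mod X)"
    then show "\<exists>q\<in>carrier (free_mod X). q \<oplus>\<^bsub>free_mod X\<^esub> p = \<zero>\<^bsub>free_mod X\<^esub>"
      by (intro bexI[of _ "- p"]) simp_all
  qed (simp_all add: add_ac)
next
  fix c :: 'k and p :: "'x \<Rightarrow>\<^sub>0 'k" assume "p \<in> carrier (free_mod X)"
  then show "c \<odot>\<^bsub>free_mod X\<^esub> p \<in> carrier (free_mod X)"
    using keys_scale[of c p] by auto
qed (simp_all add: cring_scalars scale_add_left scale_add_right scale_scale scale_one)

lemma scale_sum: "scale c (\<Sum>x\<in>S. f x) = (\<Sum>x\<in>S. scale c (f x))"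
  by (induction S rule: infinite_finite_induct) (simp_all add: scale_add_right)

lemma keys_basis: "Poly_Mapping.keys (basis x) \<subseteq> {x}"
  by (simp add: basis_def)

lemma keys_basis_subset: "x \<in> X \<Longrightarrow> Poly_Mapping.keys (basis x) \<subseteq> X"
  using keys_basis[of x] by blast

lemma lookup_basis: "Poly_Mapping.lookup (basis x) y = (if x = y then 1 else 0)"
  by (simp add: basis_def lookup_single when_def)

lemma lin_ext_superset:
  assumes "finite S" "Poly_Mapping.keys p \<subseteq> S"
  shows "lin_ext f p = (\<Sum>x\<in>S. scale (Poly_Mapping.lookup p x) (f x))"
  unfolding lin_ext_def
  by (rule sum.mono_neutral_left) (use assms in \<open>auto simp: in_keys_iff\<close>)

lemma lin_ext_basis [simp]: "lin_ext f (basis x) = f x"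
  by (subst lin_ext_superset[of "{x}"]) (simp_all add: lookup_basis keys_basis scale_one)

lemma lin_ext_add: "lin_ext f (p + q) = lin_ext f p + lin_ext f q"
proof -
  let ?S = "Poly_Mapping.keys p \<union> Poly_Mapping.keys q"
  have "lin_ext f (p + q) = (\<Sum>x\<in>?S. scale (Poly_Mapping.lookup (p + q) x) (f x))"
    by (rule lin_ext_superset) (simp_all add: Poly_Mapping.keys_add)
  also have "\<dots> = lin_ext f p + lin_ext f q"
    by (subst (1 2) lin_ext_superset[of ?S])
      (simp_all add: lookup_add scale_add_left sum.distrib)
  finally show ?thesis .
qed

lemma lin_ext_scale: "lin_ext f (scale c p) = scale c (lin_ext f p)"
  by (subst (1 2) lin_ext_superset[of "Poly_Mapping.keys p"])
    (simp_all add: scale_sum scale_scale keys_scale)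

lemma lin_ext_zero [simp]: "lin_ext f 0 = 0"
  by (simp add: lin_ext_def)

lemma lin_ext_sum: "lin_ext f (\<Sum>x\<in>S. g x) = (\<Sum>x\<in>S. lin_ext f (g x))"
  by (induction S rule: infinite_finite_induct) (simp_all add: lin_ext_add)

lemma lin_ext_lin_ext: "lin_ext g (lin_ext f p) = lin_ext (\<lambda>x. lin_ext g (f x)) p"
  by (simp add: lin_ext_def[of f] lin_ext_def[of "\<lambda>x. lin_ext g (f x)"] lin_ext_sum lin_ext_scale)

lemma lin_ext_cong:
  "p = q \<Longrightarrow> (\<And>x. x \<in> Poly_Mapping.keys q \<Longrightarrow> f x = g x) \<Longrightarrow> lin_ext f p = lin_ext g q"
  by (simp add: lin_ext_def)

lemma lin_ext_swap:
  "lin_ext (\<lambda>x. lin_ext (\<lambda>y. h x y) q) p = lin_ext (\<lambda>y. lin_ext (\<lambda>x. h x y) p) q"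
  unfolding lin_ext_def scale_sum by (subst sum.swap) (simp add: scale_scale mult.commute)

lemma lin_ext_basis_id: "lin_ext basis p = p"
  unfolding lin_ext_def
  by (rule poly_mapping_eqI)
    (simp add: lookup_sum lookup_basis if_distrib[of "(*) _"] in_keys_iff cong: if_cong)

lemma lin_ext_add_fun: "lin_ext (\<lambda>x. f x + g x) p = lin_ext f p + lin_ext g p"
  by (simp add: lin_ext_def scale_add_right sum.distrib)

lemma lin_ext_scale_fun: "lin_ext (\<lambda>x. scale c (f x)) p = scale c (lin_ext f p)"
  by (simp add: lin_ext_def scale_sum scale_scale mult.commute)

lemma keys_lin_ext:
  assumes "\<And>x. x \<in> Poly_Mapping.keys p \<Longrightarrow> Poly_Mapping.keys (f x) \<subseteq> Y"
  shows "Poly_Mapping.keys (lin_ext f p) \<subseteq> Y"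
proof
  fix y assume y: "y \<in> Poly_Mapping.keys (lin_ext f p)"
  show "y \<in> Y"
  proof (rule ccontr)
    assume "y \<notin> Y"
    have "Poly_Mapping.lookup (scale (Poly_Mapping.lookup p x) (f x)) y = 0"
      if x: "x \<in> Poly_Mapping.keys p" for x
    proof -
      have "y \<notin> Poly_Mapping.keys (f x)" using assms[OF x] \<open>y \<notin> Y\<close> by (rule contra_subsetD)
      then show ?thesis by (simp add: not_in_keys_iff_lookup_eq_zero)
    qed
    then have "Poly_Mapping.lookup (lin_ext f p) y = 0"
      unfolding lin_ext_def lookup_sum by (intro sum.neutral ballI)
    with y show False by (simp add: in_keys_iff)
  qed
qed

lemma lin_ext_mod_hom:
  assumes "\<And>x. x \<in> X \<Longrightarrow> Poly_Mapping.keys (f x) \<subseteq> Y"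
  shows "lin_ext f \<in> mod_hom scalars (free_mod X) (free_mod Y)"
proof -
  have "Poly_Mapping.keys (lin_ext f p) \<subseteq> Y" if "Poly_Mapping.keys p \<subseteq> X" for p
    by (rule keys_lin_ext) (use assms subsetD[OF that] in auto)
  then have "lin_ext f \<in> carrier (free_mod X) \<rightarrow> carrier (free_mod Y)" by simp
  then show ?thesis unfolding mod_hom_def by (simp add: lin_ext_add lin_ext_scale)
qed

lemma mod_homD:
  assumes "h \<in> mod_hom R M N" "x \<in> carrier M"
  shows "h x \<in> carrier N"
    and "y \<in> carrier M \<Longrightarrow> h (x \<oplus>\<^bsub>M\<^esub> y) = h x \<oplus>\<^bsub>N\<^esub> h y"
    and "c \<in> carrier R \<Longrightarrow> h (c \<odot>\<^bsub>M\<^esub> x) = c \<odot>\<^bsub>N\<^esub> h x"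
  using assms unfolding mod_hom_def by (blast dest: funcset_mem)+

lemma mod_hom_comp: "h \<in> mod_hom R M N \<Longrightarrow> g \<in> mod_hom R N L \<Longrightarrow> (\<lambda>x. g (h x)) \<in> mod_hom R M L"
  using mod_homD[of h R M N] mod_homD[of g R N L] unfolding mod_hom_def[of R M L]
  by (intro CollectI conjI ballI funcsetI) presburger+

lemma mod_hom_finsum:
  assumes "Module.module R M" "Module.module R N" "h \<in> mod_hom R M N" "finite S" "f \<in> S \<rightarrow> carrier M"
  shows "h (finsum M f S) = finsum N (\<lambda>x. h (f x)) S"
proof -
  interpret M: Module.module R M by fact
  interpret N: Module.module R N by fact
  have h: "h \<in> carrier M \<rightarrow> carrier N" using assms(3) by (simp add: mod_hom_def)
  have "\<zero>\<^bsub>N\<^esub> = h \<zero>\<^bsub>M\<^esub>"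
  proof -
    have "h (\<zero>\<^bsub>R\<^esub> \<odot>\<^bsub>M\<^esub> \<zero>\<^bsub>M\<^esub>) = \<zero>\<^bsub>R\<^esub> \<odot>\<^bsub>N\<^esub> h \<zero>\<^bsub>M\<^esub>"
      using assms(3) M.R.zero_closed M.M.zero_closed unfolding mod_hom_def by blast
    then show ?thesis using h by (simp add: Pi_iff)
  qed
  from assms(4,5) show ?thesis
  proof (induction S rule: finite_induct)
    case empty then show ?case using \<open>\<zero>\<^bsub>N\<^esub> = h \<zero>\<^bsub>M\<^esub>\<close> by simp
  next
    case (insert x S)
    then have "f x \<in> carrier M" "f \<in> S \<rightarrow> carrier M" by auto
    moreover from this have "(\<lambda>x. h (f x)) \<in> S \<rightarrow> carrier N" "h (f x) \<in> carrier N" using h by auto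
    ultimately show ?case using insert assms(3) by (simp add: mod_hom_def)
  qed
qed

lemma finsum_free_mod:
  assumes "finite S" "f \<in> S \<rightarrow> carrier (free_mod X)"
  shows "finsum (free_mod X) f S = sum f S"
proof -
  interpret Module.module scalars "free_mod X" by (rule module_free_mod)
  from assms show ?thesis
    by (induction S rule: finite_induct) (simp_all add: Pi_iff)
qed

definition lin_lift ::
  "('k::{comm_ring,comm_monoid_mult}, 'n, 'z) module_scheme \<Rightarrow> ('x \<Rightarrow> 'n) \<Rightarrow> ('x \<Rightarrow>\<^sub>0 'k) \<Rightarrow> 'n" where
  "lin_lift N f p = finsum N (\<lambda>x. Poly_Mapping.lookup p x \<odot>\<^bsub>N\<^esub> f x) (Poly_Mapping.keys p)"

lemma mod_hom_eq_lin_lift: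
  assumes N: "Module.module scalars N" and h: "h \<in> mod_hom scalars (free_mod X) N"
    and p: "Poly_Mapping.keys p \<subseteq> X"
  shows "h p = lin_lift N (\<lambda>x. h (basis x)) p"
proof -
  let ?K = "Poly_Mapping.keys p"
  have sm: "h (scale c (basis x)) = c \<odot>\<^bsub>N\<^esub> h (basis x)" if "x \<in> ?K" for c x
    using mod_homD(3)[OF h, of "basis x" c] that p keys_basis_subset[of x X] by auto
  have in_free: "(\<lambda>x. scale (Poly_Mapping.lookup p x) (basis x)) \<in> ?K \<rightarrow> carrier (free_mod X)"
    using p by (auto dest!: subsetD[OF keys_scale] subsetD[OF keys_basis])
  have hK: "h (basis x) \<in> carrier N" if "x \<in> ?K" for x
    using mod_homD(1)[OF h, of "basis x"] that p keys_basis_subset[of x X] by auto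
  interpret N: Module.module scalars N by fact
  have "h p = h (lin_ext basis p)" by (simp add: lin_ext_basis_id)
  also have "lin_ext basis p = finsum (free_mod X) (\<lambda>x. scale (Poly_Mapping.lookup p x) (basis x)) ?K"
    by (subst finsum_free_mod) (use in_free in \<open>auto simp: lin_ext_def\<close>)
  also have "h \<dots> = finsum N (\<lambda>x. h (scale (Poly_Mapping.lookup p x) (basis x))) ?K"
    by (rule mod_hom_finsum[OF module_free_mod N h]) (use in_free in auto)
  also have "\<dots> = lin_lift N (\<lambda>x. h (basis x)) p"
    unfolding lin_lift_def by (rule N.finsum_cong') (use sm hK in auto)
  finally show ?thesis .
qed

lemma mod_hom_free_eq:
  assumes N: "Module.module scalars N" and h: "h \<in> mod_hom scalars (free_mod X) N"
    and g: "g \<in> mod_hom scalars (free_mod X) N"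
    and eq: "\<And>x. x \<in> X \<Longrightarrow> h (basis x) = g (basis x)" and p: "Poly_Mapping.keys p \<subseteq> X"
  shows "h p = g p"
proof -
  interpret N: Module.module scalars N by fact
  have hK: "h (basis x) \<in> carrier N" if "x \<in> X" for x
    using mod_homD(1)[OF h, of "basis x"] that keys_basis_subset[of x X] by auto
  have "lin_lift N (\<lambda>x. h (basis x)) p = lin_lift N (\<lambda>x. g (basis x)) p"
    unfolding lin_lift_def
  proof (rule N.finsum_cong')
    show "(\<lambda>x. Poly_Mapping.lookup p x \<odot>\<^bsub>N\<^esub> g (basis x)) \<in> Poly_Mapping.keys p \<rightarrow> carrier N"
      using p hK eq N.smult_closed by fastforce
  qed (use p eq in auto)
  then show ?thesis
    using mod_hom_eq_lin_lift[OF N h p] mod_hom_eq_lin_lift[OF N g p] by simp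
qed

lemma lin_lift_superset:
  assumes N: "Module.module scalars N" and S: "finite S" "Poly_Mapping.keys p \<subseteq> S"
    and f: "f \<in> S \<rightarrow> carrier N"
  shows "lin_lift N f p = finsum N (\<lambda>x. Poly_Mapping.lookup p x \<odot>\<^bsub>N\<^esub> f x) S"
proof -
  interpret N: Module.module scalars N by fact
  have cl: "(\<lambda>x. Poly_Mapping.lookup p x \<odot>\<^bsub>N\<^esub> f x) \<in> S \<rightarrow> carrier N"
    using f N.smult_closed by auto
  show ?thesis unfolding lin_lift_def
  proof (rule N.add.finprod_mono_neutral_cong_left)
    fix x assume "x \<in> S - Poly_Mapping.keys p"
    then show "Poly_Mapping.lookup p x \<odot>\<^bsub>N\<^esub> f x = \<zero>\<^bsub>N\<^esub>"
      using f N.smult_l_null[of "f x"] by (auto simp: in_keys_iff)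
  qed (use S cl in auto)
qed

lemma lin_lift_mod_hom:
  fixes N :: "('k::{comm_ring,comm_monoid_mult}, 'n, 'z) module_scheme"
  assumes N: "Module.module scalars N" and f: "f \<in> X \<rightarrow> carrier N"
  shows "lin_lift N f \<in> mod_hom scalars (free_mod X) N"
proof -
  interpret N: Module.module scalars N by fact
  have sm: "c \<odot>\<^bsub>N\<^esub> n \<in> carrier N" if "n \<in> carrier N" for c n
    using that N.smult_closed by auto
  show ?thesis
    unfolding mod_hom_def
  proof (intro CollectI conjI ballI funcsetI)
    fix p assume p: "p \<in> carrier (free_mod X :: ('k, _) module)"
    then show "lin_lift N f p \<in> carrier N"
      unfolding lin_lift_def by (intro N.finsum_closed funcsetI sm) (use f in auto)
    fix q assume q: "q \<in> carrier (free_mod X :: ('k, _) module)"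
    let ?S = "Poly_Mapping.keys p \<union> Poly_Mapping.keys q"
    have f': "f \<in> ?S \<rightarrow> carrier N" using f p q by auto
    have cl: "(\<lambda>x. Poly_Mapping.lookup r x \<odot>\<^bsub>N\<^esub> f x) \<in> ?S \<rightarrow> carrier N" for r
      using f' by (intro funcsetI sm) (rule funcset_mem)
    have "lin_lift N f (p + q) =
        finsum N (\<lambda>x. Poly_Mapping.lookup (p + q) x \<odot>\<^bsub>N\<^esub> f x) ?S"
      by (rule lin_lift_superset[OF N _ _ f']) (simp_all add: Poly_Mapping.keys_add)
    also have "\<dots> = finsum N
        (\<lambda>x. Poly_Mapping.lookup p x \<odot>\<^bsub>N\<^esub> f x \<oplus>\<^bsub>N\<^esub> Poly_Mapping.lookup q x \<odot>\<^bsub>N\<^esub> f x) ?S"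
    proof (rule N.finsum_cong')
      show "(\<lambda>x. Poly_Mapping.lookup p x \<odot>\<^bsub>N\<^esub> f x \<oplus>\<^bsub>N\<^esub> Poly_Mapping.lookup q x \<odot>\<^bsub>N\<^esub> f x)
          \<in> ?S \<rightarrow> carrier N"
        by (intro funcsetI N.add.m_closed funcset_mem[OF cl])
      fix x assume "x \<in> ?S"
      then have "f x \<in> carrier N" using f' by (rule funcset_mem[rotated])
      then show "Poly_Mapping.lookup (p + q) x \<odot>\<^bsub>N\<^esub> f x =
          Poly_Mapping.lookup p x \<odot>\<^bsub>N\<^esub> f x \<oplus>\<^bsub>N\<^esub> Poly_Mapping.lookup q x \<odot>\<^bsub>N\<^esub> f x"
        using N.smult_l_distr[of _ _ "f x"] by (simp add: lookup_add)
    qed simp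
    also have "\<dots> = finsum N (\<lambda>x. Poly_Mapping.lookup p x \<odot>\<^bsub>N\<^esub> f x) ?S \<oplus>\<^bsub>N\<^esub>
        finsum N (\<lambda>x. Poly_Mapping.lookup q x \<odot>\<^bsub>N\<^esub> f x) ?S"
      by (rule N.finsum_addf[OF cl cl])
    also have "\<dots> = lin_lift N f p \<oplus>\<^bsub>N\<^esub> lin_lift N f q"
      by (simp add: lin_lift_superset[OF N _ _ f'])
    finally show "lin_lift N f (p \<oplus>\<^bsub>free_mod X\<^esub> q) = lin_lift N f p \<oplus>\<^bsub>N\<^esub> lin_lift N f q" by simp
  next
    fix c p assume p: "p \<in> carrier (free_mod X :: ('k, _) module)"
    let ?S = "Poly_Mapping.keys p"
    have f': "f \<in> ?S \<rightarrow> carrier N" using f p by auto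
    have cl: "(\<lambda>x. Poly_Mapping.lookup r x \<odot>\<^bsub>N\<^esub> f x) \<in> ?S \<rightarrow> carrier N" for r
      using f' by (intro funcsetI sm) (rule funcset_mem)
    have hom: "(\<odot>\<^bsub>N\<^esub>) c \<in> mod_hom scalars N N"
    proof -
      have "c \<odot>\<^bsub>N\<^esub> (d \<odot>\<^bsub>N\<^esub> n) = d \<odot>\<^bsub>N\<^esub> (c \<odot>\<^bsub>N\<^esub> n)" if "n \<in> carrier N" for d n
        using N.smult_assoc1[of c d n] N.smult_assoc1[of d c n] that by (simp add: mult.commute)
      then show ?thesis
        using N.smult_r_distr[of c] sm by (simp add: mod_hom_def)
    qed
    have "lin_lift N f (scale c p) = finsum N (\<lambda>x. Poly_Mapping.lookup (scale c p) x \<odot>\<^bsub>N\<^esub> f x) ?S"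
      by (rule lin_lift_superset[OF N _ _ f']) (simp_all add: keys_scale)
    also have "\<dots> = finsum N (\<lambda>x. c \<odot>\<^bsub>N\<^esub> (Poly_Mapping.lookup p x \<odot>\<^bsub>N\<^esub> f x)) ?S"
    proof (rule N.finsum_cong')
      show "(\<lambda>x. c \<odot>\<^bsub>N\<^esub> (Poly_Mapping.lookup p x \<odot>\<^bsub>N\<^esub> f x)) \<in> ?S \<rightarrow> carrier N"
        by (intro funcsetI sm funcset_mem[OF cl])
      fix x assume "x \<in> ?S"
      then have "f x \<in> carrier N" using f' by (rule funcset_mem[rotated])
      then show "Poly_Mapping.lookup (scale c p) x \<odot>\<^bsub>N\<^esub> f x =
          c \<odot>\<^bsub>N\<^esub> (Poly_Mapping.lookup p x \<odot>\<^bsub>N\<^esub> f x)"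
        using N.smult_assoc1[of _ _ "f x"] by simp
    qed simp
    also have "\<dots> = c \<odot>\<^bsub>N\<^esub> lin_lift N f p"
      unfolding lin_lift_def by (rule mod_hom_finsum[OF N N hom _ cl, symmetric]) simp
    finally show "lin_lift N f (c \<odot>\<^bsub>free_mod X\<^esub> p) = c \<odot>\<^bsub>N\<^esub> lin_lift N f p" by simp
  qed
qed

lemma lin_lift_basis:
  assumes N: "Module.module scalars N" and f: "f x \<in> carrier N"
  shows "lin_lift N f (basis x) = f x"
proof -
  interpret N: Module.module scalars N by fact
  have "1 \<odot>\<^bsub>N\<^esub> f x = f x" using N.smult_one[OF f] by simp
  then show ?thesis
    by (subst lin_lift_superset[OF N, of "{x}"]) (use f keys_basis[of x] in \<open>auto simp: lookup_basis\<close>)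
qed

lemma leaves_map_pbt: "leaves (map_pbt \<sigma> f t) = map \<sigma> (leaves t)"
  by (induction t) simp_all

lemma map_pbt_cong_leaves:
  "(\<And>a. a \<in> set (leaves t) \<Longrightarrow> \<sigma> a = \<tau> a) \<Longrightarrow> map_pbt \<sigma> f t = map_pbt \<tau> f t"
  by (induction t) simp_all

lemma subst_leaf_notin: "a \<notin> set (leaves t) \<Longrightarrow> subst_leaf a s t = t"
  by (induction t) simp_all

lemma set_leaves_subst:
  "set (leaves (subst_leaf a s t)) =
    (if a \<in> set (leaves t) then set (leaves t) - {a} \<union> set (leaves s) else set (leaves t))"
  by (induction t) auto

lemma distinct_leaves_subst:
  "\<lbrakk>distinct (leaves t); distinct (leaves s); set (leaves t) \<inter> set (leaves s) = {}\<rbrakk> \<Longrightarrow>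
    distinct (leaves (subst_leaf a s t))"
  by (induction t) (auto simp: set_leaves_subst split: if_splits)

lemma subst_leaf_pbts:
  "\<lbrakk>t \<in> pbts A; s \<in> pbts B; A \<inter> B = {}; a \<in> A\<rbrakk> \<Longrightarrow> subst_leaf a s t \<in> pbts (A - {a} \<union> B)"
  by (simp add: pbts_def distinct_leaves_subst set_leaves_subst)

lemma map_pbt_pbts: "\<lbrakk>t \<in> pbts A; inj_on \<sigma> A\<rbrakk> \<Longrightarrow> map_pbt \<sigma> id t \<in> pbts (\<sigma> ` A)"
  by (auto simp: pbts_def leaves_map_pbt distinct_map)

lemma map_subst_leaf:
  "inj_on \<sigma> (insert a (set (leaves t))) \<Longrightarrow>
    map_pbt \<sigma> id (subst_leaf a s t) = subst_leaf (\<sigma> a) (map_pbt \<sigma> id s) (map_pbt \<sigma> id t)"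
  by (induction t) (auto simp: inj_on_def)

lemma subst_leaf_sequential:
  "b \<notin> set (leaves t) \<Longrightarrow> subst_leaf b u (subst_leaf a s t) = subst_leaf a (subst_leaf b u s) t"
  by (induction t) auto

lemma subst_leaf_parallel:
  "\<lbrakk>a \<noteq> a'; a' \<notin> set (leaves s); a \<notin> set (leaves u)\<rbrakk> \<Longrightarrow>
    subst_leaf a' u (subst_leaf a s t) = subst_leaf a s (subst_leaf a' u t)"
  by (induction t) (auto simp: subst_leaf_notin)

lemma subst_leaf_Leaf: "subst_leaf a (Leaf b) t = map_pbt (id(a := b)) id t"
  by (induction t) simp_all

lemma free_operad_simps [simp]:
  "component free_operad A = free_mod (pbts A)"
  "relabel free_operad \<sigma> A = lin_ext (\<lambda>t. basis (map_pbt \<sigma> id t))"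
  "ident free_operad a = basis (Leaf a)"
  "pcomp free_operad A a B p q = lin_ext (\<lambda>t. lin_ext (\<lambda>s. basis (subst_leaf a s t)) q) p"
  by (simp_all add: free_operad_def)

lemma mod_hom_lin_ext_fun:
  assumes "\<And>x. x \<in> X \<Longrightarrow> h x \<in> mod_hom scalars (free_mod Y) (free_mod Z)"
    and "Poly_Mapping.keys p \<subseteq> X"
  shows "(\<lambda>q. lin_ext (\<lambda>x. h x q) p) \<in> mod_hom scalars (free_mod Y) (free_mod Z)"
proof -
  have h: "h x \<in> mod_hom scalars (free_mod Y) (free_mod Z)" if "x \<in> Poly_Mapping.keys p" for x
    using assms that by blast
  have "Poly_Mapping.keys (lin_ext (\<lambda>x. h x q) p) \<subseteq> Z" if "Poly_Mapping.keys q \<subseteq> Y" for q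
    by (rule keys_lin_ext) (use mod_homD(1)[OF h, of _ q] that in auto)
  moreover have "lin_ext (\<lambda>x. h x (q + r)) p = lin_ext (\<lambda>x. h x q) p + lin_ext (\<lambda>x. h x r) p"
    if "Poly_Mapping.keys q \<subseteq> Y" "Poly_Mapping.keys r \<subseteq> Y" for q r
    unfolding lin_ext_add_fun[symmetric]
    by (rule lin_ext_cong[OF refl]) (use mod_homD(2)[OF h, of _ q r] that in auto)
  moreover have "lin_ext (\<lambda>x. h x (scale c q)) p = scale c (lin_ext (\<lambda>x. h x q) p)"
    if "Poly_Mapping.keys q \<subseteq> Y" for c q
    unfolding lin_ext_scale_fun[symmetric]
    by (rule lin_ext_cong[OF refl]) (use mod_homD(3)[OF h, of _ q c] that in auto)
  ultimately show ?thesis by (simp add: mod_hom_def)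
qed

theorem operad_free_operad:
  "operad (free_operad :: ('l, 'k::{comm_ring,comm_monoid_mult}, ('l, 'w) pbt \<Rightarrow>\<^sub>0 'k) operad)"
    (is "operad ?F")
proof (intro operad.intro species.intro operad_axioms.intro)
  fix A :: "'l set" and \<sigma> :: "'l \<Rightarrow> 'l"
  show "Module.module scalars (component ?F A)"
    by (simp add: module_free_mod)
  assume \<sigma>: "inj_on \<sigma> A"
  show "relabel ?F \<sigma> A \<in> mod_hom scalars (component ?F A) (component ?F (\<sigma> ` A))"
    unfolding free_operad_simps
    by (rule lin_ext_mod_hom) (intro keys_basis_subset map_pbt_pbts \<sigma>)
  fix x assume x: "x \<in> elts ?F A"
  { fix \<tau> :: "'l \<Rightarrow> 'l" assume "\<And>a. a \<in> A \<Longrightarrow> \<sigma> a = \<tau> a"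
    then show "relabel ?F \<sigma> A x = relabel ?F \<tau> A x"
      unfolding free_operad_simps
      by (intro lin_ext_cong refl arg_cong[of _ _ basis] map_pbt_cong_leaves)
        (use x in \<open>auto simp: pbts_def\<close>) }
  fix \<tau> :: "'l \<Rightarrow> 'l"
  show "relabel ?F \<tau> (\<sigma> ` A) (relabel ?F \<sigma> A x) = relabel ?F (\<tau> \<circ> \<sigma>) A x"
    by (simp add: lin_ext_lin_ext pbt.map_comp)
next
  fix A :: "'l set" and x assume "x \<in> elts ?F A"
  show "relabel ?F id A x = x"
    by (simp add: pbt.map_id lin_ext_basis_id)
next
  fix A B :: "'l set" and a y
  assume "A \<inter> B = {}" "a \<in> A" "y \<in> elts ?F B"
  then show "(\<lambda>x. pcomp ?F A a B x y) \<in> mod_hom scalars (component ?F A) (component ?F (A - {a} \<union> B))"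
    unfolding free_operad_simps
    by (intro lin_ext_mod_hom keys_lin_ext keys_basis_subset subst_leaf_pbts) auto
next
  fix A B :: "'l set" and a x
  assume "A \<inter> B = {}" "a \<in> A" "x \<in> elts ?F A"
  then show "pcomp ?F A a B x \<in> mod_hom scalars (component ?F B) (component ?F (A - {a} \<union> B))"
    by (simp add: free_operad_def)
      (intro mod_hom_lin_ext_fun[where X = "pbts A"] lin_ext_mod_hom keys_basis_subset subst_leaf_pbts)
next
  fix A B :: "'l set" and a and \<sigma> :: "'l \<Rightarrow> 'l" and x y
  assume *: "a \<in> A" "inj_on \<sigma> (A \<union> B)" "x \<in> elts ?F A" "y \<in> elts ?F B"
  have "inj_on \<sigma> (insert a (set (leaves t)))" if "t \<in> Poly_Mapping.keys x" for t
  proof (rule inj_on_subset[OF \<open>inj_on \<sigma> (A \<union> B)\<close>])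
    show "insert a (set (leaves t)) \<subseteq> A \<union> B" using that * by (auto simp: pbts_def)
  qed
  then show "relabel ?F \<sigma> (A - {a} \<union> B) (pcomp ?F A a B x y) =
      pcomp ?F (\<sigma> ` A) (\<sigma> a) (\<sigma> ` B) (relabel ?F \<sigma> A x) (relabel ?F \<sigma> B y)"
    by (auto simp: lin_ext_lin_ext map_subst_leaf intro!: lin_ext_cong)
next
  fix A B C :: "'l set" and a b x y z
  assume *: "A \<inter> B = {}" "b \<in> B" "x \<in> elts ?F A"
  have "b \<notin> set (leaves t)" if "t \<in> Poly_Mapping.keys x" for t
    using that * by (auto simp: pbts_def)
  then show "pcomp ?F (A - {a} \<union> B) b C (pcomp ?F A a B x y) z =
      pcomp ?F A a (B - {b} \<union> C) x (pcomp ?F B b C y z)"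
    by (auto simp: lin_ext_lin_ext subst_leaf_sequential intro!: lin_ext_cong)
next
  fix A B C :: "'l set" and a a' x y z
  assume *: "A \<inter> B = {}" "A \<inter> C = {}" "a \<in> A" "a' \<in> A" "a \<noteq> a'"
    "x \<in> elts ?F A" "y \<in> elts ?F B" "z \<in> elts ?F C"
  have s: "a' \<notin> set (leaves s)" if "s \<in> Poly_Mapping.keys y" for s
    using that * by (auto simp: pbts_def)
  have u: "a \<notin> set (leaves u)" if "u \<in> Poly_Mapping.keys z" for u
    using that * by (auto simp: pbts_def)
  have "lin_ext (\<lambda>s. lin_ext (\<lambda>u. basis (subst_leaf a' u (subst_leaf a s t))) z) y =
      lin_ext (\<lambda>u. lin_ext (\<lambda>s. basis (subst_leaf a s (subst_leaf a' u t))) y) z" for t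
    by (subst lin_ext_swap) (auto simp: subst_leaf_parallel[OF \<open>a \<noteq> a'\<close> s u] intro!: lin_ext_cong)
  then show "pcomp ?F (A - {a} \<union> B) a' C (pcomp ?F A a B x y) z =
      pcomp ?F (A - {a'} \<union> C) a B (pcomp ?F A a' C x z) y"
    by (simp add: lin_ext_lin_ext)
next
  fix a :: 'l
  show "ident ?F a \<in> elts ?F {a}"
    by (simp add: keys_basis_subset pbts_def)
next
  fix \<sigma> :: "'l \<Rightarrow> 'l" and a
  show "relabel ?F \<sigma> {a} (ident ?F a) = ident ?F (\<sigma> a)" by simp
next
  fix a :: 'l and B y
  show "pcomp ?F {a} a B (ident ?F a) y = y" by (simp add: lin_ext_basis_id)
next
  fix A :: "'l set" and a b x
  show "pcomp ?F A a {b} x (ident ?F b) = relabel ?F (id(a := b)) A x"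
    by (simp add: subst_leaf_Leaf)
qed

lemma (in operad) pcomp_closed:
  "\<lbrakk>finite A; finite B; A \<inter> B = {}; a \<in> A; x \<in> elts P A; y \<in> elts P B\<rbrakk> \<Longrightarrow>
    pcomp P A a B x y \<in> elts P (A - {a} \<union> B)"
  by (rule mod_homD(1)[OF pcomp_hom_right])

lemma (in species) relabel_closed:
  "\<lbrakk>finite A; inj_on \<sigma> A; x \<in> elts P A\<rbrakk> \<Longrightarrow> relabel P \<sigma> A x \<in> elts P (\<sigma> ` A)"
  by (rule mod_homD(1)[OF relabel_hom])

lemma species_hom_mod_hom:
  "species_hom P Q \<Phi> \<Longrightarrow> finite A \<Longrightarrow> \<Phi> A \<in> mod_hom scalars (component P A) (component Q A)"
  by (simp add: species_hom_def)

lemma gen_species_simps: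
  "component gen_species A = free_mod {(\<omega>, a, b) | \<omega> a b. a \<noteq> b \<and> A = {a, b}}"
  "relabel gen_species \<sigma> A = lin_ext (\<lambda>(\<omega>, a, b). basis (\<omega>, \<sigma> a, \<sigma> b))"
  by (simp_all add: gen_species_def)

lemma species_hom_free_operad_incl: "species_hom gen_species free_operad free_operad_incl"
  unfolding species_hom_def
proof (intro conjI allI impI)
  fix A :: "'l set"
  show "free_operad_incl A \<in> mod_hom scalars (component gen_species A) (component free_operad A)"
    unfolding free_operad_incl_def gen_species_simps free_operad_simps
  proof (rule lin_ext_mod_hom)
    fix e :: "'w \<times> 'l \<times> 'l" assume "e \<in> {(\<omega>, a, b) | \<omega> a b. a \<noteq> b \<and> A = {a, b}}"
    then obtain \<omega> a b where e: "e = (\<omega>, a, b)" "a \<noteq> b" "A = {a, b}" by blast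
    then have "Node \<omega> (Leaf a) (Leaf b) \<in> pbts A" by (simp add: pbts_def)
    then show "Poly_Mapping.keys (case e of (\<omega>, a, b) \<Rightarrow> basis (Node \<omega> (Leaf a) (Leaf b))) \<subseteq> pbts A"
      using e(1) keys_basis_subset by simp
  qed
  fix \<sigma> :: "'l \<Rightarrow> 'l" and x
  show "free_operad_incl (\<sigma> ` A) (relabel gen_species \<sigma> A x) =
      relabel free_operad \<sigma> A (free_operad_incl A x)"
    by (simp add: gen_species_simps free_operad_incl_def lin_ext_lin_ext case_prod_unfold)
qed

lemma basis_gen_species: "a \<noteq> b \<Longrightarrow> basis (\<omega>, a, b) \<in> elts gen_species {a, b}"
  unfolding gen_species_simps free_mod_simps mem_Collect_eq by (rule keys_basis_subset) blast

locale gen_target = operad Q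
  for Q :: "('l::infinite, 'k::{comm_ring,comm_monoid_mult}, 'q, 'z) operad_scheme" +
  fixes \<phi> :: "'l set \<Rightarrow> (('w \<times> 'l \<times> 'l) \<Rightarrow>\<^sub>0 'k) \<Rightarrow> 'q"
  assumes \<phi>: "species_hom gen_species Q \<phi>"
begin

definition g :: "'w \<Rightarrow> 'l \<Rightarrow> 'l \<Rightarrow> 'q" where
  "g \<omega> a b = \<phi> {a, b} (basis (\<omega>, a, b))"

lemma g_closed: "a \<noteq> b \<Longrightarrow> g \<omega> a b \<in> elts Q {a, b}"
proof -
  assume "a \<noteq> b"
  have "\<phi> {a, b} \<in> mod_hom scalars (component gen_species {a, b}) (component Q {a, b})"
    by (rule species_hom_mod_hom[OF \<phi>]) simp
  from mod_homD(1)[OF this basis_gen_species[OF \<open>a \<noteq> b\<close>]]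
  show "g \<omega> a b \<in> elts Q {a, b}" by (simp add: g_def)
qed

lemma relabel_g:
  assumes "a \<noteq> b" "inj_on \<sigma> {a, b}"
  shows "relabel Q \<sigma> {a, b} (g \<omega> a b) = g \<omega> (\<sigma> a) (\<sigma> b)"
proof -
  have "basis (\<omega>, a, b) \<in> elts gen_species {a, b}"
    using assms(1) by (rule basis_gen_species)
  then have "relabel Q \<sigma> {a, b} (\<phi> {a, b} (basis (\<omega>, a, b))) =
      \<phi> (\<sigma> ` {a, b}) (relabel gen_species \<sigma> {a, b} (basis (\<omega>, a, b)))"
    using \<phi> assms(2) unfolding species_hom_def by (metis finite.emptyI finite.insertI)
  then show ?thesis by (simp add: g_def gen_species_simps)
qed

definition fresh :: "'l \<Rightarrow> 'l \<Rightarrow> 'l set \<Rightarrow> bool" where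
  "fresh s s' A \<longleftrightarrow> s \<noteq> s' \<and> s \<notin> A \<and> s' \<notin> A"

lemma ex_fresh: "finite A \<Longrightarrow> \<exists>s s'. fresh s s' A"
  using arb_element[of A] arb_element[of "insert s A" for s] unfolding fresh_def
  by (metis finite_insert insert_iff)

definition mul_at :: "'l \<Rightarrow> 'l \<Rightarrow> 'w \<Rightarrow> 'l set \<Rightarrow> 'l set \<Rightarrow> 'q \<Rightarrow> 'q \<Rightarrow> 'q" where
  "mul_at s s' \<omega> L R x y =
    pcomp Q (insert s' L) s' R (pcomp Q {s, s'} s L (g \<omega> s s') x) y"

lemma half_closed:
  assumes "finite L" "fresh s s' L" "x \<in> elts Q L"
  shows "pcomp Q {s, s'} s L (g \<omega> s s') x \<in> elts Q (insert s' L)"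
proof -
  have "{s, s'} - {s} \<union> L = insert s' L" using assms by (auto simp: fresh_def)
  then show ?thesis
    using pcomp_closed[of "{s, s'}" L s "g \<omega> s s'" x] assms g_closed[of s s' \<omega>]
    by (simp add: fresh_def)
qed

lemma mul_at_closed:
  assumes "finite L" "finite R" "L \<inter> R = {}" "fresh s s' (L \<union> R)" "x \<in> elts Q L" "y \<in> elts Q R"
  shows "mul_at s s' \<omega> L R x y \<in> elts Q (L \<union> R)"
proof -
  have "insert s' L - {s'} \<union> R = L \<union> R" using assms by (auto simp: fresh_def)
  moreover have "fresh s s' L" using assms by (simp add: fresh_def)
  ultimately show ?thesis
    using pcomp_closed[OF _ _ _ _ half_closed[of L s s' x \<omega>], of R s' y] assms
    by (simp add: fresh_def mul_at_def)
qed

lemma relabel_mul_at: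
  assumes fin: "finite L" "finite R" "L \<inter> R = {}" and s: "fresh s s' (L \<union> R)"
    and xy: "x \<in> elts Q L" "y \<in> elts Q R"
    and \<sigma>: "inj_on \<sigma> (L \<union> R)" and t: "fresh t t' (\<sigma> ` (L \<union> R))"
  shows "relabel Q \<sigma> (L \<union> R) (mul_at s s' \<omega> L R x y) =
    mul_at t t' \<omega> (\<sigma> ` L) (\<sigma> ` R) (relabel Q \<sigma> L x) (relabel Q \<sigma> R y)"
proof -
  define \<tau> where "\<tau> = \<sigma>(s := t, s' := t')"
  have eq: "\<tau> a = \<sigma> a" if "a \<in> L \<union> R" for a using that s by (auto simp: \<tau>_def fresh_def)
  have im: "\<tau> ` L = \<sigma> ` L" "\<tau> ` R = \<sigma> ` R" using eq by (auto simp: image_def)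
  have st: "\<tau> s = t" "\<tau> s' = t'" using s by (simp_all add: \<tau>_def fresh_def)
  have inj: "inj_on \<tau> (insert s (insert s' (L \<union> R)))"
  proof -
    have "inj_on \<tau> (L \<union> R)" using \<sigma> eq inj_on_cong[of "L \<union> R" \<tau> \<sigma>] by blast
    moreover have "\<tau> ` (L \<union> R) = \<sigma> ` (L \<union> R)" using im by (simp add: image_Un)
    ultimately show ?thesis using s t st by (auto simp: fresh_def)
  qed
  have sub: "inj_on \<tau> A" if "A \<subseteq> insert s (insert s' (L \<union> R))" for A
    by (rule inj_on_subset[OF inj that])
  have sL: "fresh s s' L" using s by (simp add: fresh_def)
  have e1: "{s, s'} - {s} \<union> L = insert s' L" "insert s' L - {s'} \<union> R = L \<union> R"
    using s by (auto simp: fresh_def)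
  have gst: "relabel Q \<tau> {s, s'} (g \<omega> s s') = g \<omega> t t'"
    using relabel_g[of s s' \<tau> \<omega>] s sub[of "{s, s'}"] st by (simp add: fresh_def)
  have "relabel Q \<tau> (insert s' L) (pcomp Q {s, s'} s L (g \<omega> s s') x) =
      pcomp Q {t, t'} t (\<sigma> ` L) (g \<omega> t t') (relabel Q \<tau> L x)"
    using relabel_pcomp[of "{s, s'}" L s \<tau> "g \<omega> s s'" x] fin s xy g_closed[of s s' \<omega>]
      sub[of "{s, s'} \<union> L"] gst st im
    by (simp add: fresh_def e1 subset_insertI2)
  then have "relabel Q \<tau> (L \<union> R) (mul_at s s' \<omega> L R x y) =
      mul_at t t' \<omega> (\<sigma> ` L) (\<sigma> ` R) (relabel Q \<tau> L x) (relabel Q \<tau> R y)"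
    using relabel_pcomp[OF _ _ _ _ _ half_closed[OF \<open>finite L\<close> sL xy(1)], of R s' \<tau> y \<omega>]
      fin s xy sub[of "insert s' L \<union> R"] st im
    by (simp add: fresh_def e1 mul_at_def subset_insertI2)
  moreover have "relabel Q \<tau> (L \<union> R) (mul_at s s' \<omega> L R x y) = relabel Q \<sigma> (L \<union> R) (mul_at s s' \<omega> L R x y)"
    by (rule relabel_cong) (use fin sub[of "L \<union> R"] eq mul_at_closed[OF fin s xy] in auto)
  moreover have "relabel Q \<tau> L x = relabel Q \<sigma> L x"
    by (rule relabel_cong) (use fin xy sub[of L] eq in auto)
  moreover have "relabel Q \<tau> R y = relabel Q \<sigma> R y"
    by (rule relabel_cong) (use fin xy sub[of R] eq in auto)
  ultimately show ?thesis by simp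
qed

definition mul :: "'w \<Rightarrow> 'l set \<Rightarrow> 'l set \<Rightarrow> 'q \<Rightarrow> 'q \<Rightarrow> 'q" where
  "mul \<omega> L R x y = (let (s, s') = (SOME (s, s'). fresh s s' (L \<union> R)) in mul_at s s' \<omega> L R x y)"

lemma mul_eq:
  assumes fin: "finite L" "finite R" "L \<inter> R = {}" and s: "fresh s s' (L \<union> R)"
    and xy: "x \<in> elts Q L" "y \<in> elts Q R"
  shows "mul \<omega> L R x y = mul_at s s' \<omega> L R x y"
proof -
  obtain t t' where tt: "(SOME (s, s'). fresh s s' (L \<union> R)) = (t, t')" by fastforce
  have "fresh t t' (L \<union> R)"
    using someI[of "\<lambda>(s, s'). fresh s s' (L \<union> R)" "(s, s')"] s tt by simp
  then have "relabel Q id (L \<union> R) (mul_at s s' \<omega> L R x y) =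
      mul_at t t' \<omega> L R (relabel Q id L x) (relabel Q id R y)"
    using relabel_mul_at[OF fin s xy, of id t t' \<omega>] by simp
  then show ?thesis
    using fin xy mul_at_closed[OF fin s xy] by (simp add: relabel_id mul_def tt)
qed

primrec ev :: "('l, 'w) pbt \<Rightarrow> 'q" where
  "ev (Leaf a) = ident Q a"
| "ev (Node \<omega> l r) = mul \<omega> (set (leaves l)) (set (leaves r)) (ev l) (ev r)"

lemma ev_Node:
  assumes "distinct (leaves (Node \<omega> l r))" "fresh s s' (set (leaves l) \<union> set (leaves r))"
    "ev l \<in> elts Q (set (leaves l))" "ev r \<in> elts Q (set (leaves r))"
  shows "ev (Node \<omega> l r) = mul_at s s' \<omega> (set (leaves l)) (set (leaves r)) (ev l) (ev r)"
  using assms by (simp add: mul_eq)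

lemma ev_closed: "distinct (leaves t) \<Longrightarrow> ev t \<in> elts Q (set (leaves t))"
proof (induction t)
  case (Leaf a) then show ?case by (simp add: ident_closed)
next
  case (Node \<omega> l r)
  obtain s s' where s: "fresh s s' (set (leaves l) \<union> set (leaves r))"
    using ex_fresh[of "set (leaves l) \<union> set (leaves r)"] by auto
  have "ev l \<in> elts Q (set (leaves l))" "ev r \<in> elts Q (set (leaves r))" using Node by simp_all
  with Node.prems s show ?case
    by (subst ev_Node[OF _ s]) (auto intro!: mul_at_closed)
qed

lemma ev_map:
  "\<lbrakk>distinct (leaves t); inj_on \<sigma> (set (leaves t))\<rbrakk> \<Longrightarrow>
    ev (map_pbt \<sigma> id t) = relabel Q \<sigma> (set (leaves t)) (ev t)"
proof (induction t)
  case (Leaf a) then show ?case by (simp add: relabel_ident)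
next
  case (Node \<omega> l r)
  let ?L = "set (leaves l)" and ?R = "set (leaves r)"
  obtain s s' where s: "fresh s s' (?L \<union> ?R)" using ex_fresh[of "?L \<union> ?R"] by auto
  obtain t t' where t: "fresh t t' (\<sigma> ` (?L \<union> ?R))" using ex_fresh[of "\<sigma> ` (?L \<union> ?R)"] by auto
  have inj: "inj_on \<sigma> (?L \<union> ?R)" using Node.prems by simp
  have injs: "inj_on \<sigma> ?L" "inj_on \<sigma> ?R" using inj by (auto intro: inj_on_subset)
  have dis: "?L \<inter> ?R = {}" "distinct (leaves l)" "distinct (leaves r)" using Node.prems by simp_all
  have dis': "distinct (leaves (map_pbt \<sigma> id l))" "distinct (leaves (map_pbt \<sigma> id r))"
    using dis injs by (simp_all add: leaves_map_pbt distinct_map)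
  have d: "distinct (leaves (map_pbt \<sigma> id (Node \<omega> l r)))"
    using Node.prems by (simp only: leaves_map_pbt distinct_map)
  have "ev (map_pbt \<sigma> id (Node \<omega> l r)) = mul_at t t' \<omega> (\<sigma> ` ?L) (\<sigma> ` ?R)
      (ev (map_pbt \<sigma> id l)) (ev (map_pbt \<sigma> id r))"
    using ev_Node[of \<omega> "map_pbt \<sigma> id l" "map_pbt \<sigma> id r" t t'] d t
      ev_closed[OF dis'(1)] ev_closed[OF dis'(2)]
    by (simp add: leaves_map_pbt image_Un)
  also have "ev (map_pbt \<sigma> id l) = relabel Q \<sigma> ?L (ev l)" by (rule Node.IH(1)[OF dis(2) injs(1)])
  also have "ev (map_pbt \<sigma> id r) = relabel Q \<sigma> ?R (ev r)" by (rule Node.IH(2)[OF dis(3) injs(2)])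
  also have "mul_at t t' \<omega> (\<sigma> ` ?L) (\<sigma> ` ?R) (relabel Q \<sigma> ?L (ev l)) (relabel Q \<sigma> ?R (ev r)) =
      relabel Q \<sigma> (?L \<union> ?R) (mul_at s s' \<omega> ?L ?R (ev l) (ev r))"
    using relabel_mul_at[OF _ _ dis(1) s ev_closed[OF dis(2)] ev_closed[OF dis(3)] inj t, of \<omega>]
    by simp
  also have "mul_at s s' \<omega> ?L ?R (ev l) (ev r) = ev (Node \<omega> l r)"
    using ev_Node[OF Node.prems(1) s ev_closed[OF dis(2)] ev_closed[OF dis(3)]] by simp
  finally show ?case by simp
qed

lemma ev_subst:
  "\<lbrakk>distinct (leaves t); distinct (leaves u); set (leaves t) \<inter> set (leaves u) = {}; a \<in> set (leaves t)\<rbrakk> \<Longrightarrow>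
    ev (subst_leaf a u t) = pcomp Q (set (leaves t)) a (set (leaves u)) (ev t) (ev u)"
proof (induction t)
  case (Leaf b)
  then show ?case by (simp add: pcomp_ident_left ev_closed)
next
  case (Node \<omega> l r)
  let ?L = "set (leaves l)" and ?R = "set (leaves r)" and ?U = "set (leaves u)"
  obtain s s' where s: "fresh s s' (?L \<union> ?R \<union> ?U)" using ex_fresh[of "?L \<union> ?R \<union> ?U"] by auto
  have dis: "?L \<inter> ?R = {}" "?L \<inter> ?U = {}" "?R \<inter> ?U = {}" "distinct (leaves l)" "distinct (leaves r)"
    using Node.prems by auto
  have cl: "ev l \<in> elts Q ?L" "ev r \<in> elts Q ?R" "ev u \<in> elts Q ?U"
    using ev_closed dis Node.prems(2) by auto
  let ?X = "pcomp Q {s, s'} s ?L (g \<omega> s s') (ev l)"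
  have s1: "fresh s s' (?L \<union> ?R)" "fresh s s' ?L" using s by (auto simp: fresh_def)
  have X: "?X \<in> elts Q (insert s' ?L)" by (rule half_closed) (use s1 cl in auto)
  have gcl: "g \<omega> s s' \<in> elts Q {s, s'}" using g_closed s by (simp add: fresh_def)
  have evN: "ev (Node \<omega> l r) = pcomp Q (insert s' ?L) s' ?R ?X (ev r)"
    using ev_Node[OF Node.prems(1) s1(1) cl(1,2)] by (simp add: mul_at_def)
  have dN: "distinct (leaves (subst_leaf a u (Node \<omega> l r)))"
    by (rule distinct_leaves_subst) (use Node.prems in auto)
  have e: "insert s' ?L - {s'} \<union> ?R = ?L \<union> ?R" "{s, s'} - {s} \<union> ?L = insert s' ?L"
    using s by (auto simp: fresh_def)
  show ?case
  proof (cases "a \<in> ?L")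
    case True
    then have aR: "a \<notin> ?R" using dis by auto
    have dl: "distinct (leaves (subst_leaf a u l))"
      by (rule distinct_leaves_subst) (use dis Node.prems in auto)
    have sl: "set (leaves (subst_leaf a u l)) = ?L - {a} \<union> ?U" using True by (simp add: set_leaves_subst)
    have f: "fresh s s' (?L - {a} \<union> ?U \<union> ?R)" using s by (auto simp: fresh_def)
    have IH: "ev (subst_leaf a u l) = pcomp Q ?L a ?U (ev l) (ev u)"
      by (rule Node.IH(1)) (use True dis Node.prems in auto)
    have "ev (subst_leaf a u (Node \<omega> l r)) = mul_at s s' \<omega> (?L - {a} \<union> ?U) ?R
        (pcomp Q ?L a ?U (ev l) (ev u)) (ev r)"
      using ev_Node[of \<omega> "subst_leaf a u l" r s s'] dN f ev_closed[OF dl] cl aR IH sl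
      by (simp add: subst_leaf_notin)
    also have "\<dots> = pcomp Q (insert s' (?L - {a} \<union> ?U)) s' ?R
        (pcomp Q (insert s' ?L) a ?U ?X (ev u)) (ev r)"
      using pcomp_sequential[of "{s, s'}" ?L ?U s a "g \<omega> s s'" "ev l" "ev u"] s True dis cl gcl
      by (simp add: mul_at_def e fresh_def)
    also have "insert s' (?L - {a} \<union> ?U) = insert s' ?L - {a} \<union> ?U" using s True by (auto simp: fresh_def)
    also have "pcomp Q (insert s' ?L - {a} \<union> ?U) s' ?R (pcomp Q (insert s' ?L) a ?U ?X (ev u)) (ev r) =
        pcomp Q (insert s' ?L - {s'} \<union> ?R) a ?U (pcomp Q (insert s' ?L) s' ?R ?X (ev r)) (ev u)"
      by (rule pcomp_parallel) (use s True dis cl X in \<open>auto simp: fresh_def\<close>)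
    finally show ?thesis unfolding leaves.simps set_append evN e .
  next
    case False
    then have aR: "a \<in> ?R" using Node.prems by auto
    have dr: "distinct (leaves (subst_leaf a u r))"
      by (rule distinct_leaves_subst) (use dis Node.prems in auto)
    have sr: "set (leaves (subst_leaf a u r)) = ?R - {a} \<union> ?U" using aR by (simp add: set_leaves_subst)
    have f: "fresh s s' (?L \<union> (?R - {a} \<union> ?U))" using s by (auto simp: fresh_def)
    have IH: "ev (subst_leaf a u r) = pcomp Q ?R a ?U (ev r) (ev u)"
      by (rule Node.IH(2)) (use aR dis Node.prems in auto)
    have "ev (subst_leaf a u (Node \<omega> l r)) = pcomp Q (insert s' ?L) s' (?R - {a} \<union> ?U) ?X
        (pcomp Q ?R a ?U (ev r) (ev u))"
      using ev_Node[of \<omega> l "subst_leaf a u r" s s'] dN f ev_closed[OF dr] cl False IH sr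
      by (simp add: subst_leaf_notin mul_at_def)
    also have "\<dots> = pcomp Q (insert s' ?L - {s'} \<union> ?R) a ?U (pcomp Q (insert s' ?L) s' ?R ?X (ev r)) (ev u)"
      by (rule pcomp_sequential[symmetric]) (use s aR dis cl X in \<open>auto simp: fresh_def\<close>)
    finally show ?thesis unfolding leaves.simps set_append evN e .
  qed
qed

lemma ev_gen: "a \<noteq> b \<Longrightarrow> ev (Node \<omega> (Leaf a) (Leaf b)) = g \<omega> a b"
proof -
  assume ab: "a \<noteq> b"
  obtain s s' where s: "fresh s s' {a, b}" using ex_fresh[of "{a, b}"] by auto
  have gcl: "g \<omega> s s' \<in> elts Q {s, s'}" using g_closed s by (simp add: fresh_def)
  have 1: "pcomp Q {s, s'} s {a} (g \<omega> s s') (ident Q a) = g \<omega> a s'"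
    using pcomp_ident_right[of "{s, s'}" s a "g \<omega> s s'"] relabel_g[of s s' "id(s := a)" \<omega>] gcl s
    by (auto simp: fresh_def inj_on_def)
  have gcl': "g \<omega> a s' \<in> elts Q {a, s'}" using g_closed s by (auto simp: fresh_def)
  have 2: "pcomp Q {a, s'} s' {b} (g \<omega> a s') (ident Q b) = g \<omega> a b"
    using pcomp_ident_right[of "{a, s'}" s' b "g \<omega> a s'"] relabel_g[of a s' "id(s' := b)" \<omega>] gcl' s ab
    by (auto simp: fresh_def inj_on_def)
  have "ev (Node \<omega> (Leaf a) (Leaf b)) = mul_at s s' \<omega> {a} {b} (ident Q a) (ident Q b)"
    using ev_Node[of \<omega> "Leaf a" "Leaf b" s s'] s ab by (simp add: ident_closed fresh_def)
  then show ?thesis using 1 2 by (simp add: mul_at_def insert_commute)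
qed

definition ext :: "'l set \<Rightarrow> (('l, 'w) pbt \<Rightarrow>\<^sub>0 'k) \<Rightarrow> 'q" where
  "ext A = lin_lift (component Q A) ev"

lemma ev_in: "t \<in> pbts A \<Longrightarrow> ev t \<in> elts Q A"
  using ev_closed[of t] by (auto simp: pbts_def)

lemma ext_mod_hom: "finite A \<Longrightarrow> ext A \<in> mod_hom scalars (free_mod (pbts A)) (component Q A)"
  unfolding ext_def by (intro lin_lift_mod_hom module_component funcsetI ev_in)

lemma ext_basis: "\<lbrakk>finite A; t \<in> pbts A\<rbrakk> \<Longrightarrow> ext A (basis t) = ev t"
  unfolding ext_def by (intro lin_lift_basis module_component ev_in)

lemma ext_relabel:
  assumes A: "finite A" and \<sigma>: "inj_on \<sigma> A" and x: "x \<in> elts free_operad A"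
  shows "ext (\<sigma> ` A) (relabel free_operad \<sigma> A x) = relabel Q \<sigma> A (ext A x)"
proof -
  have A': "finite (\<sigma> ` A)" using A by simp
  have r: "relabel free_operad \<sigma> A \<in> mod_hom scalars (free_mod (pbts A)) (free_mod (pbts (\<sigma> ` A)))"
    using species.relabel_hom[OF operad.axioms(1)[OF operad_free_operad] A \<sigma>]
    by (simp only: free_operad_simps)
  show ?thesis
  proof (rule mod_hom_free_eq[where h = "\<lambda>x. ext (\<sigma> ` A) (relabel free_operad \<sigma> A x)"
        and g = "\<lambda>x. relabel Q \<sigma> A (ext A x)" and p = x, OF module_component[OF A']])
    show "(\<lambda>x. ext (\<sigma> ` A) (relabel free_operad \<sigma> A x)) \<in> mod_hom scalars (free_mod (pbts A)) (component Q (\<sigma> ` A))"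
      by (rule mod_hom_comp[OF r ext_mod_hom[OF A']])
    show "(\<lambda>x. relabel Q \<sigma> A (ext A x)) \<in> mod_hom scalars (free_mod (pbts A)) (component Q (\<sigma> ` A))"
      by (rule mod_hom_comp[OF ext_mod_hom[OF A] relabel_hom[OF A \<sigma>]])
    fix t :: "('l, 'w) pbt" assume t: "t \<in> pbts A"
    then show "ext (\<sigma> ` A) (relabel free_operad \<sigma> A (basis t)) = relabel Q \<sigma> A (ext A (basis t))"
      using ext_basis[OF A' map_pbt_pbts[OF t \<sigma>]] ext_basis[OF A t] ev_map[of t \<sigma>] \<sigma>
      by (auto simp: pbts_def)
  qed (use x in simp)
qed

lemma ext_pcomp:
  assumes AB: "finite A" "finite B" "A \<inter> B = {}" "a \<in> A"
    and x: "x \<in> elts free_operad A" and y: "y \<in> elts free_operad B"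
  shows "ext (A - {a} \<union> B) (pcomp free_operad A a B x y) = pcomp Q A a B (ext A x) (ext B y)"
proof -
  let ?C = "A - {a} \<union> B"
  have C: "finite ?C" using AB by simp
  interpret F: operad "free_operad :: ('l, 'k, ('l, 'w) pbt \<Rightarrow>\<^sub>0 'k) operad" by (rule operad_free_operad)
  note N = module_component[OF C]
  have eq1: "ext ?C (pcomp free_operad A a B (basis t) y) = pcomp Q A a B (ext A (basis t)) (ext B y)"
    if t: "t \<in> pbts A" for t
  proof -
    have bt: "basis t \<in> elts (free_operad :: ('l, 'k, ('l, 'w) pbt \<Rightarrow>\<^sub>0 'k) operad) A"
      using t by (simp add: keys_basis_subset)
    have tA: "ext A (basis t) \<in> elts Q A" by (simp only: ext_basis[OF AB(1) t] ev_in[OF t])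
    show ?thesis
    proof (rule mod_hom_free_eq[where h = "\<lambda>y. ext ?C (pcomp free_operad A a B (basis t) y)"
          and g = "\<lambda>y. pcomp Q A a B (ext A (basis t)) (ext B y)" and p = y, OF N])
      show "(\<lambda>y. ext ?C (pcomp free_operad A a B (basis t) y)) \<in> mod_hom scalars (free_mod (pbts B)) (component Q ?C)"
        using mod_hom_comp[OF F.pcomp_hom_right[OF AB bt]] ext_mod_hom[OF C]
        by (simp only: free_operad_simps(1))
      show "(\<lambda>y. pcomp Q A a B (ext A (basis t)) (ext B y)) \<in> mod_hom scalars (free_mod (pbts B)) (component Q ?C)"
        by (rule mod_hom_comp[OF ext_mod_hom[OF AB(2)] pcomp_hom_right[OF AB tA]])
      fix s :: "('l, 'w) pbt" assume s: "s \<in> pbts B"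
      show "ext ?C (pcomp free_operad A a B (basis t) (basis s)) = pcomp Q A a B (ext A (basis t)) (ext B (basis s))"
        using ext_basis[OF C subst_leaf_pbts[OF t s AB(3,4)]] ext_basis[OF AB(1) t] ext_basis[OF AB(2) s]
          ev_subst[of t s a] t s AB
        by (auto simp: pbts_def)
    qed (use y in simp)
  qed
  have yB: "ext B y \<in> elts Q B"
    using mod_homD(1)[OF ext_mod_hom[OF AB(2)], of y] y by simp
  show ?thesis
  proof (rule mod_hom_free_eq[where h = "\<lambda>x. ext ?C (pcomp free_operad A a B x y)"
        and g = "\<lambda>x. pcomp Q A a B (ext A x) (ext B y)" and p = x, OF N])
    show "(\<lambda>x. ext ?C (pcomp free_operad A a B x y)) \<in> mod_hom scalars (free_mod (pbts A)) (component Q ?C)"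
      using mod_hom_comp[OF F.pcomp_hom_left[OF AB y]] ext_mod_hom[OF C]
      by (simp only: free_operad_simps(1))
    show "(\<lambda>x. pcomp Q A a B (ext A x) (ext B y)) \<in> mod_hom scalars (free_mod (pbts A)) (component Q ?C)"
      by (rule mod_hom_comp[OF ext_mod_hom[OF AB(1)] pcomp_hom_left[OF AB yB]])
  qed (use x eq1 in simp_all)
qed

lemma operad_hom_ext: "operad_hom free_operad Q ext"
  unfolding operad_hom_def species_hom_def
proof (intro conjI allI impI)
  fix A :: "'l set" assume "finite A"
  then show "ext A \<in> mod_hom scalars (component free_operad A) (component Q A)"
    unfolding free_operad_simps by (rule ext_mod_hom)
next
  fix a show "ext {a} (ident free_operad a) = ident Q a"
    using ext_basis[of "{a}" "Leaf a"] by (simp add: pbts_def)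
qed (elim conjE, rule ext_relabel ext_pcomp; assumption)+

lemma gen_species_hom_eq:
  assumes A: "finite A" and h: "h \<in> mod_hom scalars (component gen_species A) (component Q A)"
    and eq: "\<And>\<omega> a b. a \<noteq> b \<Longrightarrow> A = {a, b} \<Longrightarrow> h (basis (\<omega>, a, b)) = g \<omega> a b"
    and x: "x \<in> elts gen_species A"
  shows "h x = \<phi> A x"
proof (rule mod_hom_free_eq[OF module_component[OF A]])
  show "h \<in> mod_hom scalars (free_mod {(\<omega>, a, b) | \<omega> a b. a \<noteq> b \<and> A = {a, b}}) (component Q A)"
    using h by (simp only: gen_species_simps)
  show "\<phi> A \<in> mod_hom scalars (free_mod {(\<omega>, a, b) | \<omega> a b. a \<noteq> b \<and> A = {a, b}}) (component Q A)"
    using species_hom_mod_hom[OF \<phi> A] by (simp only: gen_species_simps)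
  show "Poly_Mapping.keys x \<subseteq> {(\<omega>, a, b) | \<omega> a b. a \<noteq> b \<and> A = {a, b}}"
    using x by (simp add: gen_species_simps)
  fix e :: "'w \<times> 'l \<times> 'l" assume "e \<in> {(\<omega>, a, b) | \<omega> a b. a \<noteq> b \<and> A = {a, b}}"
  then obtain \<omega> a b where "e = (\<omega>, a, b)" "a \<noteq> b" "A = {a, b}" by blast
  then show "h (basis e) = \<phi> A (basis e)" using eq by (simp add: g_def)
qed

lemma ext_incl:
  assumes A: "finite A" and x: "x \<in> elts gen_species A"
  shows "ext A (free_operad_incl A x) = \<phi> A x"
proof (rule gen_species_hom_eq[where h = "\<lambda>x. ext A (free_operad_incl A x)", OF A _ _ x])
  have "free_operad_incl A \<in> mod_hom scalars (component gen_species A) (component (free_operad :: ('l, 'k, ('l, 'w) pbt \<Rightarrow>\<^sub>0 'k) operad) A)"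
    by (rule species_hom_mod_hom[OF species_hom_free_operad_incl A])
  then show "(\<lambda>x. ext A (free_operad_incl A x)) \<in> mod_hom scalars (component gen_species A) (component Q A)"
    unfolding free_operad_simps by (rule mod_hom_comp[OF _ ext_mod_hom[OF A]])
  fix \<omega> :: 'w and a b assume "a \<noteq> b" "A = {a, b}"
  then show "ext A (free_operad_incl A (basis (\<omega>, a, b))) = g \<omega> a b"
    using ext_basis[OF A, of "Node \<omega> (Leaf a) (Leaf b)"] ev_gen[of a b \<omega>]
    by (simp add: free_operad_incl_def pbts_def del: ev.simps)
qed

lemma ext_unique:
  assumes \<Psi>: "operad_hom free_operad Q \<Psi>"
    and gens: "\<And>A x. finite A \<Longrightarrow> x \<in> elts gen_species A \<Longrightarrow> \<Psi> A (free_operad_incl A x) = \<phi> A x"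
    and A: "finite A" and x: "x \<in> elts free_operad A"
  shows "\<Psi> A x = ext A x"
proof -
  have ident: "\<Psi> {a} (basis (Leaf a)) = ident Q a" for a
    using \<Psi> by (simp add: operad_hom_def)
  have comp: "\<Psi> (A - {a} \<union> B) (basis (subst_leaf a s t)) = pcomp Q A a B (\<Psi> A (basis t)) (\<Psi> B (basis s))"
    if "finite A" "finite B" "A \<inter> B = {}" "a \<in> A" "t \<in> pbts A" "s \<in> pbts B" for A B a s t
  proof -
    have "basis t \<in> elts (free_operad :: ('l, 'k, ('l, 'w) pbt \<Rightarrow>\<^sub>0 'k) operad) A"
      "basis s \<in> elts (free_operad :: ('l, 'k, ('l, 'w) pbt \<Rightarrow>\<^sub>0 'k) operad) B"
      using that by (simp_all add: keys_basis_subset)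
    then have "\<Psi> (A - {a} \<union> B) (pcomp free_operad A a B (basis t) (basis s)) =
        pcomp Q A a B (\<Psi> A (basis t)) (\<Psi> B (basis s))"
      using \<Psi> that by (simp add: operad_hom_def del: free_operad_simps)
    then show ?thesis by simp
  qed
  have gen: "\<Psi> {a, b} (basis (Node \<omega> (Leaf a) (Leaf b))) = g \<omega> a b" if "a \<noteq> b" for \<omega> a b
    using gens[of "{a, b}" "basis (\<omega>, a, b)"] that
      basis_gen_species[OF that, of \<omega>]
    by (simp add: free_operad_incl_def g_def)
  have tree: "\<Psi> (set (leaves t)) (basis t) = ev t" if "distinct (leaves t)" for t
    using that
  proof (induction t)
    case (Leaf a) then show ?case by (simp add: ident)
  next
    case (Node \<omega> l r)
    let ?L = "set (leaves l)" and ?R = "set (leaves r)"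
    obtain s s' where s: "fresh s s' (?L \<union> ?R)" using ex_fresh[of "?L \<union> ?R"] by auto
    have cl: "ev l \<in> elts Q ?L" "ev r \<in> elts Q ?R" using ev_closed Node.prems by auto
    have lr: "l \<in> pbts ?L" "r \<in> pbts ?R" using Node.prems by (simp_all add: pbts_def)
    have 1: "\<Psi> (insert s' ?L) (basis (Node \<omega> l (Leaf s'))) = pcomp Q {s, s'} s ?L (g \<omega> s s') (ev l)"
    proof -
      have "{s, s'} - {s} \<union> ?L = insert s' ?L" using s by (auto simp: fresh_def)
      then show ?thesis
        using comp[of "{s, s'}" ?L s "Node \<omega> (Leaf s) (Leaf s')" l] s lr gen[of s s' \<omega>] Node
        by (simp add: fresh_def pbts_def)
    qed
    have "\<Psi> (?L \<union> ?R) (basis (Node \<omega> l r)) = pcomp Q (insert s' ?L) s' ?R (\<Psi> (insert s' ?L) (basis (Node \<omega> l (Leaf s')))) (ev r)"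
    proof -
      have "insert s' ?L - {s'} \<union> ?R = ?L \<union> ?R" using s by (auto simp: fresh_def)
      then show ?thesis
        using comp[of "insert s' ?L" ?R s' "Node \<omega> l (Leaf s')" r] s lr Node
        by (simp add: fresh_def pbts_def subst_leaf_notin del: ev.simps)
    qed
    then show ?case
      using 1 ev_Node[OF Node.prems s cl] by (simp add: mul_at_def del: ev.simps)
  qed
  show ?thesis
  proof (rule mod_hom_free_eq[where h = "\<Psi> A" and g = "ext A" and p = x, OF module_component[OF A]])
    show "\<Psi> A \<in> mod_hom scalars (free_mod (pbts A)) (component Q A)"
      using species_hom_mod_hom[of free_operad Q \<Psi>, OF _ A] \<Psi> by (simp add: operad_hom_def)
    show "ext A \<in> mod_hom scalars (free_mod (pbts A)) (component Q A)" by (rule ext_mod_hom[OF A])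
    fix t :: "('l, 'w) pbt" assume t: "t \<in> pbts A"
    then show "\<Psi> A (basis t) = ext A (basis t)"
      using tree[of t] ext_basis[OF A t] by (auto simp: pbts_def)
  qed (use x in simp)
qed

end

theorem free_operad_is_free:
  fixes Q :: "('l::infinite, 'k::{comm_ring,comm_monoid_mult}, 'q, 'z) operad_scheme"
    and \<phi> :: "'l set \<Rightarrow> (('w \<times> 'l \<times> 'l) \<Rightarrow>\<^sub>0 'k) \<Rightarrow> 'q"
  assumes "operad Q" and "species_hom gen_species Q \<phi>"
  shows "\<exists>\<Psi>. operad_hom free_operad Q \<Psi> \<and>
    (\<forall>A. finite A \<longrightarrow> (\<forall>x \<in> elts gen_species A. \<Psi> A (free_operad_incl A x) = \<phi> A x)) \<and>
    (\<forall>\<Psi>'. operad_hom free_operad Q \<Psi>' \<and>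
       (\<forall>A. finite A \<longrightarrow> (\<forall>x \<in> elts gen_species A. \<Psi>' A (free_operad_incl A x) = \<phi> A x)) \<longrightarrow>
       (\<forall>A. finite A \<longrightarrow> (\<forall>x \<in> elts free_operad A. \<Psi>' A x = \<Psi> A x)))"
proof -
  interpret gen_target Q \<phi> using assms by (simp add: gen_target_def gen_target_axioms_def)
  show ?thesis
  proof (intro exI[of _ ext] conjI allI impI ballI)
    show "operad_hom free_operad Q ext" by (rule operad_hom_ext)
  next
    fix A :: "'l set" and x :: "('w \<times> 'l \<times> 'l) \<Rightarrow>\<^sub>0 'k" assume "finite A" "x \<in> elts gen_species A"
    then show "ext A (free_operad_incl A x) = \<phi> A x" by (rule ext_incl)
  next
    fix \<Psi> and A :: "'l set" and x :: "('l, 'w) pbt \<Rightarrow>\<^sub>0 'k"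
    assume "operad_hom free_operad Q \<Psi> \<and>
      (\<forall>A. finite A \<longrightarrow> (\<forall>x\<in>elts gen_species A. \<Psi> A (free_operad_incl A x) = \<phi> A x))"
      and "finite A" "x \<in> elts free_operad A"
    then show "\<Psi> A x = ext A x" by (elim conjE) (rule ext_unique, auto)
  qed
qed

end

theory Submission
  imports Defs
begin

text \<open>
  Let a planar binary tree act on one-vertex trees by letting \<open>\<rhd>\<^sub>\<omega>\<close> hang its first argument, with an edge
  of type \<open>\<omega>\<close>, below each vertex of the second one and multiply by \<open>\<omega>\<close> the types on the path from that
  vertex to the root. This evaluation carries substitution of a leaf to the composition of \<open>RTF\<close>; by
  induction this only has to be checked when a vertex of one of the two factors of \<open>\<rhd>\<^sub>\<omega>\<close> is replaced, and the
  operad axioms of \<open>RTF\<close> then hold because it is an image of the free operad.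

  Evaluation is triangular: the term obtained by always hanging below the root has strictly fewer
  pairs (vertex, ancestor) than all other ones. Every typed tree is such a leading term, so evaluation is
  onto. The pre-Lie family relations allow one to sort the branches along the right spine of
  a binary tree, up to terms with a shorter spine. Hence binary trees with sorted branches span the
  quotient; they have distinct leading terms, so no nonzero combination of them evaluates to zero, and the
  kernel of evaluation is exactly the ideal of relations.
\<close>

section \<open>Images and quotients of operads\<close>

text \<open>Two obstacles shape the argument. Checking the operad axioms of \<open>RTF\<close>
  directly would mean comparing iterated twisted types over nested choices of attachment maps;
  writing every element as an image of the free operad leaves only the compatibility of
  \<open>graft\<close> with a single \<open>hang\<close>. Even there an edge is a triple that
  contains its type, so hanging a tree changes the very edges on which attachment maps are defined,
  and these maps have to be transported along \<open>path_twist\<close>. Commutativity of types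
  enters here, because the factors coming from different incoming edges are collected as a product
  over a set.

  No dimension count is available over an arbitrary ring. Leading trees have coefficient 1, so
  elimination never divides: run downwards from the largest ancestor count it gives surjectivity,
  and applied to a minimal leading tree it gives independence of the normal forms. Sorting needs an
  order on the labels, which come with none; an injection of the finite label set into the natural
  numbers is chosen instead.\<close>

lemma module_image:
  assumes M: "Module.module R M" and img: "f ` carrier M = carrier N"
    and add: "\<And>x y. x \<in> carrier M \<Longrightarrow> y \<in> carrier M \<Longrightarrow> f (x \<oplus>\<^bsub>M\<^esub> y) = f x \<oplus>\<^bsub>N\<^esub> f y"
    and smult: "\<And>c x. c \<in> carrier R \<Longrightarrow> x \<in> carrier M \<Longrightarrow> f (c \<odot>\<^bsub>M\<^esub> x) = c \<odot>\<^bsub>N\<^esub> f x"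
    and zero: "f \<zero>\<^bsub>M\<^esub> = \<zero>\<^bsub>N\<^esub>"
  shows "Module.module R N"
proof -
  interpret M: Module.module R M by fact
  have pre: "\<exists>x'\<in>carrier M. x = f x'" if "x \<in> carrier N" for x using that img by blast
  have f: "f x \<in> carrier N" if "x \<in> carrier M" for x using that img by blast
  show ?thesis
  proof (rule moduleI)
    show "cring R" by (rule M.is_cring)
    show "abelian_group N"
    proof (rule abelian_groupI)
      fix x y assume "x \<in> carrier N" "y \<in> carrier N"
      then obtain x' y' where x: "x = f x'" "x' \<in> carrier M" and y: "y = f y'" "y' \<in> carrier M"
        using pre by blast
      show "x \<oplus>\<^bsub>N\<^esub> y \<in> carrier N"
        using f[OF M.add.m_closed[OF x(2) y(2)]] by (simp add: x y add)
      show "x \<oplus>\<^bsub>N\<^esub> y = y \<oplus>\<^bsub>N\<^esub> x"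
        using M.add.m_comm[OF x(2) y(2)] by (simp add: x y flip: add)
      show "\<zero>\<^bsub>N\<^esub> \<oplus>\<^bsub>N\<^esub> x = x" using x by (simp flip: zero add)
      show "\<exists>z\<in>carrier N. z \<oplus>\<^bsub>N\<^esub> x = \<zero>\<^bsub>N\<^esub>"
        using x f[of "\<ominus>\<^bsub>M\<^esub> x'"] add[of "\<ominus>\<^bsub>M\<^esub> x'" x'] zero by (auto simp: M.l_neg)
      fix z assume "z \<in> carrier N"
      then obtain z' where z: "z = f z'" "z' \<in> carrier M" using pre by blast
      show "x \<oplus>\<^bsub>N\<^esub> y \<oplus>\<^bsub>N\<^esub> z = x \<oplus>\<^bsub>N\<^esub> (y \<oplus>\<^bsub>N\<^esub> z)"
        using M.add.m_assoc[OF x(2) y(2) z(2)] x(2) y(2) z(2) by (simp add: x(1) y(1) z(1) flip: add)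
    next
      show "\<zero>\<^bsub>N\<^esub> \<in> carrier N" using f[of "\<zero>\<^bsub>M\<^esub>"] zero by simp
    qed
  next
    fix c x assume c: "c \<in> carrier R" and "x \<in> carrier N"
    then obtain x' where x: "x = f x'" "x' \<in> carrier M" using pre by blast
    show "c \<odot>\<^bsub>N\<^esub> x \<in> carrier N" using f[of "c \<odot>\<^bsub>M\<^esub> x'"] x c by (simp add: smult)
    fix d assume d: "d \<in> carrier R"
    show "(c \<oplus>\<^bsub>R\<^esub> d) \<odot>\<^bsub>N\<^esub> x = c \<odot>\<^bsub>N\<^esub> x \<oplus>\<^bsub>N\<^esub> d \<odot>\<^bsub>N\<^esub> x"
      using M.smult_l_distr[OF c d x(2)] x c d by (simp flip: smult add)
    show "(c \<otimes>\<^bsub>R\<^esub> d) \<odot>\<^bsub>N\<^esub> x = c \<odot>\<^bsub>N\<^esub> (d \<odot>\<^bsub>N\<^esub> x)"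
      using M.smult_assoc1[OF c d x(2)] x c d by (simp flip: smult)
  next
    fix c x y assume c: "c \<in> carrier R" and "x \<in> carrier N" "y \<in> carrier N"
    then obtain x' y' where x: "x = f x'" "x' \<in> carrier M" and y: "y = f y'" "y' \<in> carrier M"
      using pre by blast
    show "c \<odot>\<^bsub>N\<^esub> (x \<oplus>\<^bsub>N\<^esub> y) = c \<odot>\<^bsub>N\<^esub> x \<oplus>\<^bsub>N\<^esub> c \<odot>\<^bsub>N\<^esub> y"
      using M.smult_r_distr[OF c x(2) y(2)] x y c by (simp flip: smult add)
  next
    fix x assume "x \<in> carrier N"
    then obtain x' where x: "x = f x'" "x' \<in> carrier M" using pre by blast
    show "\<one>\<^bsub>R\<^esub> \<odot>\<^bsub>N\<^esub> x = x" using x by (simp flip: smult)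
  qed
qed

text \<open>The operad axioms are equations between operations, hence inherited by a surjective
  image. Of \<open>Q\<close> only the operations are given and not a single law, so preservation of
  zero is required separately. The lemma is applied to the projection onto a quotient and to
  evaluation in \<open>RTF\<close>.\<close>

lemma operad_image:
  fixes P :: "('l, 'k::{comm_ring,comm_monoid_mult}, 'm, 'y) operad_scheme"
    and Q :: "('l, 'k, 'n, 'z) operad_scheme"
  assumes P: "operad P"
    and img: "\<And>A. finite A \<Longrightarrow> f A ` elts P A = elts Q A"
    and add: "\<And>A x y. finite A \<Longrightarrow> x \<in> elts P A \<Longrightarrow> y \<in> elts P A \<Longrightarrow>
      f A (x \<oplus>\<^bsub>component P A\<^esub> y) = f A x \<oplus>\<^bsub>component Q A\<^esub> f A y"
    and smult: "\<And>A c x. finite A \<Longrightarrow> x \<in> elts P A \<Longrightarrow>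
      f A (c \<odot>\<^bsub>component P A\<^esub> x) = c \<odot>\<^bsub>component Q A\<^esub> f A x"
    and zero: "\<And>A. finite A \<Longrightarrow> f A \<zero>\<^bsub>component P A\<^esub> = \<zero>\<^bsub>component Q A\<^esub>"
    and relabel: "\<And>A \<sigma> x. finite A \<Longrightarrow> inj_on \<sigma> A \<Longrightarrow> x \<in> elts P A \<Longrightarrow>
      f (\<sigma> ` A) (relabel P \<sigma> A x) = relabel Q \<sigma> A (f A x)"
    and ident: "\<And>a. f {a} (ident P a) = ident Q a"
    and pcomp: "\<And>A B a x y. finite A \<Longrightarrow> finite B \<Longrightarrow> A \<inter> B = {} \<Longrightarrow> a \<in> A \<Longrightarrow>
      x \<in> elts P A \<Longrightarrow> y \<in> elts P B \<Longrightarrow>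
      f (A - {a} \<union> B) (pcomp P A a B x y) = pcomp Q A a B (f A x) (f B y)"
  shows "operad Q"
proof -
  interpret P: operad P by fact
  have pre: "\<exists>x'\<in>elts P A. x = f A x'" if "finite A" "x \<in> elts Q A" for A x
    using that img[of A] by blast
  have cl: "f A x \<in> elts Q A" if "finite A" "x \<in> elts P A" for A x
    using that img[of A] by blast
  have Padd: "x \<oplus>\<^bsub>component P A\<^esub> y \<in> elts P A" if "finite A" "x \<in> elts P A" "y \<in> elts P A" for A x y
  proof -
    interpret Module.module scalars "component P A" by (rule P.module_component[OF that(1)])
    show ?thesis using that by simp
  qed
  have Psm: "c \<odot>\<^bsub>component P A\<^esub> y \<in> elts P A" if "finite A" "y \<in> elts P A" for A c y
  proof -
    interpret Module.module scalars "component P A" by (rule P.module_component[OF that(1)])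
    show ?thesis using that smult_closed[of c y] by simp
  qed
  \<comment> \<open>A map that \<open>f\<close> intertwines with a homomorphism is itself one. This
    settles linearity of relabelling and of partial composition in either argument.\<close>
  have hom: "h \<in> mod_hom scalars (component Q A) (component Q B)"
    if fin: "finite A" "finite B" and h': "h' \<in> mod_hom scalars (component P A) (component P B)"
      and eq: "\<And>x. x \<in> elts P A \<Longrightarrow> h (f A x) = f B (h' x)" for h h' A B
    unfolding mod_hom_def
  proof (intro CollectI conjI ballI funcsetI)
    note H = mod_homD[OF h']
    fix x assume "x \<in> elts Q A"
    then obtain x' where x: "x' \<in> elts P A" "x = f A x'" using pre fin by blast
    show "h x \<in> elts Q B" using cl[OF fin(2) H(1)[OF x(1)]] eq x by simp
    { fix y assume "y \<in> elts Q A"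
      then obtain y' where y: "y' \<in> elts P A" "y = f A y'" using pre fin by blast
      have "h (x \<oplus>\<^bsub>component Q A\<^esub> y) = h (f A (x' \<oplus>\<^bsub>component P A\<^esub> y'))" using x y fin add by simp
      also have "\<dots> = f B (h' x' \<oplus>\<^bsub>component P B\<^esub> h' y')" using x y fin eq Padd H by simp
      finally show "h (x \<oplus>\<^bsub>component Q A\<^esub> y) = h x \<oplus>\<^bsub>component Q B\<^esub> h y" using x y fin eq add H(1) by simp }
    fix c :: 'k
    have "h (c \<odot>\<^bsub>component Q A\<^esub> x) = h (f A (c \<odot>\<^bsub>component P A\<^esub> x'))" using x fin smult by simp
    also have "\<dots> = f B (c \<odot>\<^bsub>component P B\<^esub> h' x')" using x fin eq Psm H(3)[of x' c] by simp
    finally show "h (c \<odot>\<^bsub>component Q A\<^esub> x) = c \<odot>\<^bsub>component Q B\<^esub> h x" using x fin eq smult H(1) by simp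
  qed
  show ?thesis
  proof (intro operad.intro species.intro operad_axioms.intro)
    fix A :: "'l set" assume A: "finite A"
    show "Module.module scalars (component Q A)"
      by (rule module_image[OF P.module_component[OF A] img[OF A]]) (simp_all add: A add smult zero)
    fix \<sigma> :: "'l \<Rightarrow> 'l" assume \<sigma>: "inj_on \<sigma> A"
    show "relabel Q \<sigma> A \<in> mod_hom scalars (component Q A) (component Q (\<sigma> ` A))"
      by (rule hom[OF A _ P.relabel_hom[OF A \<sigma>]]) (simp_all add: A \<sigma> relabel)
    fix x assume "x \<in> elts Q A"
    then obtain x' where x: "x' \<in> elts P A" "x = f A x'" using pre A by blast
    { fix \<tau> :: "'l \<Rightarrow> 'l" assume eq: "\<And>a. a \<in> A \<Longrightarrow> \<sigma> a = \<tau> a"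
      have "inj_on \<tau> A" using \<sigma> eq inj_on_cong by blast
      moreover have "\<tau> ` A = \<sigma> ` A" using eq by simp
      ultimately show "relabel Q \<sigma> A x = relabel Q \<tau> A x"
        using P.relabel_cong[OF A \<sigma> eq x(1)] relabel[OF A _ x(1)] \<sigma> x(2) by metis }
    fix \<tau> :: "'l \<Rightarrow> 'l" assume \<tau>: "inj_on \<tau> (\<sigma> ` A)"
    have "relabel Q \<tau> (\<sigma> ` A) (relabel Q \<sigma> A x) = f (\<tau> ` \<sigma> ` A) (relabel P \<tau> (\<sigma> ` A) (relabel P \<sigma> A x'))"
      using A \<sigma> \<tau> x P.relabel_closed by (simp add: relabel)
    also have "\<dots> = f ((\<tau> \<circ> \<sigma>) ` A) (relabel P (\<tau> \<circ> \<sigma>) A x')"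
      using P.relabel_comp[OF A \<sigma> \<tau> x(1)] by (simp add: image_comp)
    also have "\<dots> = relabel Q (\<tau> \<circ> \<sigma>) A x"
      using relabel[OF A comp_inj_on[OF \<sigma> \<tau>] x(1)] x(2) by simp
    finally show "relabel Q \<tau> (\<sigma> ` A) (relabel Q \<sigma> A x) = relabel Q (\<tau> \<circ> \<sigma>) A x" .
  next
    fix A :: "'l set" and x assume A: "finite A" and "x \<in> elts Q A"
    then obtain x' where x: "x' \<in> elts P A" "x = f A x'" using pre by blast
    show "relabel Q id A x = x"
      using relabel[OF A inj_on_id x(1)] P.relabel_id[OF A x(1)] x(2) by simp
  next
    fix A B :: "'l set" and a y
    assume AB: "finite A" "finite B" "A \<inter> B = {}" "a \<in> A" and "y \<in> elts Q B"
    then obtain y' where y: "y' \<in> elts P B" "y = f B y'" using pre by blast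
    show "(\<lambda>x. pcomp Q A a B x y) \<in> mod_hom scalars (component Q A) (component Q (A - {a} \<union> B))"
      by (rule hom[OF AB(1) _ P.pcomp_hom_left[OF AB y(1)]]) (use AB y in \<open>simp_all add: pcomp\<close>)
  next
    fix A B :: "'l set" and a x
    assume AB: "finite A" "finite B" "A \<inter> B = {}" "a \<in> A" and "x \<in> elts Q A"
    then obtain x' where x: "x' \<in> elts P A" "x = f A x'" using pre by blast
    show "pcomp Q A a B x \<in> mod_hom scalars (component Q B) (component Q (A - {a} \<union> B))"
      by (rule hom[OF AB(2) _ P.pcomp_hom_right[OF AB x(1)]]) (use AB x in \<open>simp_all add: pcomp\<close>)
  next
    fix A B :: "'l set" and a and \<sigma> :: "'l \<Rightarrow> 'l" and x y
    assume AB: "finite A" "finite B" "A \<inter> B = {}" "a \<in> A" and \<sigma>: "inj_on \<sigma> (A \<union> B)"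
      and "x \<in> elts Q A" "y \<in> elts Q B"
    then obtain x' y' where x: "x' \<in> elts P A" "x = f A x'" and y: "y' \<in> elts P B" "y = f B y'"
      using pre by meson
    have inj: "inj_on \<sigma> A" "inj_on \<sigma> B" "inj_on \<sigma> (A - {a} \<union> B)"
      using \<sigma> by (auto intro: inj_on_subset)
    have im: "\<sigma> ` (A - {a} \<union> B) = \<sigma> ` A - {\<sigma> a} \<union> \<sigma> ` B" "\<sigma> ` A \<inter> \<sigma> ` B = {}"
      using \<sigma> AB unfolding inj_on_def by blast+
    have "relabel Q \<sigma> (A - {a} \<union> B) (pcomp Q A a B x y) =
        f (\<sigma> ` (A - {a} \<union> B)) (relabel P \<sigma> (A - {a} \<union> B) (pcomp P A a B x' y'))"
      using AB inj x y P.pcomp_closed by (simp add: relabel pcomp del: image_Un)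
    also have "\<dots> = f (\<sigma> ` A - {\<sigma> a} \<union> \<sigma> ` B)
        (pcomp P (\<sigma> ` A) (\<sigma> a) (\<sigma> ` B) (relabel P \<sigma> A x') (relabel P \<sigma> B y'))"
      unfolding im(1) P.relabel_pcomp[OF AB \<sigma> x(1) y(1)] ..
    also have "\<dots> = pcomp Q (\<sigma> ` A) (\<sigma> a) (\<sigma> ` B) (relabel Q \<sigma> A x) (relabel Q \<sigma> B y)"
      using AB inj x y im P.relabel_closed by (simp add: relabel pcomp)
    finally show "relabel Q \<sigma> (A - {a} \<union> B) (pcomp Q A a B x y) =
        pcomp Q (\<sigma> ` A) (\<sigma> a) (\<sigma> ` B) (relabel Q \<sigma> A x) (relabel Q \<sigma> B y)" .
  next
    fix A B C :: "'l set" and a b x y z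
    assume fin: "finite A" "finite B" "finite C" and dis: "A \<inter> B = {}" "A \<inter> C = {}" "B \<inter> C = {}"
      and ab: "a \<in> A" "b \<in> B" and "x \<in> elts Q A" "y \<in> elts Q B" "z \<in> elts Q C"
    then obtain x' y' z' where x: "x' \<in> elts P A" "x = f A x'" and y: "y' \<in> elts P B" "y = f B y'"
      and z: "z' \<in> elts P C" "z = f C z'"
      using pre by meson
    have d: "(A - {a} \<union> B) \<inter> C = {}" "A \<inter> (B - {b} \<union> C) = {}" "b \<in> A - {a} \<union> B"
      "A - {a} \<union> B - {b} \<union> C = A - {a} \<union> (B - {b} \<union> C)"
      using dis ab by auto
    have "pcomp Q (A - {a} \<union> B) b C (pcomp Q A a B x y) z =
        f (A - {a} \<union> B - {b} \<union> C) (pcomp P (A - {a} \<union> B) b C (pcomp P A a B x' y') z')"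
      using fin dis ab d(1,3) x y z P.pcomp_closed by (simp add: pcomp)
    also have "\<dots> = f (A - {a} \<union> (B - {b} \<union> C)) (pcomp P A a (B - {b} \<union> C) x' (pcomp P B b C y' z'))"
      unfolding d(4) P.pcomp_sequential[OF fin dis ab x(1) y(1) z(1)] ..
    also have "\<dots> = pcomp Q A a (B - {b} \<union> C) x (pcomp Q B b C y z)"
      using fin dis ab d x y z P.pcomp_closed by (simp add: pcomp)
    finally show "pcomp Q (A - {a} \<union> B) b C (pcomp Q A a B x y) z =
        pcomp Q A a (B - {b} \<union> C) x (pcomp Q B b C y z)" .
  next
    fix A B C :: "'l set" and a b x y z
    assume fin: "finite A" "finite B" "finite C" and dis: "A \<inter> B = {}" "A \<inter> C = {}" "B \<inter> C = {}"
      and ab: "a \<in> A" "b \<in> A" "a \<noteq> b" and "x \<in> elts Q A" "y \<in> elts Q B" "z \<in> elts Q C"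
    then obtain x' y' z' where x: "x' \<in> elts P A" "x = f A x'" and y: "y' \<in> elts P B" "y = f B y'"
      and z: "z' \<in> elts P C" "z = f C z'"
      using pre by meson
    have d: "(A - {a} \<union> B) \<inter> C = {}" "(A - {b} \<union> C) \<inter> B = {}" "b \<in> A - {a} \<union> B" "a \<in> A - {b} \<union> C"
      "A - {a} \<union> B - {b} \<union> C = A - {b} \<union> C - {a} \<union> B"
      using dis ab by auto
    have "pcomp Q (A - {a} \<union> B) b C (pcomp Q A a B x y) z =
        f (A - {a} \<union> B - {b} \<union> C) (pcomp P (A - {a} \<union> B) b C (pcomp P A a B x' y') z')"
      using fin dis ab d(1,3) x y z P.pcomp_closed by (simp add: pcomp)
    also have "\<dots> = f (A - {b} \<union> C - {a} \<union> B) (pcomp P (A - {b} \<union> C) a B (pcomp P A b C x' z') y')"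
      unfolding d(5) P.pcomp_parallel[OF fin dis ab x(1) y(1) z(1)] ..
    also have "\<dots> = pcomp Q (A - {b} \<union> C) a B (pcomp Q A b C x z) y"
      using fin dis ab d x y z P.pcomp_closed by (simp add: pcomp)
    finally show "pcomp Q (A - {a} \<union> B) b C (pcomp Q A a B x y) z =
        pcomp Q (A - {b} \<union> C) a B (pcomp Q A b C x z) y" .
  next
    fix a show "ident Q a \<in> elts Q {a}" using cl[OF _ P.ident_closed] ident by (metis finite.simps)
  next
    fix \<sigma> :: "'l \<Rightarrow> 'l" and a
    show "relabel Q \<sigma> {a} (ident Q a) = ident Q (\<sigma> a)"
      using relabel[OF _ _ P.ident_closed, of a \<sigma>] P.relabel_ident[of \<sigma> a] by (simp add: ident)
  next
    fix a :: 'l and B y assume B: "finite B" "a \<notin> B" and "y \<in> elts Q B"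
    then obtain y' where y: "y' \<in> elts P B" "y = f B y'" using pre by blast
    show "pcomp Q {a} a B (ident Q a) y = y"
      using pcomp[of "{a}" B a "ident P a" y'] B y P.pcomp_ident_left[OF B y(1)]
      by (simp add: ident P.ident_closed)
  next
    fix A :: "'l set" and a b x assume A: "finite A" "a \<in> A" "b \<notin> A" and "x \<in> elts Q A"
    then obtain x' where x: "x' \<in> elts P A" "x = f A x'" using pre by blast
    have im: "id(a := b) ` A = A - {a} \<union> {b}" "inj_on (id(a := b)) A"
      using A by (auto simp: inj_on_def)
    show "pcomp Q A a {b} x (ident Q b) = relabel Q (id(a := b)) A x"
      using pcomp[of A "{b}" a x' "ident P b"] A x P.pcomp_ident_right[OF A x(1)] relabel[OF A(1) im(2) x(1)]
      unfolding im(1) by (simp add: ident P.ident_closed)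
  qed
qed

section \<open>The quotient of an operad by an ideal\<close>

locale operad_with_ideal = operad P
  for P :: "('l, 'k::{comm_ring,comm_monoid_mult}, 'm, 'z) operad_scheme" +
  fixes I :: "'l set \<Rightarrow> 'm set"
  assumes ideal: "operad_ideal P I"
begin

abbreviation proj :: "'l set \<Rightarrow> 'm \<Rightarrow> 'm set" where
  "proj \<equiv> coset_of P I"

lemma submodule_ideal: "finite A \<Longrightarrow> submodule (I A) scalars (component P A)"
  using ideal by (simp add: operad_ideal_def)

lemma ideal_subset: "finite A \<Longrightarrow> I A \<subseteq> elts P A"
  by (metis module.submoduleE(1) module_component submodule_ideal)

lemma abelian_subgroup_ideal: "finite A \<Longrightarrow> abelian_subgroup (I A) (component P A)"
  using submodule.axioms(1)[OF submodule_ideal] module_component[THEN module.axioms(2)]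
  by (intro abelian_subgroupI3 additive_subgroupI)

lemma proj_self: "finite A \<Longrightarrow> x \<in> elts P A \<Longrightarrow> x \<in> proj A x"
  unfolding coset_of_def by (rule abelian_subgroup.a_rcos_self[OF abelian_subgroup_ideal])

lemma proj_eq:
  assumes "finite A" "x \<in> elts P A" "y \<in> proj A x"
  shows "proj A y = proj A x"
  using assms abelian_subgroup.a_repr_independence'[OF abelian_subgroup_ideal, of A y x]
    abelian_group.a_repr_independence[of "component P A" y "I A" x]
    module.axioms(2)[OF module_component, of A] submodule.axioms(1)[OF submodule_ideal, of A]
  unfolding coset_of_def by metis

lemma proj_subset: "finite A \<Longrightarrow> x \<in> elts P A \<Longrightarrow> proj A x \<subseteq> elts P A"
  unfolding coset_of_def
  by (rule abelian_monoid.a_r_coset_subset_G[OF abelian_group.axioms(1)[OF module.axioms(2)[OF module_component]] ideal_subset])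

lemma proj_iff:
  assumes "finite A" "x \<in> elts P A"
  shows "y \<in> proj A x \<longleftrightarrow> (\<exists>h\<in>I A. y = h \<oplus>\<^bsub>component P A\<^esub> x)"
  unfolding coset_of_def a_r_coset_def' by blast

lemma proj_map:
  assumes fin: "finite A" "finite B" and h: "h \<in> mod_hom scalars (component P A) (component P B)"
    and hI: "\<And>z. z \<in> I A \<Longrightarrow> h z \<in> I B" and x: "x \<in> elts P A" and y: "y \<in> proj A x"
  shows "proj B (h y) = proj B (h x)"
proof -
  obtain z where z: "z \<in> I A" "y = z \<oplus>\<^bsub>component P A\<^esub> x" using y proj_iff fin x by blast
  then have "h y = h z \<oplus>\<^bsub>component P B\<^esub> h x" using mod_homD(2)[OF h, of z x] x ideal_subset[OF fin(1)] by blast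
  then have "h y \<in> proj B (h x)" using proj_iff[OF fin(2)] hI[OF z(1)] mod_homD(1)[OF h x] by blast
  then show ?thesis by (rule proj_eq[OF fin(2) mod_homD(1)[OF h x]])
qed

text \<open>Quotient operations are unions over all representatives. The cosets united here
  coincide, because \<open>h\<close> carries the ideal into the ideal. Scalar multiplication,
  relabelling and each argument of partial composition are instances.\<close>

lemma UN_proj_map:
  assumes "finite A" "finite B" "h \<in> mod_hom scalars (component P A) (component P B)"
    "\<And>z. z \<in> I A \<Longrightarrow> h z \<in> I B" "x \<in> elts P A"
  shows "(\<Union>y\<in>proj A x. proj B (h y)) = proj B (h x)"
  using proj_map[OF assms] proj_self[OF assms(1,5)] by blast

lemma quotient_operad_simps:
  "elts (quotient_operad P I) A = proj A ` elts P A"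
  "zero (component (quotient_operad P I) A) = I A"
  "add (component (quotient_operad P I) A) = set_add (component P A)"
  "smult (component (quotient_operad P I) A) c X = (\<Union>x\<in>X. proj A (c \<odot>\<^bsub>component P A\<^esub> x))"
  "relabel (quotient_operad P I) \<sigma> A X = (\<Union>x\<in>X. proj (\<sigma> ` A) (relabel P \<sigma> A x))"
  "ident (quotient_operad P I) a = proj {a} (ident P a)"
  "pcomp (quotient_operad P I) A a B X Y = (\<Union>x\<in>X. \<Union>y\<in>Y. proj (A - {a} \<union> B) (pcomp P A a B x y))"
  by (auto simp: quotient_operad_def A_RCOSETS_def' coset_of_def)

lemma proj_add:
  assumes "finite A" "x \<in> elts P A" "y \<in> elts P A"
  shows "proj A (x \<oplus>\<^bsub>component P A\<^esub> y) = proj A x \<oplus>\<^bsub>component (quotient_operad P I) A\<^esub> proj A y"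
  unfolding quotient_operad_simps coset_of_def
  by (rule abelian_subgroup.a_rcos_sum[OF abelian_subgroup_ideal, symmetric]) fact+

lemma proj_zero: "finite A \<Longrightarrow> proj A \<zero>\<^bsub>component P A\<^esub> = \<zero>\<^bsub>component (quotient_operad P I) A\<^esub>"
  unfolding quotient_operad_simps coset_of_def
  by (rule abelian_group.a_coset_add_zero[OF module.axioms(2)[OF module_component] ideal_subset])

lemma proj_smult:
  assumes A: "finite A" and x: "x \<in> elts P A"
  shows "proj A (c \<odot>\<^bsub>component P A\<^esub> x) = c \<odot>\<^bsub>component (quotient_operad P I) A\<^esub> proj A x"
  unfolding quotient_operad_simps
proof (rule UN_proj_map[symmetric, OF A A _ _ x])
  interpret M: Module.module scalars "component P A" by (rule module_component[OF A])
  show "(\<lambda>x. c \<odot>\<^bsub>component P A\<^esub> x) \<in> mod_hom scalars (component P A) (component P A)"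
    using M.smult_closed[of c] M.smult_r_distr[of c] M.smult_assoc1[of _ c] M.smult_assoc1[of c]
    by (auto simp: mod_hom_def mult.commute)
  show "c \<odot>\<^bsub>component P A\<^esub> z \<in> I A" if "z \<in> I A" for z
    using submodule.smult_closed[OF submodule_ideal[OF A], of c z] that by simp
qed

lemma proj_relabel:
  assumes "finite A" "inj_on \<sigma> A" "x \<in> elts P A"
  shows "proj (\<sigma> ` A) (relabel P \<sigma> A x) = relabel (quotient_operad P I) \<sigma> A (proj A x)"
  unfolding quotient_operad_simps
  by (rule UN_proj_map[symmetric, OF _ _ relabel_hom])
    (use assms ideal in \<open>auto simp: operad_ideal_def\<close>)

lemma proj_pcomp:
  assumes AB: "finite A" "finite B" "A \<inter> B = {}" "a \<in> A" and x: "x \<in> elts P A" and y: "y \<in> elts P B"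
  shows "proj (A - {a} \<union> B) (pcomp P A a B x y) = pcomp (quotient_operad P I) A a B (proj A x) (proj B y)"
proof -
  let ?C = "A - {a} \<union> B"
  have C: "finite ?C" using AB by simp
  have "pcomp (quotient_operad P I) A a B (proj A x) (proj B y) =
      (\<Union>x'\<in>proj A x. \<Union>y'\<in>proj B y. proj ?C (pcomp P A a B x' y'))"
    by (simp only: quotient_operad_simps)
  \<comment> \<open>The two representatives are removed one after the other: \<open>y'\<close> for
    an arbitrary \<open>x'\<close> in its coset, then \<open>x'\<close> itself.\<close>
  also have "\<dots> = (\<Union>x'\<in>proj A x. proj ?C (pcomp P A a B x' y))"
  proof (rule SUP_cong[OF refl])
    fix x' assume "x' \<in> proj A x"
    then have x': "x' \<in> elts P A" using proj_subset[OF AB(1) x] by blast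
    show "(\<Union>y'\<in>proj B y. proj ?C (pcomp P A a B x' y')) = proj ?C (pcomp P A a B x' y)"
      by (rule UN_proj_map[OF AB(2) C pcomp_hom_right[OF AB x'] _ y])
        (use ideal AB x' in \<open>simp add: operad_ideal_def\<close>)
  qed
  also have "\<dots> = proj ?C (pcomp P A a B x y)"
    by (rule UN_proj_map[OF AB(1) C pcomp_hom_left[OF AB y] _ x])
      (use ideal AB y in \<open>simp add: operad_ideal_def\<close>)
  finally show ?thesis ..
qed

lemma operad_quotient: "operad (quotient_operad P I)"
  by (rule operad_image[where f = proj, OF operad_axioms])
    (simp_all add: quotient_operad_simps(1,6) proj_add proj_zero proj_smult proj_relabel proj_pcomp)

lemma operad_hom_proj: "operad_hom P (quotient_operad P I) proj"
  unfolding operad_hom_def species_hom_def mod_hom_def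
  by (auto simp: quotient_operad_simps(1,6) proj_add proj_smult proj_relabel proj_pcomp)

end

section \<open>Kernels of morphisms and factorisation through quotients\<close>

lemma mod_hom_zero:
  assumes "Module.module R M" "Module.module R N" "h \<in> mod_hom R M N"
  shows "h \<zero>\<^bsub>M\<^esub> = \<zero>\<^bsub>N\<^esub>"
proof -
  interpret M: Module.module R M by fact
  interpret N: Module.module R N by fact
  show ?thesis using mod_hom_finsum[OF assms, of "{}"] by simp
qed

locale operad_morphism = P: operad P + Q: operad Q
  for P :: "('l, 'k::{comm_ring,comm_monoid_mult}, 'm, 'y) operad_scheme"
    and Q :: "('l, 'k, 'n, 'z) operad_scheme" +
  fixes h :: "'l set \<Rightarrow> 'm \<Rightarrow> 'n"
  assumes hom: "operad_hom P Q h"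
begin

lemma h_mod_hom: "finite A \<Longrightarrow> h A \<in> mod_hom scalars (component P A) (component Q A)"
  using hom by (simp add: operad_hom_def species_hom_def)

lemma h_closed: "finite A \<Longrightarrow> x \<in> elts P A \<Longrightarrow> h A x \<in> elts Q A"
  using mod_homD(1)[OF h_mod_hom] .

lemma h_relabel: "finite A \<Longrightarrow> inj_on \<sigma> A \<Longrightarrow> x \<in> elts P A \<Longrightarrow>
    h (\<sigma> ` A) (relabel P \<sigma> A x) = relabel Q \<sigma> A (h A x)"
  using hom by (simp add: operad_hom_def species_hom_def)

lemma h_ident: "h {a} (ident P a) = ident Q a"
  using hom by (simp add: operad_hom_def)

lemma h_pcomp: "finite A \<Longrightarrow> finite B \<Longrightarrow> A \<inter> B = {} \<Longrightarrow> a \<in> A \<Longrightarrow> x \<in> elts P A \<Longrightarrow> y \<in> elts P B \<Longrightarrow>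
    h (A - {a} \<union> B) (pcomp P A a B x y) = pcomp Q A a B (h A x) (h B y)"
  using hom by (simp add: operad_hom_def)

definition kernel :: "'l set \<Rightarrow> 'm set" where
  "kernel A = {x \<in> elts P A. h A x = \<zero>\<^bsub>component Q A\<^esub>}"

lemma submodule_kernel: "finite A \<Longrightarrow> submodule (kernel A) scalars (component P A)"
proof -
  assume A: "finite A"
  interpret M: Module.module scalars "component P A" by (rule P.module_component[OF A])
  interpret N: Module.module scalars "component Q A" by (rule Q.module_component[OF A])
  note H = mod_homD[OF h_mod_hom[OF A]]
  have zero: "h A \<zero>\<^bsub>component P A\<^esub> = \<zero>\<^bsub>component Q A\<^esub>"
    by (rule mod_hom_zero[OF M.module_axioms N.module_axioms h_mod_hom[OF A]])
  show ?thesis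
  proof (rule M.submoduleI)
    show "\<ominus>\<^bsub>component P A\<^esub> x \<in> kernel A" if x: "x \<in> kernel A" for x
    proof -
      have "h A (\<ominus>\<^bsub>component P A\<^esub> x \<oplus>\<^bsub>component P A\<^esub> x) = \<zero>\<^bsub>component Q A\<^esub>"
        using x zero by (simp add: kernel_def M.l_neg)
      then show ?thesis
        using x H(1)[of "\<ominus>\<^bsub>component P A\<^esub> x"] H(2)[of "\<ominus>\<^bsub>component P A\<^esub> x" x] by (simp add: kernel_def)
    qed
    show "c \<odot>\<^bsub>component P A\<^esub> x \<in> kernel A" if "x \<in> kernel A" for c x
      using that H(3)[of x c] M.smult_closed[of c x] N.smult_r_null[of c] by (simp add: kernel_def)
  qed (auto simp: kernel_def zero H)
qed

lemma operad_ideal_kernel: "operad_ideal P kernel"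
  unfolding operad_ideal_def
proof (intro conjI allI impI; (elim conjE)?)
  fix A :: "'l set" assume "finite A" then show "submodule (kernel A) scalars (component P A)" by (rule submodule_kernel)
next
  fix A :: "'l set" and \<sigma> :: "'l \<Rightarrow> 'l" and x
  assume A: "finite A" "inj_on \<sigma> A" and "x \<in> kernel A"
  then have x: "x \<in> elts P A" "h A x = \<zero>\<^bsub>component Q A\<^esub>" by (simp_all add: kernel_def)
  have "relabel Q \<sigma> A \<zero>\<^bsub>component Q A\<^esub> = \<zero>\<^bsub>component Q (\<sigma> ` A)\<^esub>"
    by (rule mod_hom_zero[OF Q.module_component Q.module_component Q.relabel_hom]) (use A in simp_all)
  then show "relabel P \<sigma> A x \<in> kernel (\<sigma> ` A)"
    using P.relabel_closed[OF A x(1)] h_relabel[OF A x(1)] x(2) by (simp add: kernel_def)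
next
  fix A B a x y
  assume AB: "finite A" "finite B" "A \<inter> B = {}" "a \<in> A" and "x \<in> kernel A" and y: "y \<in> elts P B"
  then have x: "x \<in> elts P A" "h A x = \<zero>\<^bsub>component Q A\<^esub>" by (simp_all add: kernel_def)
  have "pcomp Q A a B \<zero>\<^bsub>component Q A\<^esub> (h B y) = \<zero>\<^bsub>component Q (A - {a} \<union> B)\<^esub>"
    by (rule mod_hom_zero[OF Q.module_component Q.module_component Q.pcomp_hom_left[OF AB h_closed[OF AB(2) y]]])
      (use AB in simp_all)
  then show "pcomp P A a B x y \<in> kernel (A - {a} \<union> B)"
    using P.pcomp_closed[OF AB x(1) y] h_pcomp[OF AB x(1) y] x(2) by (simp add: kernel_def)
next
  fix A B a x y
  assume AB: "finite A" "finite B" "A \<inter> B = {}" "a \<in> A" and x: "x \<in> elts P A" and "y \<in> kernel B"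
  then have y: "y \<in> elts P B" "h B y = \<zero>\<^bsub>component Q B\<^esub>" by (simp_all add: kernel_def)
  have "pcomp Q A a B (h A x) \<zero>\<^bsub>component Q B\<^esub> = \<zero>\<^bsub>component Q (A - {a} \<union> B)\<^esub>"
    by (rule mod_hom_zero[OF Q.module_component Q.module_component Q.pcomp_hom_right[OF AB h_closed[OF AB(1) x]]])
      (use AB in simp_all)
  then show "pcomp P A a B x y \<in> kernel (A - {a} \<union> B)"
    using P.pcomp_closed[OF AB x y(1)] h_pcomp[OF AB x y(1)] y(2) by (simp add: kernel_def)
qed

end

lemma operad_hom_quotient:
  fixes P :: "('l, 'k::{comm_ring,comm_monoid_mult}, 'm, 'y) operad_scheme"
    and Q :: "('l, 'k, 'n, 'z) operad_scheme"
  assumes P: "operad P" and Q: "operad Q" and I: "operad_ideal P I" and h: "operad_hom P Q h"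
    and ker: "\<And>A x. finite A \<Longrightarrow> x \<in> I A \<Longrightarrow> h A x = \<zero>\<^bsub>component Q A\<^esub>"
  obtains g where "operad_hom (quotient_operad P I) Q g"
    "\<And>A x. finite A \<Longrightarrow> x \<in> elts P A \<Longrightarrow> g A (coset_of P I A x) = h A x"
proof -
  interpret operad_with_ideal P I using P I by (simp add: operad_with_ideal_def operad_with_ideal_axioms_def)
  interpret operad_morphism P Q h using P Q h by (simp add: operad_morphism_def operad_morphism_axioms_def)
  \<comment> \<open>A representative is chosen arbitrarily; two elements of a coset differ by an
    element of the ideal, which \<open>h\<close> kills.\<close>
  define g where "g A X = h A (SOME x. x \<in> X)" for A X
  have g: "g A (proj A x) = h A x" if A: "finite A" and x: "x \<in> elts P A" for A x
  proof -
    interpret N: Module.module scalars "component Q A" by (rule Q.module_component[OF A])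
    have "(SOME y. y \<in> proj A x) \<in> proj A x" using proj_self[OF A x] by (rule someI)
    then obtain z where z: "z \<in> I A" "(SOME y. y \<in> proj A x) = z \<oplus>\<^bsub>component P A\<^esub> x"
      using proj_iff[OF A x] by blast
    have "z \<in> elts P A" using z(1) ideal_subset[OF A] by blast
    then have "h A (z \<oplus>\<^bsub>component P A\<^esub> x) = h A x"
      using mod_homD(2)[OF h_mod_hom[OF A], of z x] x ker[OF A z(1)] h_closed[OF A x] by simp
    then show ?thesis unfolding g_def z(2) .
  qed
  let ?P = "quotient_operad P I"
  have h1: "g A \<in> mod_hom scalars (component ?P A) (component Q A)" if A: "finite A" for A
    unfolding mod_hom_def
  proof (intro CollectI conjI ballI funcsetI)
    interpret M: Module.module scalars "component P A" by (rule module_component[OF A])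
    note H = mod_homD[OF h_mod_hom[OF A]]
    fix X assume "X \<in> elts ?P A"
    then obtain x where x: "x \<in> elts P A" "X = proj A x" by (auto simp: quotient_operad_simps(1))
    show "g A X \<in> elts Q A" using g[OF A x(1)] H(1)[OF x(1)] x(2) by simp
    show "g A (c \<odot>\<^bsub>component ?P A\<^esub> X) = c \<odot>\<^bsub>component Q A\<^esub> g A X" for c
      using g[OF A x(1)] g[OF A M.smult_closed[of c, OF _ x(1)]] H(3)[OF x(1), of c] x(2)
      by (simp flip: proj_smult[OF A x(1)])
    fix Y assume "Y \<in> elts ?P A"
    then obtain y where y: "y \<in> elts P A" "Y = proj A y" by (auto simp: quotient_operad_simps(1))
    show "g A (X \<oplus>\<^bsub>component ?P A\<^esub> Y) = g A X \<oplus>\<^bsub>component Q A\<^esub> g A Y"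
      using g[OF A x(1)] g[OF A y(1)] g[OF A M.add.m_closed[OF x(1) y(1)]] H(2)[OF x(1) y(1)] x(2) y(2)
      by (simp flip: proj_add[OF A x(1) y(1)])
  qed
  have h2: "g (\<sigma> ` A) (relabel ?P \<sigma> A X) = relabel Q \<sigma> A (g A X)"
    if A: "finite A" "inj_on \<sigma> A" "X \<in> elts ?P A" for A \<sigma> X
  proof -
    obtain x where x: "x \<in> elts P A" "X = proj A x" using A(3) by (auto simp: quotient_operad_simps(1))
    show ?thesis
      using g[OF A(1) x(1)] g[OF finite_imageI[OF A(1)] relabel_closed[OF A(1,2) x(1)]] h_relabel[OF A(1,2) x(1)]
      by (simp add: x(2) flip: proj_relabel[OF A(1,2) x(1)])
  qed
  have h3: "g {a} (ident ?P a) = ident Q a" for a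
    by (simp add: quotient_operad_simps(6) g ident_closed h_ident)
  have h4: "g (A - {a} \<union> B) (pcomp ?P A a B X Y) = pcomp Q A a B (g A X) (g B Y)"
    if AB: "finite A" "finite B" "A \<inter> B = {}" "a \<in> A" and XY: "X \<in> elts ?P A" "Y \<in> elts ?P B" for A B a X Y
  proof -
    obtain x y where x: "x \<in> elts P A" "X = proj A x" and y: "y \<in> elts P B" "Y = proj B y"
      using XY by (auto simp: quotient_operad_simps(1))
    have "finite (A - {a} \<union> B)" using AB by simp
    then show ?thesis
      using g[OF AB(1) x(1)] g[OF AB(2) y(1)] g[OF _ pcomp_closed[OF AB x(1) y(1)]] h_pcomp[OF AB x(1) y(1)]
      by (simp add: x(2) y(2) flip: proj_pcomp[OF AB x(1) y(1)])
  qed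
  have "operad_hom ?P Q g"
    unfolding operad_hom_def species_hom_def
  proof (intro conjI allI impI; (elim conjE)?)
  qed (rule h1 h2 h3 h4; assumption?)+
  then show thesis using g by (rule that)
qed

section \<open>The ideal generated by a family of elements\<close>

lemma (in operad) operad_ideal_elts: "operad_ideal P (elts P)"
  unfolding operad_ideal_def
proof (intro conjI allI impI; (elim conjE)?)
  fix A :: "'l set" assume "finite A"
  then interpret M: Module.module scalars "component P A" by (rule module_component)
  show "submodule (elts P A) scalars (component P A)" by (rule M.carrier_is_submodule)
next
  fix A :: "'l set" and \<sigma> :: "'l \<Rightarrow> 'l" and x
  assume "finite A" "inj_on \<sigma> A" "x \<in> elts P A"
  then show "relabel P \<sigma> A x \<in> elts P (\<sigma> ` A)" by (rule relabel_closed)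
next
  fix A B a x y
  assume "finite A" "finite B" "A \<inter> B = {}" "a \<in> A" "x \<in> elts P A" "y \<in> elts P B"
  then show "pcomp P A a B x y \<in> elts P (A - {a} \<union> B)" by (rule pcomp_closed)
next
  fix A B a x y
  assume "finite A" "finite B" "A \<inter> B = {}" "a \<in> A" "x \<in> elts P A" "y \<in> elts P B"
  then show "pcomp P A a B x y \<in> elts P (A - {a} \<union> B)" by (rule pcomp_closed)
qed

lemma generated_ideal_least:
  "operad_ideal P J \<Longrightarrow> (\<And>B. finite B \<Longrightarrow> G B \<subseteq> J B) \<Longrightarrow> generated_ideal P G A \<subseteq> J A"
  by (auto simp: generated_ideal_def)

lemma generated_ideal_incl: "finite A \<Longrightarrow> G A \<subseteq> generated_ideal P G A"
  by (auto simp: generated_ideal_def)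

text \<open>Every closure condition passes to intersections. The hypothesis on \<open>G\<close> puts
  the ideal of all elements into the intersected family, which keeps the intersection inside
  \<open>elts P\<close>.\<close>

lemma (in operad) operad_ideal_generated:
  assumes G: "\<And>A. finite A \<Longrightarrow> G A \<subseteq> elts P A"
  shows "operad_ideal P (generated_ideal P G)"
proof -
  let ?I = "generated_ideal P G"
  have mem: "x \<in> ?I A \<longleftrightarrow> (\<forall>J. operad_ideal P J \<and> (\<forall>B. finite B \<longrightarrow> G B \<subseteq> J B) \<longrightarrow> x \<in> J A)" for x A
    unfolding generated_ideal_def by blast
  have g1: "submodule (?I A) scalars (component P A)" if A: "finite A" for A
  proof -
    interpret M: Module.module scalars "component P A" by (rule module_component[OF A])
    have sub: "submodule (J A) scalars (component P A)" if "operad_ideal P J" for J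
      using that A by (simp add: operad_ideal_def)
    have zero: "\<zero>\<^bsub>component P A\<^esub> \<in> J A" if "operad_ideal P J" for J
      using subgroup.one_closed[OF submodule.axioms(1)[OF sub[OF that]]] by simp
    show ?thesis
    proof (rule M.submoduleI)
      show "?I A \<subseteq> elts P A"
        by (rule generated_ideal_least[OF operad_ideal_elts G])
      show "c \<odot>\<^bsub>component P A\<^esub> x \<in> ?I A" if "c \<in> carrier scalars" "x \<in> ?I A" for c x
        using that M.submoduleE(4)[OF sub] unfolding mem by blast
    next
      show "\<zero>\<^bsub>component P A\<^esub> \<in> ?I A" using zero unfolding mem by blast
      show "\<ominus>\<^bsub>component P A\<^esub> x \<in> ?I A" if "x \<in> ?I A" for x
        using that M.submoduleE(3)[OF sub] unfolding mem by blast
      show "x \<oplus>\<^bsub>component P A\<^esub> y \<in> ?I A" if "x \<in> ?I A" "y \<in> ?I A" for x y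
        using that M.submoduleE(5)[OF sub] unfolding mem by blast
    qed
  qed
  have g2: "relabel P \<sigma> A x \<in> ?I (\<sigma> ` A)" if A: "finite A" "inj_on \<sigma> A" and x: "x \<in> ?I A" for A \<sigma> x
    unfolding mem
  proof (intro allI impI)
    fix J assume J: "operad_ideal P J \<and> (\<forall>B. finite B \<longrightarrow> G B \<subseteq> J B)"
    then have "x \<in> J A" using x unfolding mem by simp
    then show "relabel P \<sigma> A x \<in> J (\<sigma> ` A)" using J A by (simp add: operad_ideal_def)
  qed
  have g3: "pcomp P A a B x y \<in> ?I (A - {a} \<union> B)"
    if AB: "finite A" "finite B" "A \<inter> B = {}" "a \<in> A" and x: "x \<in> ?I A" and y: "y \<in> elts P B" for A B a x y
    unfolding mem
  proof (intro allI impI)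
    fix J assume J: "operad_ideal P J \<and> (\<forall>B. finite B \<longrightarrow> G B \<subseteq> J B)"
    then have "x \<in> J A" using x unfolding mem by simp
    then show "pcomp P A a B x y \<in> J (A - {a} \<union> B)" using J AB y by (simp add: operad_ideal_def)
  qed
  have g4: "pcomp P A a B x y \<in> ?I (A - {a} \<union> B)"
    if AB: "finite A" "finite B" "A \<inter> B = {}" "a \<in> A" and x: "x \<in> elts P A" and y: "y \<in> ?I B" for A B a x y
    unfolding mem
  proof (intro allI impI)
    fix J assume J: "operad_ideal P J \<and> (\<forall>B. finite B \<longrightarrow> G B \<subseteq> J B)"
    then have "y \<in> J B" using y unfolding mem by simp
    then show "pcomp P A a B x y \<in> J (A - {a} \<union> B)" using J AB x by (simp add: operad_ideal_def)
  qed
  show ?thesis unfolding operad_ideal_def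
  proof (intro conjI allI impI; (elim conjE)?)
  qed (rule g1 g2 g3 g4; assumption)+
qed

section \<open>Hanging a rooted tree below a vertex of another one\<close>

lemma typed_treesI:
  assumes "rt_root T \<in> A"
    and "\<And>w \<eta> u. (w, \<eta>, u) \<in> rt_edges T \<Longrightarrow> w \<in> A \<and> w \<noteq> rt_root T \<and> u \<in> A"
    and "\<And>w \<eta> u \<eta>' u'. (w, \<eta>, u) \<in> rt_edges T \<Longrightarrow> (w, \<eta>', u') \<in> rt_edges T \<Longrightarrow> \<eta> = \<eta>' \<and> u = u'"
    and "\<And>w. w \<in> A \<Longrightarrow> w \<noteq> rt_root T \<Longrightarrow> \<exists>\<eta> u. (w, \<eta>, u) \<in> rt_edges T"
    and "\<And>w. w \<in> A \<Longrightarrow> (w, rt_root T) \<in> (parent_rel T)\<^sup>*"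
  shows "T \<in> typed_trees A"
proof -
  have "\<exists>!e. e \<in> rt_edges T \<and> fst e = w" if w: "w \<in> A" "w \<noteq> rt_root T" for w
  proof -
    obtain \<eta> u where e: "(w, \<eta>, u) \<in> rt_edges T" using assms(4)[OF w] by blast
    show ?thesis
    proof (rule ex1I[of _ "(w, \<eta>, u)"])
      fix e' assume "e' \<in> rt_edges T \<and> fst e' = w"
      then show "e' = (w, \<eta>, u)" using assms(3)[OF e] by (cases e') auto
    qed (use e in simp)
  qed
  moreover have "rt_edges T \<subseteq> (A - {rt_root T}) \<times> UNIV \<times> A"
    using assms(2) by (auto simp: subset_iff)
  ultimately show ?thesis using assms(1,5) unfolding typed_trees_def by simp
qed

lemma typed_treesD:
  assumes "T \<in> typed_trees A"
  shows "rt_root T \<in> A"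
    and "(w, \<eta>, u) \<in> rt_edges T \<Longrightarrow> w \<in> A \<and> w \<noteq> rt_root T \<and> u \<in> A"
    and "(w, \<eta>, u) \<in> rt_edges T \<Longrightarrow> (w, \<eta>', u') \<in> rt_edges T \<Longrightarrow> \<eta> = \<eta>' \<and> u = u'"
    and "w \<in> A \<Longrightarrow> w \<noteq> rt_root T \<Longrightarrow> \<exists>\<eta> u. (w, \<eta>, u) \<in> rt_edges T"
    and "w \<in> A \<Longrightarrow> (w, rt_root T) \<in> (parent_rel T)\<^sup>*"
proof -
  note all = assms[unfolded typed_trees_def mem_Collect_eq]
  note root = all[THEN conjunct1] and sub = all[THEN conjunct2, THEN conjunct1]
    and ex1 = all[THEN conjunct2, THEN conjunct2, THEN conjunct1]
    and reach = all[THEN conjunct2, THEN conjunct2, THEN conjunct2]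
  show "rt_root T \<in> A" by (rule root)
  show "(w, rt_root T) \<in> (parent_rel T)\<^sup>*" if "w \<in> A" using reach that by simp
  show edge: "w \<in> A \<and> w \<noteq> rt_root T \<and> u \<in> A" if "(w, \<eta>, u) \<in> rt_edges T" for w \<eta> u
    using subsetD[OF sub that] by simp
  show "\<exists>\<eta> u. (w, \<eta>, u) \<in> rt_edges T" if w: "w \<in> A" "w \<noteq> rt_root T"
  proof -
    obtain e where "e \<in> rt_edges T" "fst e = w" using ex1 w by blast
    then show ?thesis by (cases e) auto
  qed
  show "\<eta> = \<eta>' \<and> u = u'" if e: "(w, \<eta>, u) \<in> rt_edges T" "(w, \<eta>', u') \<in> rt_edges T"
  proof -
    have "\<exists>!e. e \<in> rt_edges T \<and> fst e = w" using ex1 edge[OF e(1)] by simp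
    from ex1E[OF this] have "(w, \<eta>, u) = (w, \<eta>', u')" using e by (metis fst_conv)
    then show ?thesis by simp
  qed
qed

lemma parent_rel_iff: "(w, u) \<in> parent_rel T \<longleftrightarrow> (\<exists>\<eta>. (w, \<eta>, u) \<in> rt_edges T)"
  by (simp add: parent_rel_def)

lemma parent_rel_mem:
  "T \<in> typed_trees A \<Longrightarrow> (w, u) \<in> parent_rel T \<Longrightarrow> w \<in> A \<and> w \<noteq> rt_root T \<and> u \<in> A"
  unfolding parent_rel_iff by (elim exE) (rule typed_treesD(2))

lemma single_valued_parent_rel: "T \<in> typed_trees A \<Longrightarrow> single_valued (parent_rel T)"
  unfolding single_valued_def parent_rel_iff using typed_treesD(3) by meson

lemma root_rtrancl: "(rt_root T, y) \<in> (parent_rel T)\<^sup>* \<Longrightarrow> T \<in> typed_trees A \<Longrightarrow> y = rt_root T"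
  by (erule converse_rtranclE) (auto dest: parent_rel_mem)

text \<open>As parents are unique, the walk to the root from a vertex on a cycle can never leave the
  cycle. The root would then lie on the cycle, but no edge leaves the root.\<close>

lemma acyclic_parent_rel:
  assumes T: "T \<in> typed_trees A"
  shows "(x, x) \<notin> (parent_rel T)\<^sup>+"
proof
  assume x: "(x, x) \<in> (parent_rel T)\<^sup>+"
  then obtain x' where "(x, x') \<in> parent_rel T" by (blast dest: tranclD)
  then have xA: "x \<in> A" "x \<noteq> rt_root T" using parent_rel_mem[OF T] by blast+
  have "(y, x) \<in> (parent_rel T)\<^sup>*" if "(x, y) \<in> (parent_rel T)\<^sup>*" for y
    using that
  proof (induction rule: rtrancl_induct)
    case (step y z)
    have "(y, x) \<in> (parent_rel T)\<^sup>+"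
    proof (cases "y = x")
      case False then show ?thesis using rtranclD[OF step.IH] by blast
    qed (use x in simp)
    then obtain z' where z': "(y, z') \<in> parent_rel T" "(z', x) \<in> (parent_rel T)\<^sup>*"
      by (blast dest: tranclD)
    have "z' = z" by (rule single_valuedD[OF single_valued_parent_rel[OF T] z'(1) step.hyps(2)])
    then show ?case using z' by simp
  qed simp
  then have "(rt_root T, x) \<in> (parent_rel T)\<^sup>*" using typed_treesD(5)[OF T xA(1)] by blast
  then have "x = rt_root T" by (rule root_rtrancl[OF _ T])
  then show False using xA(2) by contradiction
qed

text \<open>The ancestors of \<open>u\<close> form a chain, so two children of \<open>a\<close>
  among them are comparable; if they were distinct, the path between them would run through
  \<open>a\<close> and close a cycle. Thus the path from \<open>u\<close> enters \<open>a\<close> by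
  one edge only.\<close>

lemma unique_child_above:
  assumes T: "T \<in> typed_trees A" and c: "(u, c) \<in> (parent_rel T)\<^sup>*" "(c, a) \<in> parent_rel T"
    and d: "(u, d) \<in> (parent_rel T)\<^sup>*" "(d, a) \<in> parent_rel T"
  shows "c = d"
proof -
  note sv = single_valued_parent_rel[OF T]
  have *: "c = d" if "(c, d) \<in> (parent_rel T)\<^sup>*" "(c, a) \<in> parent_rel T" "(d, a) \<in> parent_rel T" for c d
    using that(1)
  proof (cases rule: converse_rtranclE)
    case (step y)
    then have "y = a" using single_valuedD[OF sv step(1) that(2)] by simp
    then have "(a, a) \<in> (parent_rel T)\<^sup>+" using rtrancl_into_trancl1[OF step(2) that(3)] by simp
    then show ?thesis using acyclic_parent_rel[OF T] by blast
  qed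
  have "(c, d) \<in> (parent_rel T)\<^sup>* \<or> (d, c) \<in> (parent_rel T)\<^sup>*"
    using single_valued_confluent[OF sv c(1) d(1)] .
  then show ?thesis using *[OF _ c(2) d(2)] *[OF _ d(2) c(2)] by blast
qed

lemma finite_rt_edges:
  assumes "T \<in> typed_trees A" "finite A"
  shows "finite (rt_edges T)"
proof (rule inj_on_finite[of fst])
  show "inj_on fst (rt_edges T)"
  proof (rule inj_onI)
    fix e e' assume e: "e \<in> rt_edges T" "e' \<in> rt_edges T" "fst e = fst e'"
    obtain w \<eta> u \<eta>' u' where "e = (w, \<eta>, u)" "e' = (w, \<eta>', u')" using e(3) by (cases e, cases e') auto
    then show "e = e'" using e typed_treesD(3)[OF assms(1), of w \<eta> u \<eta>' u'] by simp
  qed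
  show "fst ` rt_edges T \<subseteq> A" using typed_treesD(2)[OF assms(1)] by auto
qed fact

section \<open>Hanging a tree: ancestors, well-formedness, relabelling\<close>

text \<open>An edge is represented by its child end \<open>w\<close>. It lies on the path from
  \<open>u\<close> to the root iff \<open>w\<close> is reached from \<open>u\<close>, the case
  \<open>w = u\<close> included; hence the reflexive closure.\<close>

definition path_mult :: "'w::ab_semigroup_mult \<Rightarrow> 'l \<Rightarrow> ('l, 'w) rtree \<Rightarrow> 'l \<Rightarrow> 'w \<Rightarrow> 'w" where
  "path_mult \<omega> u S w \<eta> = (if (u, w) \<in> (parent_rel S)\<^sup>* then \<omega> * \<eta> else \<eta>)"

definition hang :: "'w::ab_semigroup_mult \<Rightarrow> ('l, 'w) rtree \<Rightarrow> 'l \<Rightarrow> ('l, 'w) rtree \<Rightarrow> ('l, 'w) rtree" where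
  "hang \<omega> T u S = RTree (rt_root S)
     (insert (rt_root T, \<omega>, u) (rt_edges T) \<union>
      {(w, path_mult \<omega> u S w \<eta>, x) | w \<eta> x. (w, \<eta>, x) \<in> rt_edges S})"

lemma rt_root_hang [simp]: "rt_root (hang \<omega> T u S) = rt_root S"
  by (simp add: hang_def)

lemma rt_edges_hang:
  "(w, \<eta>, x) \<in> rt_edges (hang \<omega> T u S) \<longleftrightarrow> w = rt_root T \<and> \<eta> = \<omega> \<and> x = u \<or> (w, \<eta>, x) \<in> rt_edges T \<or>
    (\<exists>\<zeta>. (w, \<zeta>, x) \<in> rt_edges S \<and> \<eta> = path_mult \<omega> u S w \<zeta>)"
  by (auto simp: hang_def)

lemma rt_edges_hangE:
  assumes "(w, \<eta>, x) \<in> rt_edges (hang \<omega> T u S)"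
  obtains "w = rt_root T" "\<eta> = \<omega>" "x = u" | "(w, \<eta>, x) \<in> rt_edges T"
    | \<zeta> where "(w, \<zeta>, x) \<in> rt_edges S" "\<eta> = path_mult \<omega> u S w \<zeta>"
  using assms unfolding rt_edges_hang by blast

lemma rt_edges_hangI:
  "(rt_root T, \<omega>, u) \<in> rt_edges (hang \<omega> T u S)"
  "(w, \<eta>, x) \<in> rt_edges T \<Longrightarrow> (w, \<eta>, x) \<in> rt_edges (hang \<omega> T u S)"
  "(w, \<eta>, x) \<in> rt_edges S \<Longrightarrow> (w, path_mult \<omega> u S w \<eta>, x) \<in> rt_edges (hang \<omega> T u S)"
  unfolding rt_edges_hang by blast+

lemma parent_rel_hang:
  "parent_rel (hang \<omega> T u S) = insert (rt_root T, u) (parent_rel T \<union> parent_rel S)"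
proof (rule Set.set_eqI)
  fix p :: "'a \<times> 'a"
  obtain w x where p: "p = (w, x)" by (cases p)
  show "p \<in> parent_rel (hang \<omega> T u S) \<longleftrightarrow> p \<in> insert (rt_root T, u) (parent_rel T \<union> parent_rel S)"
    unfolding p parent_rel_iff rt_edges_hang insert_iff Un_iff prod.inject by blast
qed

text \<open>The only edge between the two parts leads from the root of \<open>T\<close> to
  \<open>u\<close>. A path therefore crosses at most once, and as every vertex of \<open>T\<close>
  reaches that root, it reaches in \<open>S\<close> exactly what \<open>u\<close> reaches.\<close>

lemma rtrancl_hang:
  assumes T: "T \<in> typed_trees A" and S: "S \<in> typed_trees B" and AB: "A \<inter> B = {}" and u: "u \<in> B"
    and x: "x \<in> A \<union> B"
  shows "(x, y) \<in> (parent_rel (hang \<omega> T u S))\<^sup>* \<longleftrightarrow>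
    x \<in> A \<and> y \<in> A \<and> (x, y) \<in> (parent_rel T)\<^sup>* \<or> x \<in> B \<and> y \<in> B \<and> (x, y) \<in> (parent_rel S)\<^sup>* \<or>
    x \<in> A \<and> y \<in> B \<and> (u, y) \<in> (parent_rel S)\<^sup>*" (is "_ \<longleftrightarrow> ?R y")
proof
  assume "(x, y) \<in> (parent_rel (hang \<omega> T u S))\<^sup>*"
  then show "?R y"
  proof (induction rule: rtrancl_induct)
    case base then show ?case using x by blast
  next
    case (step y z)
    consider "y = rt_root T" "z = u" | "(y, z) \<in> parent_rel T" | "(y, z) \<in> parent_rel S"
      using step.hyps(2) unfolding parent_rel_hang by blast
    then show ?case
    proof cases
      case 1 then show ?thesis using step.IH AB u typed_treesD(1)[OF T] by blast
    next
      case 2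
      then have "y \<in> A" "z \<in> A" using parent_rel_mem[OF T] by blast+
      then show ?thesis using step.IH 2 AB by (meson disjoint_iff rtrancl.rtrancl_into_rtrancl)
    next
      case 3
      then have "y \<in> B" "z \<in> B" using parent_rel_mem[OF S] by blast+
      then show ?thesis using step.IH 3 AB by (meson disjoint_iff rtrancl.rtrancl_into_rtrancl)
    qed
  qed
next
  have PT: "(x, y) \<in> (parent_rel T)\<^sup>* \<Longrightarrow> (x, y) \<in> (parent_rel (hang \<omega> T u S))\<^sup>*" for x y
    by (erule rtrancl_mono[THEN subsetD, rotated]) (auto simp: parent_rel_hang)
  have PS: "(x, y) \<in> (parent_rel S)\<^sup>* \<Longrightarrow> (x, y) \<in> (parent_rel (hang \<omega> T u S))\<^sup>*" for x y
    by (erule rtrancl_mono[THEN subsetD, rotated]) (auto simp: parent_rel_hang)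
  have "(x, y) \<in> (parent_rel (hang \<omega> T u S))\<^sup>*" if "x \<in> A" "(u, y) \<in> (parent_rel S)\<^sup>*"
  proof -
    have "(rt_root T, u) \<in> parent_rel (hang \<omega> T u S)" by (simp add: parent_rel_hang)
    then show ?thesis using PT[OF typed_treesD(5)[OF T that(1)]] PS[OF that(2)] by (meson rtrancl_trans r_into_rtrancl)
  qed
  then show "?R y \<Longrightarrow> (x, y) \<in> (parent_rel (hang \<omega> T u S))\<^sup>*" using PT PS by blast
qed

lemma hang_typed_trees:
  assumes T: "T \<in> typed_trees A" and S: "S \<in> typed_trees B" and AB: "A \<inter> B = {}" and u: "u \<in> B"
  shows "hang \<omega> T u S \<in> typed_trees (A \<union> B)"
proof (rule typed_treesI)
  note tD = typed_treesD[OF T] and sD = typed_treesD[OF S]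
  show "rt_root (hang \<omega> T u S) \<in> A \<union> B" using sD(1) by simp
  show "w \<in> A \<union> B \<and> w \<noteq> rt_root (hang \<omega> T u S) \<and> x \<in> A \<union> B"
    if "(w, \<eta>, x) \<in> rt_edges (hang \<omega> T u S)" for w \<eta> x
    using that
  proof (cases rule: rt_edges_hangE)
    case 1 then show ?thesis using tD(1) sD(1) AB u by auto
  next
    case 2 from tD(2)[OF this] show ?thesis using sD(1) AB by auto
  next
    case 3 from sD(2)[OF 3(1)] show ?thesis by simp
  qed
  show "\<eta> = \<eta>' \<and> x = x'"
    if e: "(w, \<eta>, x) \<in> rt_edges (hang \<omega> T u S)" "(w, \<eta>', x') \<in> rt_edges (hang \<omega> T u S)" for w \<eta> x \<eta>' x'
  proof (cases "w \<in> A")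
    case True
    have *: "w = rt_root T \<and> \<eta> = \<omega> \<and> x = u \<or> w \<noteq> rt_root T \<and> (w, \<eta>, x) \<in> rt_edges T"
      if "(w, \<eta>, x) \<in> rt_edges (hang \<omega> T u S)" for \<eta> x
      using that
    proof (cases rule: rt_edges_hangE)
      case 2 then show ?thesis using tD(2)[OF 2] by simp
    next
      case 3 then show ?thesis using sD(2)[OF 3(1)] True AB by auto
    qed simp
    show ?thesis
    proof (cases "w = rt_root T")
      case True then show ?thesis using *[OF e(1)] *[OF e(2)] by simp
    next
      case False
      then have "(w, \<eta>, x) \<in> rt_edges T" "(w, \<eta>', x') \<in> rt_edges T" using *[OF e(1)] *[OF e(2)] by simp_all
      then show ?thesis by (rule tD(3))
    qed
  next
    case False
    have *: "\<exists>\<zeta>. (w, \<zeta>, x) \<in> rt_edges S \<and> \<eta> = path_mult \<omega> u S w \<zeta>"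
      if "(w, \<eta>, x) \<in> rt_edges (hang \<omega> T u S)" for \<eta> x
      using that
    proof (cases rule: rt_edges_hangE)
      case 1 then show ?thesis using tD(1) False by simp
    next
      case 2 then show ?thesis using tD(2)[OF 2] False by simp
    qed blast
    obtain \<zeta> \<zeta>' where z: "(w, \<zeta>, x) \<in> rt_edges S" "\<eta> = path_mult \<omega> u S w \<zeta>"
      "(w, \<zeta>', x') \<in> rt_edges S" "\<eta>' = path_mult \<omega> u S w \<zeta>'"
      using *[OF e(1)] *[OF e(2)] by blast
    then show ?thesis using sD(3)[OF z(1,3)] by simp
  qed
  show "\<exists>\<eta> x. (w, \<eta>, x) \<in> rt_edges (hang \<omega> T u S)" if w: "w \<in> A \<union> B" "w \<noteq> rt_root (hang \<omega> T u S)" for w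
  proof (cases "w \<in> A")
    case True
    then show ?thesis
      using tD(4)[OF True] rt_edges_hangI(1,2)[where T = T and \<omega> = \<omega> and u = u and S = S] by metis
  next
    case False
    then show ?thesis using sD(4)[of w] w rt_edges_hangI(3)[where T = T and \<omega> = \<omega> and u = u and S = S] by simp metis
  qed
  show "(w, rt_root (hang \<omega> T u S)) \<in> (parent_rel (hang \<omega> T u S))\<^sup>*" if w: "w \<in> A \<union> B" for w
    unfolding rtrancl_hang[OF T S AB u w] rt_root_hang
    using sD(1) sD(5)[of w] sD(5)[OF u] w by simp metis
qed

lemma rt_root_relabel [simp]: "rt_root (relabel_rtree \<sigma> T) = \<sigma> (rt_root T)"
  by (simp add: relabel_rtree_def)

lemma rt_edges_relabel:
  "(w, \<eta>, x) \<in> rt_edges (relabel_rtree \<sigma> T) \<longleftrightarrow> (\<exists>w' x'. w = \<sigma> w' \<and> x = \<sigma> x' \<and> (w', \<eta>, x') \<in> rt_edges T)"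
  unfolding relabel_rtree_def rtree.sel image_iff Bex_def split_paired_Ex split_conv prod.inject by blast

lemma rtrancl_relabel:
  assumes T: "T \<in> typed_trees A" and \<sigma>: "inj_on \<sigma> A" and xy: "x \<in> A" "y \<in> A"
  shows "(\<sigma> x, \<sigma> y) \<in> (parent_rel (relabel_rtree \<sigma> T))\<^sup>* \<longleftrightarrow> (x, y) \<in> (parent_rel T)\<^sup>*"
proof
  have edge: "(v, w) \<in> parent_rel (relabel_rtree \<sigma> T) \<longleftrightarrow> (\<exists>v' w'. v = \<sigma> v' \<and> w = \<sigma> w' \<and> (v', w') \<in> parent_rel T)" for v w
    by (auto simp: parent_rel_iff rt_edges_relabel)
  { assume "(x, y) \<in> (parent_rel T)\<^sup>*"
    then show "(\<sigma> x, \<sigma> y) \<in> (parent_rel (relabel_rtree \<sigma> T))\<^sup>*"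
    proof (induction rule: rtrancl_induct)
      case (step y z)
      then have "(\<sigma> y, \<sigma> z) \<in> parent_rel (relabel_rtree \<sigma> T)" using edge by blast
      then show ?case using step.IH by simp
    qed simp }
  assume "(\<sigma> x, \<sigma> y) \<in> (parent_rel (relabel_rtree \<sigma> T))\<^sup>*"
  \<comment> \<open>A path in the relabelled tree is lifted edge by edge; injectivity identifies the
    end of one lifted edge with the start of the next.\<close>
  moreover have "\<exists>y'\<in>A. z = \<sigma> y' \<and> (x, y') \<in> (parent_rel T)\<^sup>*"
    if "(\<sigma> x, z) \<in> (parent_rel (relabel_rtree \<sigma> T))\<^sup>*" for z
    using that
  proof (induction rule: rtrancl_induct)
    case base then show ?case using xy by blast
  next
    case (step v z)
    obtain v1 where v1: "v1 \<in> A" "v = \<sigma> v1" "(x, v1) \<in> (parent_rel T)\<^sup>*" using step.IH by blast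
    obtain v2 w where v2: "v = \<sigma> v2" "z = \<sigma> w" "(v2, w) \<in> parent_rel T" using step.hyps(2) edge by blast
    have m: "v2 \<in> A" "w \<in> A" using parent_rel_mem[OF T v2(3)] by blast+
    have "v1 = v2" using inj_onD[OF \<sigma> _ v1(1) m(1)] v1(2) v2(1) by simp
    then have "(x, w) \<in> (parent_rel T)\<^sup>*" using rtrancl_into_rtrancl[OF v1(3)] v2(3) by simp
    then show ?case using v2(2) m(2) by blast
  qed
  ultimately obtain y' where "y' \<in> A" "\<sigma> y = \<sigma> y'" "(x, y') \<in> (parent_rel T)\<^sup>*" by blast
  then show "(x, y) \<in> (parent_rel T)\<^sup>*" using inj_onD[OF \<sigma> _ xy(2)] by blast
qed

lemma relabel_hang:
  assumes S: "S \<in> typed_trees B" and u: "u \<in> B" and \<sigma>: "inj_on \<sigma> B"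
  shows "relabel_rtree \<sigma> (hang \<omega> T u S) = hang \<omega> (relabel_rtree \<sigma> T) (\<sigma> u) (relabel_rtree \<sigma> S)"
proof (rule rtree.expand, intro conjI Set.set_eqI)
  fix e show "e \<in> rt_edges (relabel_rtree \<sigma> (hang \<omega> T u S)) \<longleftrightarrow>
      e \<in> rt_edges (hang \<omega> (relabel_rtree \<sigma> T) (\<sigma> u) (relabel_rtree \<sigma> S))"
  proof (cases e)
    case (fields w \<eta> x)
    have *: "path_mult \<omega> (\<sigma> u) (relabel_rtree \<sigma> S) (\<sigma> w') \<zeta> = path_mult \<omega> u S w' \<zeta>"
      if "(w', \<zeta>, x') \<in> rt_edges S" for w' \<zeta> x'
      using rtrancl_relabel[OF S \<sigma> u, of w'] typed_treesD(2)[OF S that] by (simp add: path_mult_def)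
    have "(\<exists>\<zeta>. (\<exists>w' x'. w = \<sigma> w' \<and> x = \<sigma> x' \<and> (w', \<zeta>, x') \<in> rt_edges S) \<and> \<eta> = path_mult \<omega> (\<sigma> u) (relabel_rtree \<sigma> S) w \<zeta>) \<longleftrightarrow>
        (\<exists>w' x' \<zeta>. w = \<sigma> w' \<and> x = \<sigma> x' \<and> (w', \<zeta>, x') \<in> rt_edges S \<and> \<eta> = path_mult \<omega> u S w' \<zeta>)"
      (is "?L \<longleftrightarrow> ?R")
    proof
      assume ?L
      then obtain \<zeta> w' x' where e: "w = \<sigma> w'" "x = \<sigma> x'" "(w', \<zeta>, x') \<in> rt_edges S"
        "\<eta> = path_mult \<omega> (\<sigma> u) (relabel_rtree \<sigma> S) w \<zeta>" by blast
      then show ?R using *[OF e(3)] by blast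
    next
      assume ?R
      then obtain \<zeta> w' x' where e: "w = \<sigma> w'" "x = \<sigma> x'" "(w', \<zeta>, x') \<in> rt_edges S"
        "\<eta> = path_mult \<omega> u S w' \<zeta>" by blast
      then have "\<eta> = path_mult \<omega> (\<sigma> u) (relabel_rtree \<sigma> S) w \<zeta>" using *[OF e(3)] by simp
      then show ?L using e by blast
    qed
    then show ?thesis
      unfolding fields rt_edges_hang rt_edges_relabel rt_root_relabel by blast
  qed
qed simp

section \<open>Grafting into a hung tree\<close>

text \<open>The product in \<open>twisted_type\<close>, freed from its index set, so that a change
  of the incoming edges becomes a change of \<open>S\<close>. The seed \<open>x\<close> stands in
  for a unit.\<close>

definition type_prod :: "('l \<times> 'w::ab_semigroup_mult \<times> 'l) set \<Rightarrow> 'w \<Rightarrow> 'w" where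
  "type_prod S x = Finite_Set.fold (\<lambda>e \<eta>. fst (snd e) * \<eta>) x S"

lemma type_prod_empty [simp]: "type_prod {} x = x"
  by (simp add: type_prod_def)

lemma type_prod_insert:
  assumes "finite S" "e \<notin> S"
  shows "type_prod (insert e S) x = fst (snd e) * type_prod S x"
proof -
  \<comment> \<open>Commutativity of the semigroup makes the product independent of the order of the
    edges.\<close>
  interpret comp_fun_commute "\<lambda>e :: 'a \<times> 'b \<times> 'a. \<lambda>\<eta>. fst (snd e) * \<eta>"
    by standard (simp add: fun_eq_iff ac_simps)
  show ?thesis using assms by (simp add: type_prod_def)
qed

lemma type_prod_image:
  "finite S \<Longrightarrow> inj_on g S \<Longrightarrow> (\<And>e. e \<in> S \<Longrightarrow> fst (snd (g e)) = fst (snd e)) \<Longrightarrow>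
    type_prod (g ` S) x = type_prod S x"
  by (induction S rule: finite_induct) (simp_all add: type_prod_insert)

text \<open>This models the case in which hanging a tree multiplies the type of exactly one incoming
  edge: the new factor can be pulled out of the product.\<close>

lemma type_prod_image_mult:
  assumes S: "finite S" "inj_on g S" and e: "e \<in> S" "fst (snd (g e)) = c * fst (snd e)"
    and rest: "\<And>e'. e' \<in> S \<Longrightarrow> e' \<noteq> e \<Longrightarrow> fst (snd (g e')) = fst (snd e')"
  shows "type_prod (g ` S) x = c * type_prod S x"
proof -
  let ?S = "S - {e}"
  have S': "S = insert e ?S" using e by blast
  have g: "g ` S = insert (g e) (g ` ?S)" using e by blast
  have ni: "g e \<notin> g ` ?S" using S(2) e(1) unfolding inj_on_def by blast
  have "type_prod (g ` ?S) x = type_prod ?S x"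
    by (rule type_prod_image) (use S rest in \<open>auto intro: inj_on_diff\<close>)
  moreover have "type_prod (g ` S) x = fst (snd (g e)) * type_prod (g ` ?S) x"
    unfolding g by (rule type_prod_insert) (use S ni in simp_all)
  moreover have "type_prod S x = fst (snd e) * type_prod ?S x"
    by (subst S', rule type_prod_insert) (use S in simp_all)
  ultimately show ?thesis using e(2) by (simp add: ac_simps)
qed

lemma twisted_type_eq:
  "twisted_type T v f U w \<omega> = type_prod {e \<in> incoming T v. (f e, w) \<in> (parent_rel U)\<^sup>*} \<omega>"
  by (simp add: twisted_type_def type_prod_def)

section \<open>Edges and ancestors in a grafted tree\<close>

lemma incoming_iff: "(w, \<eta>, u) \<in> incoming T v \<longleftrightarrow> (w, \<eta>, u) \<in> rt_edges T \<and> u = v"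
  by (simp add: incoming_def)

lemma finite_incoming: "T \<in> typed_trees A \<Longrightarrow> finite A \<Longrightarrow> finite (incoming T v)"
  by (rule finite_subset[OF _ finite_rt_edges]) (auto simp: incoming_def)

lemma rtree_eqI:
  assumes "rt_root T = rt_root T'" "\<And>w \<eta> x. (w, \<eta>, x) \<in> rt_edges T \<longleftrightarrow> (w, \<eta>, x) \<in> rt_edges T'"
  shows "T = T'"
  using assms by (intro rtree.expand conjI Set.set_eqI) auto

lemma rt_root_graft: "rt_root (graft T v f U) = (if rt_root T = v then rt_root U else rt_root T)"
  by (simp add: graft_def)

lemma rt_edges_graft: "(w, \<eta>, x) \<in> rt_edges (graft T v f U) \<longleftrightarrow>
    ((w, \<eta>, x) \<in> rt_edges T \<and> w \<noteq> v \<and> x \<noteq> v) \<or> (w = rt_root U \<and> (v, \<eta>, x) \<in> rt_edges T) \<or>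
    ((w, \<eta>, v) \<in> rt_edges T \<and> x = f (w, \<eta>, v)) \<or>
    (\<exists>\<zeta>. (w, \<zeta>, x) \<in> rt_edges U \<and> \<eta> = twisted_type T v f U w \<zeta>)"
  unfolding graft_def rtree.sel Un_iff mem_Collect_eq split_conv prod.inject by blast

lemma parent_rel_graft: "(w, x) \<in> parent_rel (graft T v f U) \<longleftrightarrow>
    ((w, x) \<in> parent_rel T \<and> w \<noteq> v \<and> x \<noteq> v) \<or> (w = rt_root U \<and> (v, x) \<in> parent_rel T) \<or>
    (\<exists>\<eta>. (w, \<eta>, v) \<in> rt_edges T \<and> x = f (w, \<eta>, v)) \<or> (w, x) \<in> parent_rel U"
  unfolding parent_rel_iff rt_edges_graft by blast

text \<open>Only the values on incoming edges enter a graft. This allows an attachment map to be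
  replaced by its restriction, as needed for sums over extensional functions.\<close>

lemma graft_cong:
  assumes "\<And>e. e \<in> incoming T v \<Longrightarrow> f e = g e"
  shows "graft T v f U = graft T v g U"
proof (rule rtree_eqI)
  have tw: "twisted_type T v f U = twisted_type T v g U"
    unfolding twisted_type_eq fun_eq_iff using assms by (metis (mono_tags, lifting) Collect_cong)
  have "f (w, \<eta>, v) = g (w, \<eta>, v)" if "(w, \<eta>, v) \<in> rt_edges T" for w \<eta>
    using assms that by (simp add: incoming_iff)
  then show "(w, \<eta>, x) \<in> rt_edges (graft T v f U) \<longleftrightarrow> (w, \<eta>, x) \<in> rt_edges (graft T v g U)" for w \<eta> x
    unfolding rt_edges_graft tw by metis
qed (simp add: rt_root_graft)

text \<open>Inside this locale the ancestor relation of the graft is computed in the four cases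
  \<open>reach_UU\<close>, \<open>reach_UT\<close>, \<open>reach_TT\<close> and
  \<open>reach_TU\<close>, according to the parts in which the two vertices lie. They decide which
  edges receive a factor when a tree is hung below a vertex of the graft.\<close>

locale grafting =
  fixes T :: "('l, 'w::ab_semigroup_mult) rtree" and A v f and U :: "('l, 'w) rtree" and C
  assumes T: "T \<in> typed_trees A" and U: "U \<in> typed_trees C" and AC: "A \<inter> C = {}" and v: "v \<in> A"
    and f: "\<And>e. e \<in> incoming T v \<Longrightarrow> f e \<in> C"
begin

abbreviation G where "G \<equiv> graft T v f U"

lemma parent_irrefl: "(x, x) \<notin> parent_rel T"
  using acyclic_parent_rel[OF T, of x] by blast

lemma rtrancl_U: "(p, w) \<in> (parent_rel U)\<^sup>* \<Longrightarrow> (p, w) \<in> (parent_rel G)\<^sup>*"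
  by (erule rtrancl_mono[THEN subsetD, rotated]) (auto simp: parent_rel_graft)

lemma f_edge: "(w, \<eta>, v) \<in> rt_edges T \<Longrightarrow> f (w, \<eta>, v) \<in> C"
  by (rule f) (simp add: incoming_iff)

text \<open>The graft has lost the vertex \<open>v\<close>; its outgoing edge now starts at the root
  of \<open>U\<close>, so this is the vertex through which the image of a path of \<open>T\<close>
  through \<open>v\<close> runs.\<close>

definition r :: "'l \<Rightarrow> 'l" where "r x = (if x = v then rt_root U else x)"

lemma rtrancl_r: "(p, w) \<in> (parent_rel T)\<^sup>* \<Longrightarrow> (r p, r w) \<in> (parent_rel G)\<^sup>*"
proof (induction rule: rtrancl_induct)
  case (step y z)
  have "(r y, r z) \<in> (parent_rel G)\<^sup>*"
  proof (cases "y = v")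
    case True
    then have "z \<noteq> v" using step.hyps(2) parent_irrefl by blast
    then have "(r y, r z) \<in> parent_rel G" using True step.hyps(2) by (simp add: r_def parent_rel_graft)
    then show ?thesis by blast
  next
    case y: False
    show ?thesis
    proof (cases "z = v")
      case True
      then obtain \<eta> where e: "(y, \<eta>, v) \<in> rt_edges T" using step.hyps(2) by (auto simp: parent_rel_iff)
      then have "(y, f (y, \<eta>, v)) \<in> parent_rel G" unfolding parent_rel_graft by blast
      moreover have "(f (y, \<eta>, v), rt_root U) \<in> (parent_rel G)\<^sup>*"
        by (rule rtrancl_U[OF typed_treesD(5)[OF U f_edge[OF e]]])
      ultimately show ?thesis using y True by (simp add: r_def converse_rtrancl_into_rtrancl)
    next
      case False
      then have "(r y, r z) \<in> parent_rel G" using y step.hyps(2) by (simp add: r_def parent_rel_graft)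
      then show ?thesis by blast
    qed
  qed
  then show ?case using step.IH by (rule rtrancl_trans[rotated])
qed simp

text \<open>A path starting in \<open>U\<close> can leave it only at its root, along the former
  outgoing edge of \<open>v\<close>. It cannot come back along an incoming edge of \<open>v\<close>,
  as this would close a cycle through \<open>v\<close> in \<open>T\<close>.\<close>

lemma rtrancl_from_U:
  assumes p: "p \<in> C" and pw: "(p, w) \<in> (parent_rel G)\<^sup>*"
  shows "w \<in> C \<and> (p, w) \<in> (parent_rel U)\<^sup>* \<or> w \<in> A - {v} \<and> (v, w) \<in> (parent_rel T)\<^sup>*"
  using pw
proof (induction rule: rtrancl_induct)
  case base then show ?case using p by simp
next
  case (step y z)
  consider (a) "(y, z) \<in> parent_rel T" "y \<noteq> v" "z \<noteq> v" | (b) "y = rt_root U" "(v, z) \<in> parent_rel T"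
    | (c) \<eta> where "(y, \<eta>, v) \<in> rt_edges T" | (d) "(y, z) \<in> parent_rel U"
    using step.hyps(2) unfolding parent_rel_graft by blast
  then show ?case
  proof cases
    case a
    have m: "y \<in> A" "z \<in> A" using parent_rel_mem[OF T a(1)] by blast+
    then have "(v, y) \<in> (parent_rel T)\<^sup>*" using step.IH AC by blast
    then have "(v, z) \<in> (parent_rel T)\<^sup>*" using a(1) by (rule rtrancl_into_rtrancl)
    then show ?thesis using m a by blast
  next
    case b
    then have "z \<in> A" "z \<noteq> v" using parent_rel_mem[OF T b(2)] parent_irrefl by blast+
    then show ?thesis using b(2) by blast
  next
    case c
    then have "(y, v) \<in> parent_rel T" unfolding parent_rel_iff by blast
    moreover from this have "y \<in> A" using parent_rel_mem[OF T] by blast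
    then have "(v, y) \<in> (parent_rel T)\<^sup>*" using step.IH AC by blast
    ultimately have "(v, v) \<in> (parent_rel T)\<^sup>+" by (rule rtrancl_into_trancl1[rotated])
    then show ?thesis using acyclic_parent_rel[OF T] by contradiction
  next
    case d
    have m: "y \<in> C" "z \<in> C" using parent_rel_mem[OF U d] by blast+
    then have "(p, y) \<in> (parent_rel U)\<^sup>*" using step.IH AC by blast
    then have "(p, z) \<in> (parent_rel U)\<^sup>*" using d by (rule rtrancl_into_rtrancl)
    then show ?thesis using m by blast
  qed
qed

text \<open>A path from \<open>T\<close> enters \<open>U\<close> along some incoming edge of
  \<open>v\<close>. The child end \<open>c\<close> of this edge is recorded because the attachment
  vertex of the edge determines which part of \<open>U\<close> is reached afterwards.\<close>

lemma rtrancl_from_T: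
  assumes p: "p \<in> A" "p \<noteq> v" and pw: "(p, w) \<in> (parent_rel G)\<^sup>*"
  shows "w \<in> A - {v} \<and> (p, w) \<in> (parent_rel T)\<^sup>* \<or>
    w \<in> C \<and> (\<exists>c \<eta>. (c, \<eta>, v) \<in> rt_edges T \<and> (p, c) \<in> (parent_rel T)\<^sup>* \<and> (f (c, \<eta>, v), w) \<in> (parent_rel U)\<^sup>*)"
  using pw
proof (induction rule: rtrancl_induct)
  case base then show ?case using p by simp
next
  case (step y z)
  consider (a) "(y, z) \<in> parent_rel T" "y \<noteq> v" "z \<noteq> v" | (b) "y = rt_root U" "(v, z) \<in> parent_rel T"
    | (c) \<eta> where "(y, \<eta>, v) \<in> rt_edges T" "z = f (y, \<eta>, v)" | (d) "(y, z) \<in> parent_rel U"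
    using step.hyps(2) unfolding parent_rel_graft by blast
  then show ?case
  proof cases
    case a
    have m: "y \<in> A" "z \<in> A" using parent_rel_mem[OF T a(1)] by blast+
    then have "(p, y) \<in> (parent_rel T)\<^sup>*" using step.IH AC by blast
    then have "(p, z) \<in> (parent_rel T)\<^sup>*" using a(1) by (rule rtrancl_into_rtrancl)
    then show ?thesis using m a by blast
  next
    case b
    have "y \<in> C" using b(1) typed_treesD(1)[OF U] by simp
    then obtain c \<eta> where c: "(c, \<eta>, v) \<in> rt_edges T" "(p, c) \<in> (parent_rel T)\<^sup>*" using step.IH AC by blast
    then have "(p, v) \<in> (parent_rel T)\<^sup>*" by (meson parent_rel_iff rtrancl_into_rtrancl)
    then have "(p, z) \<in> (parent_rel T)\<^sup>*" using b(2) by (rule rtrancl_into_rtrancl)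
    moreover have "z \<in> A" "z \<noteq> v" using parent_rel_mem[OF T b(2)] parent_irrefl b(2) by blast+
    ultimately show ?thesis by blast
  next
    case c
    have "y \<in> A" using typed_treesD(2)[OF T c(1)] by blast
    then have "(p, y) \<in> (parent_rel T)\<^sup>*" using step.IH AC by blast
    moreover have "z \<in> C" using f_edge[OF c(1)] c(2) by simp
    moreover have "(f (y, \<eta>, v), z) \<in> (parent_rel U)\<^sup>*" using c(2) by simp
    ultimately show ?thesis using c(1) by blast
  next
    case d
    have m: "y \<in> C" "z \<in> C" using parent_rel_mem[OF U d] by blast+
    then obtain c \<eta> where c: "(c, \<eta>, v) \<in> rt_edges T" "(p, c) \<in> (parent_rel T)\<^sup>*"
      "(f (c, \<eta>, v), y) \<in> (parent_rel U)\<^sup>*" using step.IH AC by blast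
    have "(f (c, \<eta>, v), z) \<in> (parent_rel U)\<^sup>*" using c(3) d by (rule rtrancl_into_rtrancl)
    then show ?thesis using m c by blast
  qed
qed

lemma reach_UU: "p \<in> C \<Longrightarrow> w \<in> C \<Longrightarrow> (p, w) \<in> (parent_rel G)\<^sup>* \<longleftrightarrow> (p, w) \<in> (parent_rel U)\<^sup>*"
  using rtrancl_from_U[of p w] rtrancl_U[of p w] AC by blast

lemma reach_UT:
  assumes "p \<in> C" "w \<in> A" "w \<noteq> v"
  shows "(p, w) \<in> (parent_rel G)\<^sup>* \<longleftrightarrow> (v, w) \<in> (parent_rel T)\<^sup>*"
proof
  assume "(v, w) \<in> (parent_rel T)\<^sup>*"
  from rtrancl_r[OF this] have "(rt_root U, w) \<in> (parent_rel G)\<^sup>*" using assms by (simp add: r_def)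
  then show "(p, w) \<in> (parent_rel G)\<^sup>*"
    using rtrancl_U[OF typed_treesD(5)[OF U assms(1)]] by (rule rtrancl_trans[rotated])
qed (use rtrancl_from_U[OF assms(1)] assms AC in blast)

lemma reach_TT:
  assumes "p \<in> A" "p \<noteq> v" "w \<in> A" "w \<noteq> v"
  shows "(p, w) \<in> (parent_rel G)\<^sup>* \<longleftrightarrow> (p, w) \<in> (parent_rel T)\<^sup>*"
proof
  assume "(p, w) \<in> (parent_rel T)\<^sup>*"
  from rtrancl_r[OF this] show "(p, w) \<in> (parent_rel G)\<^sup>*" using assms by (simp add: r_def)
qed (use rtrancl_from_T[OF assms(1,2)] assms AC in blast)

lemma reach_TU:
  assumes "p \<in> A" "p \<noteq> v" "w \<in> C"
  shows "(p, w) \<in> (parent_rel G)\<^sup>* \<longleftrightarrow>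
    (\<exists>c \<eta>. (c, \<eta>, v) \<in> rt_edges T \<and> (p, c) \<in> (parent_rel T)\<^sup>* \<and> (f (c, \<eta>, v), w) \<in> (parent_rel U)\<^sup>*)"
proof
  assume "\<exists>c \<eta>. (c, \<eta>, v) \<in> rt_edges T \<and> (p, c) \<in> (parent_rel T)\<^sup>* \<and> (f (c, \<eta>, v), w) \<in> (parent_rel U)\<^sup>*"
  then obtain c \<eta> where c: "(c, \<eta>, v) \<in> rt_edges T" "(p, c) \<in> (parent_rel T)\<^sup>*" "(f (c, \<eta>, v), w) \<in> (parent_rel U)\<^sup>*"
    by blast
  have "c \<noteq> v" using c(1) parent_irrefl[of v] by (auto simp: parent_rel_iff)
  then have "(p, c) \<in> (parent_rel G)\<^sup>*" using rtrancl_r[OF c(2)] assms(2) by (simp add: r_def)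
  moreover have "(c, f (c, \<eta>, v)) \<in> parent_rel G" unfolding parent_rel_graft using c(1) by blast
  ultimately have "(p, f (c, \<eta>, v)) \<in> (parent_rel G)\<^sup>*" by (rule rtrancl_into_rtrancl)
  then show "(p, w) \<in> (parent_rel G)\<^sup>*" using rtrancl_U[OF c(3)] by (rule rtrancl_trans)
qed (use rtrancl_from_T[OF assms(1,2)] assms AC in blast)

end

section \<open>Compatibility of grafting with hanging\<close>

text \<open>Neither \<open>u\<close> nor any edge of \<open>Y\<close> involves \<open>a\<close>, so
  the incoming edges and their attachment maps are literally those of \<open>X\<close>. If
  \<open>a\<close> is the root of \<open>X\<close>, the connecting edge starts at the root of
  \<open>Z\<close> on both sides.\<close>

lemma graft_hang_left:
  assumes X: "X \<in> typed_trees A" and Y: "Y \<in> typed_trees B" and AB: "A \<inter> B = {}" and u: "u \<in> B" and a: "a \<in> A"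
  shows "incoming (hang \<omega> X u Y) a = incoming X a"
    and "graft (hang \<omega> X u Y) a f Z = hang \<omega> (graft X a f Z) u Y"
proof -
  have nY: "w \<noteq> a" "x \<noteq> a" if "(w, \<eta>, x) \<in> rt_edges Y" for w \<eta> x
    using typed_treesD(2)[OF Y that] AB a by blast+
  have ua: "u \<noteq> a" using u a AB by blast
  show inc: "incoming (hang \<omega> X u Y) a = incoming X a"
  proof (rule Set.set_eqI)
    fix e :: "'a \<times> 'b \<times> 'a"
    obtain w \<eta> x where e: "e = (w, \<eta>, x)" by (cases e)
    show "e \<in> incoming (hang \<omega> X u Y) a \<longleftrightarrow> e \<in> incoming X a"
      unfolding e incoming_iff rt_edges_hang using nY ua by blast
  qed
  have tw: "twisted_type (hang \<omega> X u Y) a f Z = twisted_type X a f Z"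
    by (simp add: fun_eq_iff twisted_type_eq inc)
  show "graft (hang \<omega> X u Y) a f Z = hang \<omega> (graft X a f Z) u Y"
  proof (rule rtree_eqI)
    show "rt_root (graft (hang \<omega> X u Y) a f Z) = rt_root (hang \<omega> (graft X a f Z) u Y)"
      using typed_treesD(1)[OF Y] a AB by (auto simp: rt_root_graft)
    fix w \<eta> x
    have h1: "(w, \<eta>, x) \<in> rt_edges (hang \<omega> X u Y) \<and> w \<noteq> a \<and> x \<noteq> a \<longleftrightarrow>
        w = rt_root X \<and> \<eta> = \<omega> \<and> x = u \<and> rt_root X \<noteq> a \<or> (w, \<eta>, x) \<in> rt_edges X \<and> w \<noteq> a \<and> x \<noteq> a \<or>
        (\<exists>\<zeta>. (w, \<zeta>, x) \<in> rt_edges Y \<and> \<eta> = path_mult \<omega> u Y w \<zeta>)"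
      unfolding rt_edges_hang using nY ua by blast
    have h2: "(a, \<eta>, x) \<in> rt_edges (hang \<omega> X u Y) \<longleftrightarrow> rt_root X = a \<and> \<eta> = \<omega> \<and> x = u \<or> (a, \<eta>, x) \<in> rt_edges X"
      unfolding rt_edges_hang using nY by blast
    have h3: "(w, \<eta>, a) \<in> rt_edges (hang \<omega> X u Y) \<longleftrightarrow> (w, \<eta>, a) \<in> rt_edges X"
      unfolding rt_edges_hang using nY ua by blast
    show "(w, \<eta>, x) \<in> rt_edges (graft (hang \<omega> X u Y) a f Z) \<longleftrightarrow> (w, \<eta>, x) \<in> rt_edges (hang \<omega> (graft X a f Z) u Y)"
      unfolding rt_edges_graft[of _ _ _ "hang \<omega> X u Y"] h1 h2 h3 tw
      unfolding rt_edges_hang rt_edges_graft rt_root_graft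
      by (cases "rt_root X = a") (simp_all, blast+)
  qed
qed

definition path_twist :: "'w::ab_semigroup_mult \<Rightarrow> 'l \<Rightarrow> ('l, 'w) rtree \<Rightarrow> 'l \<times> 'w \<times> 'l \<Rightarrow> 'l \<times> 'w \<times> 'l" where
  "path_twist \<omega> u S e = (fst e, path_mult \<omega> u S (fst e) (fst (snd e)), snd (snd e))"

lemma path_twist_simps [simp]:
  "path_twist \<omega> u S (w, \<eta>, x) = (w, path_mult \<omega> u S w \<eta>, x)"
  "fst (path_twist \<omega> u S e) = fst e"
  "fst (snd (path_twist \<omega> u S e)) = path_mult \<omega> u S (fst e) (fst (snd e))"
  by (simp_all add: path_twist_def)

lemma inj_on_path_twist:
  assumes "S \<in> typed_trees A"
  shows "inj_on (path_twist \<omega> u S) (rt_edges S)"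
proof (rule inj_onI)
  fix e e' assume e: "e \<in> rt_edges S" "e' \<in> rt_edges S" "path_twist \<omega> u S e = path_twist \<omega> u S e'"
  have "fst e = fst e'" using arg_cong[OF e(3), of fst] by simp
  then obtain w \<eta> x \<eta>' x' where "e = (w, \<eta>, x)" "e' = (w, \<eta>', x')" by (cases e, cases e') auto
  then show "e = e'" using e(1,2) typed_treesD(3)[OF assms, of w \<eta> x \<eta>' x'] by simp
qed

lemma incoming_hang_right:
  assumes X: "X \<in> typed_trees A" and AB: "A \<inter> B = {}" and a: "a \<in> B"
  shows "incoming (hang \<omega> X u Y) a = (if u = a then {(rt_root X, \<omega>, a)} else {}) \<union> path_twist \<omega> u Y ` incoming Y a"
proof (rule Set.set_eqI)
  fix e :: "'a \<times> 'b \<times> 'a"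
  obtain w \<eta> x where e: "e = (w, \<eta>, x)" by (cases e)
  have "(w, \<eta>, a) \<notin> rt_edges X" using typed_treesD(2)[OF X, of w \<eta> a] AB a by blast
  then have "e \<in> incoming (hang \<omega> X u Y) a \<longleftrightarrow>
      w = rt_root X \<and> \<eta> = \<omega> \<and> u = a \<and> x = a \<or> e \<in> path_twist \<omega> u Y ` incoming Y a"
    unfolding e incoming_iff rt_edges_hang image_iff Bex_def split_paired_Ex path_twist_simps prod.inject by blast
  then show "e \<in> incoming (hang \<omega> X u Y) a \<longleftrightarrow>
      e \<in> (if u = a then {(rt_root X, \<omega>, a)} else {}) \<union> path_twist \<omega> u Y ` incoming Y a"
    by (cases "u = a") (auto simp: e)
qed

text \<open>There are two ways for the factor \<omega> to reach an edge of \<open>Z\<close>. If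
  \<open>u = a\<close>, the connecting edge is itself an incoming edge of \<open>a\<close> and
  contributes \<omega> along the path from its attachment vertex. Otherwise \<omega> has already
  been multiplied into the type of the one incoming edge of \<open>a\<close> on the path from
  \<open>u\<close>, and the twisted type passes it on. Both amount to a \<open>path_mult\<close> in
  the graft at \<open>u'\<close>, the vertex below which \<open>X\<close> finally hangs.\<close>

lemma twisted_type_hang_right:
  assumes X: "X \<in> typed_trees A" and Y: "Y \<in> typed_trees B" and Z: "Z \<in> typed_trees C" and B: "finite B"
    and AB: "A \<inter> B = {}" and BC: "B \<inter> C = {}" and a: "a \<in> B" and u: "u \<in> B" and w: "w \<in> C"
    and f: "\<And>e. e \<in> incoming (hang \<omega> X u Y) a \<Longrightarrow> f e \<in> C"
  defines "f' \<equiv> f \<circ> path_twist \<omega> u Y" and "u' \<equiv> if u = a then f (rt_root X, \<omega>, a) else u"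
  shows "twisted_type (hang \<omega> X u Y) a f Z w \<zeta> =
    path_mult \<omega> u' (graft Y a f' Z) w (twisted_type Y a f' Z w \<zeta>)"
proof -
  note inc = incoming_hang_right[OF X AB a, of \<omega> u Y]
  have u'C: "u' \<in> C" if "u = a"
  proof -
    have "(rt_root X, \<omega>, a) \<in> incoming (hang \<omega> X u Y) a" unfolding inc using that by simp
    from f[OF this] show ?thesis using that by (simp add: u'_def)
  qed
  interpret grafting Y B a f' Z C
  proof
    fix e assume "e \<in> incoming Y a"
    then show "f' e \<in> C" unfolding f'_def o_def by (intro f) (simp add: inc)
  qed fact+
  define S where "S = {e \<in> incoming Y a. (f' e, w) \<in> (parent_rel Z)\<^sup>*}"
  have S: "finite S" unfolding S_def using finite_incoming[OF Y B] by simp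
  have inj: "inj_on (path_twist \<omega> u Y) S"
    by (rule inj_on_subset[OF inj_on_path_twist[OF Y]]) (auto simp: S_def incoming_def)
  have S': "{e \<in> path_twist \<omega> u Y ` incoming Y a. (f e, w) \<in> (parent_rel Z)\<^sup>*} = path_twist \<omega> u Y ` S"
    by (auto simp: S_def f'_def)
  have twY: "twisted_type Y a f' Z w \<zeta> = type_prod S \<zeta>" by (simp add: twisted_type_eq S_def)
  show ?thesis
  proof (cases "u = a")
    case True
    let ?n = "(rt_root X, \<omega>, a)"
    \<comment> \<open>For \<open>u = a\<close> the old incoming edges start in children of
      \<open>a\<close>, which are not ancestors of \<open>a\<close>; their types stay
      unchanged.\<close>
    have "\<not> (u, fst e) \<in> (parent_rel Y)\<^sup>*" if "e \<in> S" for e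
    proof
      assume "(u, fst e) \<in> (parent_rel Y)\<^sup>*"
      moreover have "(fst e, a) \<in> parent_rel Y" using that by (cases e) (auto simp: S_def incoming_iff parent_rel_iff)
      ultimately have "(a, a) \<in> (parent_rel Y)\<^sup>+" unfolding True by (rule rtrancl_into_trancl1)
      then show False using acyclic_parent_rel[OF Y] by contradiction
    qed
    then have img: "type_prod (path_twist \<omega> u Y ` S) \<zeta> = type_prod S \<zeta>"
      by (intro type_prod_image S inj) (simp add: path_mult_def)
    have n: "?n \<notin> path_twist \<omega> u Y ` S"
    proof
      assume "?n \<in> path_twist \<omega> u Y ` S"
      then obtain \<eta> x where "(rt_root X, \<eta>, x) \<in> S" by (auto simp: path_twist_def)
      then have "rt_root X \<in> B" using typed_treesD(2)[OF Y] by (auto simp: S_def incoming_iff)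
      then show False using typed_treesD(1)[OF X] AB by blast
    qed
    have reach: "(u', w) \<in> (parent_rel G)\<^sup>* \<longleftrightarrow> (f ?n, w) \<in> (parent_rel Z)\<^sup>*"
      using reach_UU[OF u'C[OF True] w] by (simp add: u'_def True)
    have "{e \<in> incoming (hang \<omega> X u Y) a. (f e, w) \<in> (parent_rel Z)\<^sup>*} =
        (if (f ?n, w) \<in> (parent_rel Z)\<^sup>* then insert ?n (path_twist \<omega> u Y ` S) else path_twist \<omega> u Y ` S)"
      unfolding S'[symmetric] inc using True by auto
    then show ?thesis
      unfolding twisted_type_eq[of "hang \<omega> X u Y"] twY path_mult_def reach
      using S n img by (simp add: type_prod_insert)
  next
    case False
    then have u': "u' = u" by (simp add: u'_def)
    have tw: "twisted_type (hang \<omega> X u Y) a f Z w \<zeta> = type_prod (path_twist \<omega> u Y ` S) \<zeta>"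
      unfolding twisted_type_eq inc S'[symmetric] using False by simp
    show ?thesis
    \<comment> \<open>The question is whether the path from \<open>u\<close> enters \<open>a\<close>
      by an edge that contributes to the type at \<open>w\<close>. Such an edge is unique, so
      \<omega> then occurs in exactly one factor of the product, and otherwise in none.\<close>
    proof (cases "\<exists>c \<eta>. (c, \<eta>, a) \<in> rt_edges Y \<and> (u, c) \<in> (parent_rel Y)\<^sup>* \<and> (f' (c, \<eta>, a), w) \<in> (parent_rel Z)\<^sup>*")
      case True
      then obtain c \<eta> where c: "(c, \<eta>, a) \<in> rt_edges Y" "(u, c) \<in> (parent_rel Y)\<^sup>*" "(f' (c, \<eta>, a), w) \<in> (parent_rel Z)\<^sup>*"
        by blast
      have "type_prod (path_twist \<omega> u Y ` S) \<zeta> = \<omega> * type_prod S \<zeta>"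
      proof (rule type_prod_image_mult[OF S inj])
        show "(c, \<eta>, a) \<in> S" using c by (simp add: S_def incoming_iff)
        show "fst (snd (path_twist \<omega> u Y (c, \<eta>, a))) = \<omega> * fst (snd (c, \<eta>, a))"
          using c(2) by (simp add: path_mult_def)
        fix e assume e: "e \<in> S" "e \<noteq> (c, \<eta>, a)"
        obtain d \<theta> where d: "e = (d, \<theta>, a)" "(d, \<theta>, a) \<in> rt_edges Y"
          using e(1) by (cases e) (auto simp: S_def incoming_iff)
        have "\<not> (u, d) \<in> (parent_rel Y)\<^sup>*"
        proof
          assume "(u, d) \<in> (parent_rel Y)\<^sup>*"
          then have "d = c"
            using unique_child_above[OF Y, of u d a c] c(1,2) d(2) by (auto simp: parent_rel_iff)
          then show False using typed_treesD(3)[OF Y c(1)] d e(2) by blast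
        qed
        then show "fst (snd (path_twist \<omega> u Y e)) = fst (snd e)" by (simp add: d(1) path_mult_def)
      qed
      moreover have "(u, w) \<in> (parent_rel G)\<^sup>*" using reach_TU[OF u False w] True by blast
      ultimately show ?thesis unfolding tw twY u' by (simp add: path_mult_def)
    next
      case no: False
      have "type_prod (path_twist \<omega> u Y ` S) \<zeta> = type_prod S \<zeta>"
      proof (rule type_prod_image[OF S inj])
        fix e assume e: "e \<in> S"
        obtain d \<theta> where d: "e = (d, \<theta>, a)" "(d, \<theta>, a) \<in> rt_edges Y" "(f' (d, \<theta>, a), w) \<in> (parent_rel Z)\<^sup>*"
          using e by (cases e) (auto simp: S_def incoming_iff)
        then have "\<not> (u, d) \<in> (parent_rel Y)\<^sup>*" using no by blast
        then show "fst (snd (path_twist \<omega> u Y e)) = fst (snd e)" by (simp add: d(1) path_mult_def)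
      qed
      moreover have "\<not> (u, w) \<in> (parent_rel G)\<^sup>*" using reach_TU[OF u False w] no by blast
      ultimately show ?thesis unfolding tw twY u' by (simp add: path_mult_def)
    qed
  qed
qed

text \<open>A tree hung below \<open>u\<close> with \<open>u \<noteq> a\<close> keeps its place. If
  it hangs below \<open>a\<close>, the attachment map moves it to its value at the connecting edge.
  The other incoming edges have changed types, which is why the map is pulled back along
  \<open>path_twist\<close> before it is used in \<open>Y\<close>.\<close>

lemma graft_hang_right:
  assumes X: "X \<in> typed_trees A" and Y: "Y \<in> typed_trees B" and Z: "Z \<in> typed_trees C" and B: "finite B"
    and AB: "A \<inter> B = {}" and BC: "B \<inter> C = {}" and a: "a \<in> B" and u: "u \<in> B"
    and f: "\<And>e. e \<in> incoming (hang \<omega> X u Y) a \<Longrightarrow> f e \<in> C"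
  defines "f' \<equiv> f \<circ> path_twist \<omega> u Y" and "u' \<equiv> if u = a then f (rt_root X, \<omega>, a) else u"
  shows "graft (hang \<omega> X u Y) a f Z = hang \<omega> X u' (graft Y a f' Z)"
proof -
  note inc = incoming_hang_right[OF X AB a, of \<omega> u Y] and f_mem = f
  have u'C: "u' \<in> C" if "u = a"
  proof -
    have "(rt_root X, \<omega>, a) \<in> incoming (hang \<omega> X u Y) a" unfolding inc using that by simp
    from f[OF this] show ?thesis using that by (simp add: u'_def)
  qed
  interpret grafting Y B a f' Z C
  proof
    fix e assume "e \<in> incoming Y a"
    then show "f' e \<in> C" unfolding f'_def o_def by (intro f) (simp add: inc)
  qed fact+
  \<comment> \<open>Away from \<open>a\<close>, the same vertices of \<open>Y\<close> are ancestors
    of \<open>u\<close> before the graft and of \<open>u'\<close> after it.\<close>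
  have pm1: "path_mult \<omega> u' G w \<eta> = path_mult \<omega> u Y w \<eta>" if "w \<in> B" "w \<noteq> a" for w \<eta>
  proof (cases "u = a")
    case True
    then show ?thesis using reach_UT[OF u'C[OF True] that] by (simp add: path_mult_def)
  next
    case False
    then show ?thesis using reach_TT[OF u False that] by (simp add: path_mult_def u'_def)
  qed
  \<comment> \<open>The edge leaving \<open>a\<close> now leaves the root of \<open>Z\<close>. It is
    multiplied iff the path passes through \<open>a\<close> in \<open>Y\<close>, equivalently
    through the root of \<open>Z\<close> in the graft.\<close>
  have pm2: "path_mult \<omega> u' G (rt_root Z) \<eta> = path_mult \<omega> u Y a \<eta>" for \<eta>
  proof -
    note rZ = typed_treesD(1)[OF Z]
    have "(u', rt_root Z) \<in> (parent_rel G)\<^sup>* \<longleftrightarrow> (u, a) \<in> (parent_rel Y)\<^sup>*"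
    proof (cases "u = a")
      case True
      then show ?thesis using reach_UU[OF u'C[OF True] rZ] typed_treesD(5)[OF Z u'C[OF True]] by simp
    next
      case False
      have "(\<exists>c \<eta>. (c, \<eta>, a) \<in> rt_edges Y \<and> (u, c) \<in> (parent_rel Y)\<^sup>* \<and> (f' (c, \<eta>, a), rt_root Z) \<in> (parent_rel Z)\<^sup>*)
          \<longleftrightarrow> (u, a) \<in> (parent_rel Y)\<^sup>*" (is "?L \<longleftrightarrow> ?R")
      proof
        assume ?L then show ?R by (metis parent_rel_iff rtrancl.rtrancl_into_rtrancl)
      next
        assume ?R
        then obtain c where c: "(u, c) \<in> (parent_rel Y)\<^sup>*" "(c, a) \<in> parent_rel Y"
          using False by (metis rtranclE)
        then obtain \<eta> where e: "(c, \<eta>, a) \<in> rt_edges Y" unfolding parent_rel_iff by blast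
        then show ?L using c(1) typed_treesD(5)[OF Z f_edge[OF e]] by blast
      qed
      then show ?thesis using reach_TU[OF u False rZ] False by (simp add: u'_def)
    qed
    then show ?thesis by (simp add: path_mult_def)
  qed
  have tw: "twisted_type (hang \<omega> X u Y) a f Z w \<zeta> = path_mult \<omega> u' G w (twisted_type Y a f' Z w \<zeta>)" if "w \<in> C" for w \<zeta>
    unfolding u'_def f'_def by (rule twisted_type_hang_right[OF X Y Z B AB BC a u that f_mem])
  have nX: "w \<noteq> a" "x \<noteq> a" if "(w, \<eta>, x) \<in> rt_edges X" for w \<eta> x
    using typed_treesD(2)[OF X that] AB a by blast+
  have rX: "rt_root X \<noteq> a" using typed_treesD(1)[OF X] AB a by blast
  have yY: "w \<in> B" if "(w, \<eta>, x) \<in> rt_edges Y" for w \<eta> x using typed_treesD(2)[OF Y that] by blast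
  have irr: "w \<noteq> a" if "(w, \<eta>, a) \<in> rt_edges Y" for w \<eta>
    using that parent_irrefl[of a] unfolding parent_rel_iff by blast
  show ?thesis
  proof (rule rtree_eqI)
    show "rt_root (graft (hang \<omega> X u Y) a f Z) = rt_root (hang \<omega> X u' G)" by (simp add: rt_root_graft)
    fix w \<eta> x
    \<comment> \<open>The four kinds of edges other than those of \<open>X\<close> and the
      connecting one: \<open>M1\<close> edges of \<open>Y\<close> away from \<open>a\<close>,
      \<open>M2\<close> the edge leaving \<open>a\<close>, \<open>M3\<close> the edges entering
      \<open>a\<close>, \<open>M4\<close> the edges of \<open>Z\<close>. Both trees are compared
      kind by kind.\<close>
    define M1 where "M1 \<longleftrightarrow> (\<exists>\<zeta>. (w, \<zeta>, x) \<in> rt_edges Y \<and> \<eta> = path_mult \<omega> u Y w \<zeta>) \<and> w \<noteq> a \<and> x \<noteq> a"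
    define M2 where "M2 \<longleftrightarrow> w = rt_root Z \<and> (\<exists>\<zeta>. (a, \<zeta>, x) \<in> rt_edges Y \<and> \<eta> = path_mult \<omega> u Y a \<zeta>)"
    define M3 where "M3 \<longleftrightarrow> (\<exists>\<zeta>. (w, \<zeta>, a) \<in> rt_edges Y \<and> \<eta> = path_mult \<omega> u Y w \<zeta> \<and> x = f' (w, \<zeta>, a))"
    define M4 where "M4 \<longleftrightarrow> (\<exists>\<zeta>. (w, \<zeta>, x) \<in> rt_edges Z \<and> \<eta> = twisted_type (hang \<omega> X u Y) a f Z w \<zeta>)"
    have l1: "(w, \<eta>, x) \<in> rt_edges (hang \<omega> X u Y) \<and> w \<noteq> a \<and> x \<noteq> a \<longleftrightarrow>
        w = rt_root X \<and> \<eta> = \<omega> \<and> x = u \<and> u \<noteq> a \<or> (w, \<eta>, x) \<in> rt_edges X \<or> M1"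
      unfolding rt_edges_hang M1_def using nX rX by blast
    have l2: "w = rt_root Z \<and> (a, \<eta>, x) \<in> rt_edges (hang \<omega> X u Y) \<longleftrightarrow> M2"
      unfolding rt_edges_hang M2_def using nX rX by blast
    have l3: "(w, \<eta>, a) \<in> rt_edges (hang \<omega> X u Y) \<and> x = f (w, \<eta>, a) \<longleftrightarrow>
        w = rt_root X \<and> \<eta> = \<omega> \<and> u = a \<and> x = f (rt_root X, \<omega>, a) \<or> M3"
      unfolding rt_edges_hang M3_def f'_def o_def path_twist_simps using nX by blast
    have r: "(\<exists>\<xi>. (w, \<xi>, x) \<in> rt_edges G \<and> \<eta> = path_mult \<omega> u' G w \<xi>) \<longleftrightarrow> M1 \<or> M2 \<or> M3 \<or> M4"
    proof -
      have r1: "(\<exists>\<xi>. ((w, \<xi>, x) \<in> rt_edges Y \<and> w \<noteq> a \<and> x \<noteq> a) \<and> \<eta> = path_mult \<omega> u' G w \<xi>) \<longleftrightarrow> M1"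
        unfolding M1_def using pm1[OF yY] by metis
      have r2: "(\<exists>\<xi>. (w = rt_root Z \<and> (a, \<xi>, x) \<in> rt_edges Y) \<and> \<eta> = path_mult \<omega> u' G w \<xi>) \<longleftrightarrow> M2"
        unfolding M2_def using pm2 by metis
      have r3: "(\<exists>\<xi>. ((w, \<xi>, a) \<in> rt_edges Y \<and> x = f' (w, \<xi>, a)) \<and> \<eta> = path_mult \<omega> u' G w \<xi>) \<longleftrightarrow> M3"
        unfolding M3_def using pm1[OF yY irr] by metis
      have r4: "(\<exists>\<xi>. (\<exists>\<zeta>. (w, \<zeta>, x) \<in> rt_edges Z \<and> \<xi> = twisted_type Y a f' Z w \<zeta>) \<and> \<eta> = path_mult \<omega> u' G w \<xi>) \<longleftrightarrow> M4"
        unfolding M4_def using tw typed_treesD(2)[OF Z] by metis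
      show ?thesis
        unfolding r1[symmetric] r2[symmetric] r3[symmetric] r4[symmetric] rt_edges_graft by blast
    qed
    have "(w, \<eta>, x) \<in> rt_edges (graft (hang \<omega> X u Y) a f Z) \<longleftrightarrow>
        (w = rt_root X \<and> \<eta> = \<omega> \<and> x = u \<and> u \<noteq> a \<or> (w, \<eta>, x) \<in> rt_edges X \<or> M1) \<or> M2 \<or>
        (w = rt_root X \<and> \<eta> = \<omega> \<and> u = a \<and> x = f (rt_root X, \<omega>, a) \<or> M3) \<or> M4"
      unfolding rt_edges_graft[of _ _ _ "hang \<omega> X u Y"] l1 l2 l3 M4_def ..
    also have "\<dots> \<longleftrightarrow> (w = rt_root X \<and> \<eta> = \<omega> \<and> x = u') \<or> (w, \<eta>, x) \<in> rt_edges X \<or> M1 \<or> M2 \<or> M3 \<or> M4"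
      unfolding u'_def by (cases "u = a") auto
    also have "\<dots> \<longleftrightarrow> (w, \<eta>, x) \<in> rt_edges (hang \<omega> X u' G)"
      unfolding rt_edges_hang r ..
    finally show "(w, \<eta>, x) \<in> rt_edges (graft (hang \<omega> X u Y) a f Z) \<longleftrightarrow> (w, \<eta>, x) \<in> rt_edges (hang \<omega> X u' G)" .
  qed
qed

section \<open>Evaluating binary trees in rooted trees\<close>

definition graft_sum :: "'l \<Rightarrow> 'l set \<Rightarrow> ('l, 'w::ab_semigroup_mult) rtree \<Rightarrow> ('l, 'w) rtree \<Rightarrow>
    (('l, 'w) rtree \<Rightarrow>\<^sub>0 'k::{comm_ring,comm_monoid_mult})" where
  "graft_sum a C T U = (\<Sum>f \<in> incoming T a \<rightarrow>\<^sub>E C. basis (graft T a f U))"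

text \<open>
  The value in \<open>RTF\<close> of the generator \<open>\<rhd>\<^sub>\<omega>\<close> at two trees \<open>T\<close> and \<open>S\<close>, where \<open>B\<close> is the vertex set of \<open>S\<close>.
\<close>

definition hang_sum :: "'w::ab_semigroup_mult \<Rightarrow> 'l set \<Rightarrow> ('l, 'w) rtree \<Rightarrow> ('l, 'w) rtree \<Rightarrow>
    (('l, 'w) rtree \<Rightarrow>\<^sub>0 'k::{comm_ring,comm_monoid_mult})" where
  "hang_sum \<omega> B T S = (\<Sum>u\<in>B. basis (hang \<omega> T u S))"

lemma RTF_simps:
  "component RTF A = free_mod (typed_trees A)"
  "relabel RTF \<sigma> A = lin_ext (\<lambda>T. basis (relabel_rtree \<sigma> T))"
  "ident RTF a = basis (RTree a {})"
  "pcomp RTF A a B p q = lin_ext (\<lambda>T. lin_ext (graft_sum a B T) q) p"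
  by (simp_all add: RTF_def graft_sum_def[abs_def])

section \<open>Sums over attachment maps\<close>

lemma sum_PiE_image:
  assumes "inj_on h S"
  shows "(\<Sum>f \<in> h ` S \<rightarrow>\<^sub>E C. g (restrict (f \<circ> h) S)) = (\<Sum>f \<in> S \<rightarrow>\<^sub>E C. g f)"
proof (rule sum.reindex_bij_witness[where j = "\<lambda>f. restrict (f \<circ> h) S"
      and i = "\<lambda>f. restrict (f \<circ> inv_into S h) (h ` S)"])
  fix f assume f: "f \<in> h ` S \<rightarrow>\<^sub>E C"
  show "restrict (restrict (f \<circ> h) S \<circ> inv_into S h) (h ` S) = f"
  proof (rule extensionalityI[where A = "h ` S"])
    show "f \<in> extensional (h ` S)" using f by (simp add: PiE_iff)
  qed (auto simp: assms inv_into_f_f)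
  show "restrict (f \<circ> h) S \<in> S \<rightarrow>\<^sub>E C" using f by (simp add: PiE_iff)
next
  fix f assume f: "f \<in> S \<rightarrow>\<^sub>E C"
  show "restrict (restrict (f \<circ> inv_into S h) (h ` S) \<circ> h) S = f"
  proof (rule extensionalityI[where A = S])
    show "f \<in> extensional S" using f by (simp add: PiE_iff)
  qed (auto simp: assms inv_into_f_f)
  show "restrict (f \<circ> inv_into S h) (h ` S) \<in> h ` S \<rightarrow>\<^sub>E C"
    using f by (auto simp: PiE_iff assms inv_into_f_f)
qed simp

text \<open>A map on one more edge is a value at that edge together with a map on the others. For
  the connecting edge, the value is the vertex of the grafted tree below which the hung tree ends
  up.\<close>

lemma sum_PiE_insert:
  assumes "n \<notin> S"
  shows "(\<Sum>f \<in> insert n S \<rightarrow>\<^sub>E C. g (f n) (restrict f S)) = (\<Sum>c\<in>C. \<Sum>f \<in> S \<rightarrow>\<^sub>E C. g c f)"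
  unfolding sum.cartesian_product
proof (rule sum.reindex_bij_witness[where j = "\<lambda>f. (f n, restrict f S)" and i = "\<lambda>(c, f). f(n := c)"])
  fix f assume f: "f \<in> insert n S \<rightarrow>\<^sub>E C"
  show "(case (f n, restrict f S) of (c, f) \<Rightarrow> f(n := c)) = f"
  proof -
    have "(restrict f S)(n := f n) = f"
    proof (rule extensionalityI[where A = "insert n S"])
      show "f \<in> extensional (insert n S)" using f by (simp add: PiE_iff)
    qed (auto simp: extensional_def)
    then show ?thesis by simp
  qed
  show "(f n, restrict f S) \<in> C \<times> (S \<rightarrow>\<^sub>E C)" using f by (simp add: PiE_iff)
  show "(case (f n, restrict f S) of (c, f) \<Rightarrow> g c f) = g (f n) (restrict f S)" by simp
next
  fix p assume "p \<in> C \<times> (S \<rightarrow>\<^sub>E C)"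
  then obtain c f where p: "p = (c, f)" "c \<in> C" and f: "f \<in> S \<rightarrow>\<^sub>E C" by blast
  have "restrict (f(n := c)) S = f"
  proof (rule extensionalityI[where A = S])
    show "f \<in> extensional S" using f by (simp add: PiE_iff)
  qed (use assms in auto)
  then show "((case p of (c, f) \<Rightarrow> f(n := c)) n, restrict (case p of (c, f) \<Rightarrow> f(n := c)) S) = p"
    by (simp add: p)
  show "(case p of (c, f) \<Rightarrow> f(n := c)) \<in> insert n S \<rightarrow>\<^sub>E C"
    using f p assms by (auto simp: PiE_iff extensional_def)
qed

lemma graft_sum_hang_left:
  assumes X: "X \<in> typed_trees A" and Y: "Y \<in> typed_trees B" and AB: "A \<inter> B = {}" and a: "a \<in> A"
  shows "lin_ext (\<lambda>H. graft_sum a C H Z) (hang_sum \<omega> B X Y) = lin_ext (\<lambda>X'. hang_sum \<omega> B X' Y) (graft_sum a C X Z)"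
proof -
  have "lin_ext (\<lambda>H. graft_sum a C H Z) (hang_sum \<omega> B X Y) = (\<Sum>u\<in>B. graft_sum a C (hang \<omega> X u Y) Z)"
    by (simp add: hang_sum_def lin_ext_sum)
  also have "\<dots> = (\<Sum>u\<in>B. \<Sum>f \<in> incoming X a \<rightarrow>\<^sub>E C. basis (hang \<omega> (graft X a f Z) u Y))"
    by (rule sum.cong) (simp_all add: graft_sum_def graft_hang_left[OF X Y AB _ a])
  also have "\<dots> = (\<Sum>f \<in> incoming X a \<rightarrow>\<^sub>E C. hang_sum \<omega> B (graft X a f Z) Y)"
    unfolding hang_sum_def by (rule sum.swap)
  also have "\<dots> = lin_ext (\<lambda>X'. hang_sum \<omega> B X' Y) (graft_sum a C X Z)"
    by (simp add: graft_sum_def lin_ext_sum)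
  finally show ?thesis .
qed

text \<open>The vertices of the graft are those of \<open>B - {a}\<close> and of \<open>C\<close>.
  Hanging below \<open>u \<noteq> a\<close> before grafting yields the terms with \<open>X\<close>
  below \<open>u\<close>; hanging below \<open>a\<close> yields, through the value of the attachment
  map at the connecting edge, the terms with \<open>X\<close> below a vertex of \<open>C\<close>.
  Each position occurs exactly once.\<close>

lemma graft_sum_hang_right:
  assumes X: "X \<in> typed_trees A" and Y: "Y \<in> typed_trees B" and Z: "Z \<in> typed_trees C"
    and B: "finite B" and C: "finite C" and AB: "A \<inter> B = {}" and BC: "B \<inter> C = {}" and a: "a \<in> B"
  shows "lin_ext (\<lambda>H. graft_sum a C H Z) (hang_sum \<omega> B X Y) =
    lin_ext (hang_sum \<omega> (B - {a} \<union> C) X) (graft_sum a C Y Z)"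
proof -
  let ?In = "incoming Y a"
  define t where "t u f = (basis (hang \<omega> X u (graft Y a f Z)) :: ('a, 'b) rtree \<Rightarrow>\<^sub>0 'c)" for u f
  have inj: "inj_on (path_twist \<omega> u Y) ?In" for u
    by (rule inj_on_subset[OF inj_on_path_twist[OF Y]]) (auto simp: incoming_def)
  have gr: "graft Y a (f \<circ> path_twist \<omega> u Y) Z = graft Y a (restrict (f \<circ> path_twist \<omega> u Y) ?In) Z" for f u
    by (rule graft_cong) simp
  have tm: "basis (graft (hang \<omega> X u Y) a f Z) =
      t (if u = a then f (rt_root X, \<omega>, a) else u) (restrict (f \<circ> path_twist \<omega> u Y) ?In)"
    if "u \<in> B" "f \<in> incoming (hang \<omega> X u Y) a \<rightarrow>\<^sub>E C" for u f
  proof -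
    have "graft (hang \<omega> X u Y) a f Z = hang \<omega> X (if u = a then f (rt_root X, \<omega>, a) else u)
        (graft Y a (f \<circ> path_twist \<omega> u Y) Z)"
      by (rule graft_hang_right[OF X Y Z B AB BC a that(1)]) (use that(2) in \<open>simp add: PiE_iff\<close>)
    then show ?thesis unfolding t_def gr by simp
  qed
  have other: "graft_sum a C (hang \<omega> X u Y) Z = (\<Sum>f \<in> ?In \<rightarrow>\<^sub>E C. t u f)" if u: "u \<in> B" "u \<noteq> a" for u
  proof -
    have "incoming (hang \<omega> X u Y) a = path_twist \<omega> u Y ` ?In"
      using incoming_hang_right[OF X AB a, of \<omega> u Y] u(2) by simp
    then have "graft_sum a C (hang \<omega> X u Y) Z =
        (\<Sum>f \<in> path_twist \<omega> u Y ` ?In \<rightarrow>\<^sub>E C. t u (restrict (f \<circ> path_twist \<omega> u Y) ?In))"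
      unfolding graft_sum_def using tm[OF u(1)] u(2) by (intro sum.cong) simp_all
    also have "\<dots> = (\<Sum>f \<in> ?In \<rightarrow>\<^sub>E C. t u f)" by (rule sum_PiE_image[OF inj])
    finally show ?thesis .
  qed
  have at_a: "graft_sum a C (hang \<omega> X a Y) Z = (\<Sum>c\<in>C. \<Sum>f \<in> ?In \<rightarrow>\<^sub>E C. t c f)"
  proof -
    let ?n = "(rt_root X, \<omega>, a)" and ?\<tau> = "path_twist \<omega> a Y"
    have "rt_root X \<notin> B" using typed_treesD(1)[OF X] AB by blast
    then have n: "?n \<notin> ?\<tau> ` ?In"
      using typed_treesD(2)[OF Y] by (auto simp: path_twist_def incoming_def)
    have inc: "incoming (hang \<omega> X a Y) a = insert ?n (?\<tau> ` ?In)"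
      using incoming_hang_right[OF X AB a, of \<omega> a Y] by simp
    have "graft_sum a C (hang \<omega> X a Y) Z =
        (\<Sum>f \<in> insert ?n (?\<tau> ` ?In) \<rightarrow>\<^sub>E C. t (f ?n) (restrict (f \<circ> ?\<tau>) ?In))"
      unfolding graft_sum_def inc by (rule sum.cong[OF refl], subst tm) (simp_all add: inc a)
    also have "\<dots> = (\<Sum>f \<in> insert ?n (?\<tau> ` ?In) \<rightarrow>\<^sub>E C. t (f ?n) (restrict (restrict f (?\<tau> ` ?In) \<circ> ?\<tau>) ?In))"
      by (intro sum.cong refl arg_cong2[of _ _ _ _ t] restrict_ext) simp
    also have "\<dots> = (\<Sum>c\<in>C. \<Sum>f \<in> ?\<tau> ` ?In \<rightarrow>\<^sub>E C. t c (restrict (f \<circ> ?\<tau>) ?In))"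
      by (rule sum_PiE_insert[OF n])
    also have "\<dots> = (\<Sum>c\<in>C. \<Sum>f \<in> ?In \<rightarrow>\<^sub>E C. t c f)"
      by (intro sum.cong refl sum_PiE_image[OF inj])
    finally show ?thesis .
  qed
  have "lin_ext (\<lambda>H. graft_sum a C H Z) (hang_sum \<omega> B X Y) = (\<Sum>u\<in>B. graft_sum a C (hang \<omega> X u Y) Z)"
    by (simp add: hang_sum_def lin_ext_sum)
  also have "\<dots> = graft_sum a C (hang \<omega> X a Y) Z + (\<Sum>u\<in>B - {a}. graft_sum a C (hang \<omega> X u Y) Z)"
    by (rule sum.remove[OF B a])
  also have "\<dots> = (\<Sum>u\<in>C. \<Sum>f \<in> ?In \<rightarrow>\<^sub>E C. t u f) + (\<Sum>u\<in>B - {a}. \<Sum>f \<in> ?In \<rightarrow>\<^sub>E C. t u f)"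
    by (simp add: at_a other)
  also have "\<dots> = (\<Sum>u\<in>B - {a} \<union> C. \<Sum>f \<in> ?In \<rightarrow>\<^sub>E C. t u f)"
    by (subst sum.union_disjoint) (use B C BC in \<open>auto simp: add.commute\<close>)
  also have "\<dots> = (\<Sum>f \<in> ?In \<rightarrow>\<^sub>E C. hang_sum \<omega> (B - {a} \<union> C) X (graft Y a f Z))"
    unfolding hang_sum_def t_def by (rule sum.swap)
  also have "\<dots> = lin_ext (hang_sum \<omega> (B - {a} \<union> C) X) (graft_sum a C Y Z)"
    by (simp add: graft_sum_def lin_ext_sum)
  finally show ?thesis .
qed

section \<open>Evaluation, and its compatibility with substitution\<close>

primrec tev :: "('l, 'w::ab_semigroup_mult) pbt \<Rightarrow> (('l, 'w) rtree \<Rightarrow>\<^sub>0 'k::{comm_ring,comm_monoid_mult})" where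
  "tev (Leaf a) = basis (RTree a {})"
| "tev (Node \<omega> l r) = lin_ext (\<lambda>T. lin_ext (hang_sum \<omega> (set (leaves r)) T) (tev r)) (tev l)"

lemma singleton_typed_tree: "RTree a {} \<in> typed_trees {a}"
  by (simp add: typed_trees_def)

lemma keys_sum_subset: "(\<And>x. x \<in> S \<Longrightarrow> Poly_Mapping.keys (g x) \<subseteq> Y) \<Longrightarrow> Poly_Mapping.keys (\<Sum>x\<in>S. g x) \<subseteq> Y"
  using keys_sum[of g S] by blast

lemma keys_hang_sum:
  assumes "T \<in> typed_trees A" "S \<in> typed_trees B" "A \<inter> B = {}"
  shows "Poly_Mapping.keys (hang_sum \<omega> B T S) \<subseteq> typed_trees (A \<union> B)"
  unfolding hang_sum_def by (intro keys_sum_subset keys_basis_subset hang_typed_trees assms)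

lemma distinct_leaves_induct [consumes 1, case_names Leaf Node]:
  assumes "distinct (leaves t)"
    and "\<And>a. P (Leaf a)"
    and "\<And>\<omega> l r. distinct (leaves l) \<Longrightarrow> distinct (leaves r) \<Longrightarrow> set (leaves l) \<inter> set (leaves r) = {} \<Longrightarrow>
      P l \<Longrightarrow> P r \<Longrightarrow> P (Node \<omega> l r)"
  shows "P t"
  using assms(1) by (induction t) (use assms(2,3) in simp_all)

lemma keys_tev: "distinct (leaves t) \<Longrightarrow> Poly_Mapping.keys (tev t) \<subseteq> typed_trees (set (leaves t))"
proof (induction t rule: distinct_leaves_induct)
  case (Leaf a)
  then show ?case by (simp add: keys_basis_subset singleton_typed_tree)
next
  case (Node \<omega> l r)
  show ?case unfolding tev.simps leaves.simps set_append
    by (intro keys_lin_ext keys_hang_sum) (use Node in auto)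
qed

lemma tev_map:
  "distinct (leaves t) \<Longrightarrow> inj_on \<sigma> (set (leaves t)) \<Longrightarrow>
    tev (map_pbt \<sigma> id t) = lin_ext (\<lambda>T. basis (relabel_rtree \<sigma> T)) (tev t)"
proof (induction t rule: distinct_leaves_induct)
  case (Leaf a)
  then show ?case by (simp add: relabel_rtree_def)
next
  case (Node \<omega> l r)
  let ?R = "set (leaves r)"
  have inj: "inj_on \<sigma> (set (leaves l))" "inj_on \<sigma> ?R" using Node.prems by (auto intro: inj_on_subset)
  have *: "lin_ext (\<lambda>T. basis (relabel_rtree \<sigma> T)) (hang_sum \<omega> ?R T S) =
      hang_sum \<omega> (\<sigma> ` ?R) (relabel_rtree \<sigma> T) (relabel_rtree \<sigma> S)"
    if "S \<in> Poly_Mapping.keys (tev r)" for T and S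
  proof -
    have S: "S \<in> typed_trees ?R" using that keys_tev[OF Node.hyps(2)] by blast
    show ?thesis
      by (simp add: hang_sum_def lin_ext_sum sum.reindex[OF inj(2)] relabel_hang[OF S _ inj(2)])
  qed
  have m: "map_pbt \<sigma> id (Node \<omega> l r) = Node \<omega> (map_pbt \<sigma> id l) (map_pbt \<sigma> id r)" by simp
  show ?case
    unfolding m tev.simps leaves_map_pbt set_map Node.IH(1)[OF inj(1)] Node.IH(2)[OF inj(2)] lin_ext_lin_ext lin_ext_basis
    by (intro lin_ext_cong refl *[symmetric])
qed

text \<open>The identities for single trees are \<open>graft_sum_hang_left\<close> and
  \<open>graft_sum_hang_right\<close>; \<open>lin_ext_swap\<close> brings the nested linear
  extensions into the order in which they apply.\<close>

lemma tev_subst: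
  fixes t s :: "('l, 'w::ab_semigroup_mult) pbt"
  assumes "distinct (leaves t)" "distinct (leaves s)" "set (leaves t) \<inter> set (leaves s) = {}" "a \<in> set (leaves t)"
  shows "tev (subst_leaf a s t) = lin_ext (\<lambda>T. lin_ext (graft_sum a (set (leaves s)) T) (tev s)) (tev t :: ('l, 'w) rtree \<Rightarrow>\<^sub>0 'k::{comm_ring,comm_monoid_mult})"
  using assms(1,3,4)
proof (induction t rule: distinct_leaves_induct)
  case (Leaf b)
  \<comment> \<open>A one-vertex tree has no incoming edge, hence only the empty attachment map, and
    the graft returns \<open>U\<close>.\<close>
  have "graft_sum a (set (leaves s)) (RTree a {}) U = (basis U :: ('l, 'w) rtree \<Rightarrow>\<^sub>0 'k)" for U
  proof -
    have "incoming (RTree a {} :: ('l, 'w) rtree) a = {}" by (simp add: incoming_def)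
    moreover have "graft (RTree a {}) a f U = U" for f
      by (rule rtree_eqI) (simp_all add: rt_root_graft rt_edges_graft twisted_type_eq incoming_def)
    ultimately show ?thesis by (simp add: graft_sum_def)
  qed
  then have "graft_sum a (set (leaves s)) (RTree a {}) = (basis :: _ \<Rightarrow> ('l, 'w) rtree \<Rightarrow>\<^sub>0 'k)" by (rule HOL.ext)
  then show ?case using Leaf by (simp add: lin_ext_basis_id)
next
  case (Node \<omega> l r)
  let ?L = "set (leaves l)" and ?R = "set (leaves r)" and ?S = "set (leaves s)"
  have kl: "X \<in> typed_trees ?L" if "X \<in> Poly_Mapping.keys (tev l :: ('l, 'w) rtree \<Rightarrow>\<^sub>0 'k)" for X using that keys_tev Node.hyps(1) by blast
  have kr: "Y \<in> typed_trees ?R" if "Y \<in> Poly_Mapping.keys (tev r :: ('l, 'w) rtree \<Rightarrow>\<^sub>0 'k)" for Y using that keys_tev Node.hyps(2) by blast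
  have ks: "Z \<in> typed_trees ?S" if "Z \<in> Poly_Mapping.keys (tev s :: ('l, 'w) rtree \<Rightarrow>\<^sub>0 'k)" for Z using that keys_tev assms(2) by blast
  show ?case
  proof (cases "a \<in> ?L")
    case True
    then have aR: "a \<notin> ?R" using Node.hyps(3) by blast
    have IH: "tev (subst_leaf a s l) = lin_ext (\<lambda>T. lin_ext (graft_sum a ?S T) (tev s)) (tev l :: ('l, 'w) rtree \<Rightarrow>\<^sub>0 'k)"
      by (rule Node.IH(1)) (use Node.prems True in auto)
    have "tev (subst_leaf a s (Node \<omega> l r)) =
        lin_ext (\<lambda>X. lin_ext (\<lambda>Z. lin_ext (\<lambda>X'. lin_ext (hang_sum \<omega> ?R X') (tev r)) (graft_sum a ?S X Z)) (tev s)) (tev l :: ('l, 'w) rtree \<Rightarrow>\<^sub>0 'k)"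
      using aR by (simp add: subst_leaf_notin IH lin_ext_lin_ext)
    also have "\<dots> = lin_ext (\<lambda>X. lin_ext (\<lambda>Z. lin_ext (\<lambda>Y. lin_ext (\<lambda>X'. hang_sum \<omega> ?R X' Y) (graft_sum a ?S X Z)) (tev r)) (tev s)) (tev l)"
      by (subst lin_ext_swap) (rule refl)
    also have "\<dots> = lin_ext (\<lambda>X. lin_ext (\<lambda>Z. lin_ext (\<lambda>Y. lin_ext (\<lambda>H. graft_sum a ?S H Z) (hang_sum \<omega> ?R X Y)) (tev r)) (tev s)) (tev l)"
      by (rule lin_ext_cong[OF refl], rule lin_ext_cong[OF refl], rule lin_ext_cong[OF refl])
        (rule graft_sum_hang_left[OF kl kr Node.hyps(3) True, symmetric]; assumption)
    also have "\<dots> = lin_ext (\<lambda>X. lin_ext (\<lambda>Y. lin_ext (\<lambda>Z. lin_ext (\<lambda>H. graft_sum a ?S H Z) (hang_sum \<omega> ?R X Y)) (tev s)) (tev r)) (tev l)"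
      by (subst lin_ext_swap) (rule refl)
    also have "\<dots> = lin_ext (\<lambda>X. lin_ext (\<lambda>Y. lin_ext (\<lambda>H. lin_ext (graft_sum a ?S H) (tev s)) (hang_sum \<omega> ?R X Y)) (tev r)) (tev l)"
      by (subst lin_ext_swap) (rule refl)
    also have "\<dots> = lin_ext (\<lambda>T. lin_ext (graft_sum a ?S T) (tev s)) (tev (Node \<omega> l r))"
      by (simp add: lin_ext_lin_ext)
    finally show ?thesis .
  next
    case False
    then have aR: "a \<in> ?R" using Node.prems by auto
    have IH: "tev (subst_leaf a s r) = lin_ext (\<lambda>T. lin_ext (graft_sum a ?S T) (tev s)) (tev r :: ('l, 'w) rtree \<Rightarrow>\<^sub>0 'k)"
      by (rule Node.IH(2)) (use Node.prems aR in auto)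
    have d: "?R \<inter> ?S = {}" using Node.prems by auto
    have "tev (subst_leaf a s (Node \<omega> l r)) =
        lin_ext (\<lambda>X. lin_ext (\<lambda>Y. lin_ext (\<lambda>Z. lin_ext (hang_sum \<omega> (?R - {a} \<union> ?S) X) (graft_sum a ?S Y Z)) (tev s)) (tev r)) (tev l :: ('l, 'w) rtree \<Rightarrow>\<^sub>0 'k)"
      using False aR by (simp add: subst_leaf_notin IH lin_ext_lin_ext set_leaves_subst)
    also have "\<dots> = lin_ext (\<lambda>X. lin_ext (\<lambda>Y. lin_ext (\<lambda>Z. lin_ext (\<lambda>H. graft_sum a ?S H Z) (hang_sum \<omega> ?R X Y)) (tev s)) (tev r)) (tev l)"
      by (rule lin_ext_cong[OF refl], rule lin_ext_cong[OF refl], rule lin_ext_cong[OF refl])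
        (rule graft_sum_hang_right[OF kl kr ks finite_set finite_set Node.hyps(3) d aR, symmetric]; assumption)
    also have "\<dots> = lin_ext (\<lambda>X. lin_ext (\<lambda>Y. lin_ext (\<lambda>H. lin_ext (graft_sum a ?S H) (tev s)) (hang_sum \<omega> ?R X Y)) (tev r)) (tev l)"
      by (subst lin_ext_swap) (rule refl)
    also have "\<dots> = lin_ext (\<lambda>T. lin_ext (graft_sum a ?S T) (tev s)) (tev (Node \<omega> l r))"
      by (simp add: lin_ext_lin_ext)
    finally show ?thesis .
  qed
qed

section \<open>The leading tree of a binary tree\<close>

text \<open>
  This is the statistic that makes evaluation triangular: among all ways of hanging \<open>T\<close> below a
  vertex of \<open>S\<close>, hanging it below the root of \<open>S\<close> is the only one with fewest ancestor pairs.
\<close>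

definition ancestor_count :: "'l set \<Rightarrow> ('l, 'w) rtree \<Rightarrow> nat" where
  "ancestor_count A T = card ((parent_rel T)\<^sup>* \<inter> A \<times> A)"

text \<open>Ancestor pairs are sorted by the parts in which their ends lie. A pair from
  \<open>A\<close> to \<open>B\<close> starts anywhere in \<open>A\<close> and ends at any vertex
  reached from \<open>u\<close>, which gives the product. The vertex \<open>u\<close> itself counts,
  so the second factor is 1 exactly when \<open>u\<close> is the root.\<close>

lemma ancestor_count_hang:
  assumes T: "T \<in> typed_trees A" and S: "S \<in> typed_trees B" and AB: "A \<inter> B = {}" and u: "u \<in> B"
    and fin: "finite A" "finite B"
  shows "ancestor_count (A \<union> B) (hang \<omega> T u S) =
    ancestor_count A T + ancestor_count B S + card A * card {w \<in> B. (u, w) \<in> (parent_rel S)\<^sup>*}"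
proof -
  let ?P = "(parent_rel T)\<^sup>* \<inter> A \<times> A" and ?Q = "(parent_rel S)\<^sup>* \<inter> B \<times> B"
    and ?R = "A \<times> {w \<in> B. (u, w) \<in> (parent_rel S)\<^sup>*}"
  have "(parent_rel (hang \<omega> T u S))\<^sup>* \<inter> (A \<union> B) \<times> (A \<union> B) = (?P \<union> ?Q) \<union> ?R"
  proof (rule Set.set_eqI)
    fix p :: "'a \<times> 'a"
    obtain x y where p: "p = (x, y)" by (cases p)
    show "p \<in> (parent_rel (hang \<omega> T u S))\<^sup>* \<inter> (A \<union> B) \<times> (A \<union> B) \<longleftrightarrow> p \<in> (?P \<union> ?Q) \<union> ?R"
    proof (cases "x \<in> A \<union> B")
      case True
      then show ?thesis
        unfolding p Int_iff Un_iff mem_Sigma_iff mem_Collect_eq rtrancl_hang[OF T S AB u True] by blast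
    next
      case False then show ?thesis unfolding p by blast
    qed
  qed
  moreover have "card ((?P \<union> ?Q) \<union> ?R) = card (?P \<union> ?Q) + card ?R"
    by (rule card_Un_disjoint) (use fin AB in auto)
  moreover have "card (?P \<union> ?Q) = card ?P + card ?Q"
    by (rule card_Un_disjoint) (use fin AB in auto)
  ultimately show ?thesis by (simp add: ancestor_count_def card_cartesian_product)
qed

lemma card_ancestors:
  assumes S: "S \<in> typed_trees B" and u: "u \<in> B" and B: "finite B"
  shows "card {w \<in> B. (u, w) \<in> (parent_rel S)\<^sup>*} \<ge> 1"
    and "u \<noteq> rt_root S \<Longrightarrow> card {w \<in> B. (u, w) \<in> (parent_rel S)\<^sup>*} > 1"
    and "card {w \<in> B. (rt_root S, w) \<in> (parent_rel S)\<^sup>*} = 1"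
proof -
  let ?W = "{w \<in> B. (u, w) \<in> (parent_rel S)\<^sup>*}"
  have W: "finite ?W" "u \<in> ?W" "rt_root S \<in> ?W" using B u typed_treesD(1,5)[OF S] by auto
  show "card ?W \<ge> 1" using card_mono[of ?W "{u}"] W by simp
  show "card ?W > 1" if "u \<noteq> rt_root S"
    using card_mono[of ?W "{u, rt_root S}"] W that by simp
  have "{w \<in> B. (rt_root S, w) \<in> (parent_rel S)\<^sup>*} = {rt_root S}"
    using root_rtrancl[OF _ S] typed_treesD(1)[OF S] by blast
  then show "card {w \<in> B. (rt_root S, w) \<in> (parent_rel S)\<^sup>*} = 1" by simp
qed

section \<open>Leading trees and triangularity\<close>

text \<open>This is the root of \<open>lead t\<close>: hanging keeps the root of the second factor,
  so the root sits at the end of the right spine.\<close>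

primrec tip :: "('l, 'w) pbt \<Rightarrow> 'l" where
  "tip (Leaf a) = a"
| "tip (Node \<omega> l r) = tip r"

lemma tip_leaves: "tip t \<in> set (leaves t)"
  by (induction t) simp_all

primrec lead :: "('l, 'w::ab_semigroup_mult) pbt \<Rightarrow> ('l, 'w) rtree" where
  "lead (Leaf a) = RTree a {}"
| "lead (Node \<omega> l r) = hang \<omega> (lead l) (tip r) (lead r)"

lemma rt_root_lead [simp]: "rt_root (lead t) = tip t"
  by (induction t) simp_all

lemma lead_typed: "distinct (leaves t) \<Longrightarrow> lead t \<in> typed_trees (set (leaves t))"
  by (induction t rule: distinct_leaves_induct)
    (simp_all add: singleton_typed_tree hang_typed_trees tip_leaves)

text \<open>The count is strictly increasing in the counts of both factors, and because
  \<open>A\<close> is nonempty a position other than the root makes the mixed term strictly larger.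
  One strict inequality out of three thus suffices.\<close>

lemma ancestor_count_less:
  assumes T: "T \<in> typed_trees A" "T0 \<in> typed_trees A" and S: "S \<in> typed_trees B" "S0 \<in> typed_trees B"
    and AB: "A \<inter> B = {}" and u: "u \<in> B" and fin: "finite A" "finite B"
    and le: "ancestor_count A T0 \<le> ancestor_count A T" "ancestor_count B S0 \<le> ancestor_count B S"
    and less: "ancestor_count A T0 < ancestor_count A T \<or> ancestor_count B S0 < ancestor_count B S \<or> u \<noteq> rt_root S"
  shows "ancestor_count (A \<union> B) (hang \<omega> T0 (rt_root S0) S0) < ancestor_count (A \<union> B) (hang \<omega> T u S)"
proof -
  let ?c = "card {w \<in> B. (u, w) \<in> (parent_rel S)\<^sup>*}"
  have A: "card A > 0" using typed_treesD(1)[OF T(1)] fin(1) by (auto simp: card_gt_0_iff)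
  have "ancestor_count (A \<union> B) (hang \<omega> T0 (rt_root S0) S0) = ancestor_count A T0 + ancestor_count B S0 + card A"
    using ancestor_count_hang[OF T(2) S(2) AB typed_treesD(1)[OF S(2)] fin, of \<omega>]
      card_ancestors(3)[OF S(2) typed_treesD(1)[OF S(2)] fin(2)] by simp
  moreover have "ancestor_count (A \<union> B) (hang \<omega> T u S) = ancestor_count A T + ancestor_count B S + card A * ?c"
    by (rule ancestor_count_hang[OF T(1) S(1) AB u fin])
  moreover have "card A \<le> card A * ?c" using card_ancestors(1)[OF S(1) u fin(2)] by simp
  moreover have "card A < card A * ?c" if "u \<noteq> rt_root S"
    using card_ancestors(2)[OF S(1) u fin(2) that] A by simp
  ultimately show ?thesis using le less by linarith
qed

lemma tev_lead:
  fixes t :: "('l, 'w::ab_semigroup_mult) pbt"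
  assumes "distinct (leaves t)"
  shows "\<exists>y :: ('l, 'w) rtree \<Rightarrow>\<^sub>0 'k::{comm_ring,comm_monoid_mult}. tev t = basis (lead t) + y \<and> Poly_Mapping.keys y \<subseteq>
    {T \<in> typed_trees (set (leaves t)). ancestor_count (set (leaves t)) (lead t) < ancestor_count (set (leaves t)) T}"
  using assms
proof (induction t rule: distinct_leaves_induct)
  case (Leaf a)
  show ?case by (rule exI[of _ 0]) simp
next
  case (Node \<omega> l r)
  let ?L = "set (leaves l)" and ?R = "set (leaves r)"
  let ?nL = "ancestor_count ?L" and ?nR = "ancestor_count ?R"
  let ?h = "hang_sum \<omega> ?R"
  let ?Big = "{T \<in> typed_trees (?L \<union> ?R). ancestor_count (?L \<union> ?R) (lead (Node \<omega> l r)) < ancestor_count (?L \<union> ?R) T}"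
  note tl = lead_typed[OF Node.hyps(1)] and tr = lead_typed[OF Node.hyps(2)]
  obtain yl :: "('l, 'w) rtree \<Rightarrow>\<^sub>0 'k" where yl: "tev l = basis (lead l) + yl"
    "Poly_Mapping.keys yl \<subseteq> {T \<in> typed_trees ?L. ?nL (lead l) < ?nL T}" using Node.IH(1) by blast
  obtain yr :: "('l, 'w) rtree \<Rightarrow>\<^sub>0 'k" where yr: "tev r = basis (lead r) + yr"
    "Poly_Mapping.keys yr \<subseteq> {T \<in> typed_trees ?R. ?nR (lead r) < ?nR T}" using Node.IH(2) by blast
  have big: "hang \<omega> T u S \<in> ?Big"
    if "T \<in> typed_trees ?L" "S \<in> typed_trees ?R" "u \<in> ?R" "?nL (lead l) \<le> ?nL T" "?nR (lead r) \<le> ?nR S"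
      "?nL (lead l) < ?nL T \<or> ?nR (lead r) < ?nR S \<or> u \<noteq> rt_root S" for T u S
    using ancestor_count_less[OF that(1) tl that(2) tr Node.hyps(3) that(3) _ _ that(4,5,6), of \<omega>]
      hang_typed_trees[OF that(1,2) Node.hyps(3) that(3)] by simp
  \<comment> \<open>The remainder in three parts: \<open>y0\<close> hangs the leading left tree
    below non-root vertices of the leading right one, \<open>y1\<close> uses the remainder of the
    right factor, and \<open>y2\<close> the remainder of the left one.\<close>
  define y0 where "y0 = (\<Sum>u\<in>?R - {tip r}. basis (hang \<omega> (lead l) u (lead r)) :: ('l, 'w) rtree \<Rightarrow>\<^sub>0 'k)"
  define y1 where "y1 = lin_ext (?h (lead l)) yr"
  define y2 where "y2 = lin_ext (\<lambda>T. lin_ext (?h T) (tev r)) yl"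
  have "?h (lead l) (lead r) = basis (lead (Node \<omega> l r)) + y0"
    unfolding hang_sum_def y0_def lead.simps by (rule sum.remove) (simp_all add: tip_leaves)
  then have eq: "tev (Node \<omega> l r) = basis (lead (Node \<omega> l r)) + (y0 + y1 + y2)"
    unfolding tev.simps y1_def y2_def
    by (subst yl(1), subst lin_ext_add, subst (1) yr(1)) (simp add: lin_ext_add add.assoc)
  have "Poly_Mapping.keys y0 \<subseteq> ?Big" unfolding y0_def
    by (intro keys_sum_subset keys_basis_subset big tl tr) auto
  moreover have "Poly_Mapping.keys y1 \<subseteq> ?Big" unfolding y1_def hang_sum_def
    by (intro keys_lin_ext keys_sum_subset keys_basis_subset big tl) (use yr(2) in auto)
  moreover have "Poly_Mapping.keys y2 \<subseteq> ?Big" unfolding y2_def hang_sum_def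
  proof (intro keys_lin_ext keys_sum_subset keys_basis_subset)
    fix T S u assume T: "T \<in> Poly_Mapping.keys yl" and S: "S \<in> Poly_Mapping.keys (tev r :: ('l, 'w) rtree \<Rightarrow>\<^sub>0 'k)" and u: "u \<in> ?R"
    have "S \<in> Poly_Mapping.keys (basis (lead r) :: ('l, 'w) rtree \<Rightarrow>\<^sub>0 'k) \<union> Poly_Mapping.keys yr"
      using S Poly_Mapping.keys_add[of "basis (lead r)" yr] yr(1) by auto
    then have "S = lead r \<or> S \<in> Poly_Mapping.keys yr" using keys_basis[of "lead r"] by blast
    then have "S \<in> typed_trees ?R" "?nR (lead r) \<le> ?nR S" using yr(2) tr by auto
    then show "hang \<omega> T u S \<in> ?Big" using T yl(2) u by (intro big) auto
  qed
  ultimately have "Poly_Mapping.keys (y0 + y1 + y2) \<subseteq> ?Big"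
    using Poly_Mapping.keys_add[of "y0 + y1" y2] Poly_Mapping.keys_add[of y0 y1] by blast
  then show ?case using eq by (intro exI[of _ "y0 + y1 + y2"]) simp
qed

text \<open>Cutting the edge of any child \<open>c\<close> of the root leaves the subtree at
  \<open>c\<close> and the rest, both with fewer vertices. Hanging the first one back below the root
  multiplies no type and so restores the tree exactly.\<close>

lemma lead_surj:
  "finite A \<Longrightarrow> T \<in> typed_trees A \<Longrightarrow> \<exists>t\<in>pbts A. lead t = T"
proof (induction "card A" arbitrary: A T rule: less_induct)
  case less
  note T = less.prems(2) and A = less.prems(1)
  let ?r = "rt_root T"
  note tD = typed_treesD[OF T]
  show ?case
  proof (cases "A = {?r}")
    case True
    have "rt_edges T = {}" using tD(2) True by fastforce
    then have "T = RTree ?r {}" by (metis rtree.collapse)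
    then show ?thesis using True by (intro bexI[of _ "Leaf ?r"]) (auto simp: pbts_def)
  next
    case False
    then obtain w where "w \<in> A" "w \<noteq> ?r" using tD(1) by blast
    then obtain c where c: "(c, ?r) \<in> parent_rel T" using tD(5)[of w] by (metis rtranclE)
    then obtain \<omega> where e: "(c, \<omega>, ?r) \<in> rt_edges T" by (auto simp: parent_rel_iff)
    have cA: "c \<in> A" "c \<noteq> ?r" using tD(2)[OF e] by blast+
    define L where "L = {w \<in> A. (w, c) \<in> (parent_rel T)\<^sup>*}"
    define T1 where "T1 = RTree c {e \<in> rt_edges T. fst e \<in> L - {c}}"
    define T2 where "T2 = RTree ?r {e \<in> rt_edges T. fst e \<in> A - L}"
    have E1: "(w, \<eta>, x) \<in> rt_edges T1 \<longleftrightarrow> (w, \<eta>, x) \<in> rt_edges T \<and> w \<in> L \<and> w \<noteq> c" for w \<eta> x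
      by (simp add: T1_def)
    have E2: "(w, \<eta>, x) \<in> rt_edges T2 \<longleftrightarrow> (w, \<eta>, x) \<in> rt_edges T \<and> w \<in> A \<and> w \<notin> L" for w \<eta> x
      by (simp add: T2_def)
    have root: "rt_root T1 = c" "rt_root T2 = ?r" by (simp_all add: T1_def T2_def)
    have up: "x \<in> L" if wx: "(w, x) \<in> parent_rel T" "w \<in> L" "w \<noteq> c" for w x
    proof -
      have "(w, c) \<in> (parent_rel T)\<^sup>*" using wx(2) by (simp add: L_def)
      then obtain x' where "(w, x') \<in> parent_rel T" "(x', c) \<in> (parent_rel T)\<^sup>*"
        using wx(3) by (metis converse_rtranclE)
      moreover from this(1) have "x' = x"
        using single_valuedD[OF single_valued_parent_rel[OF T] _ wx(1)] by blast
      ultimately show ?thesis using parent_rel_mem[OF T wx(1)] by (simp add: L_def)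
    qed
    have down: "x \<in> A - L" if "(w, x) \<in> parent_rel T" "w \<in> A - L" for w x
      using that parent_rel_mem[OF T that(1)] converse_rtrancl_into_rtrancl[OF that(1), of c] by (auto simp: L_def)
    have cL: "c \<in> L" using cA by (simp add: L_def)
    have rL: "?r \<in> A - L" using root_rtrancl[of T c A] T cA tD(1) by (auto simp: L_def)
    have T1: "T1 \<in> typed_trees L"
    proof (rule typed_treesI, unfold root E1)
      show "c \<in> L" by (rule cL)
      show "w \<in> L \<and> w \<noteq> c \<and> x \<in> L" if "(w, \<eta>, x) \<in> rt_edges T \<and> w \<in> L \<and> w \<noteq> c" for w \<eta> x
        using that up[of w x] by (auto simp: parent_rel_iff)
      show "\<eta> = \<eta>' \<and> x = x'" if "(w, \<eta>, x) \<in> rt_edges T \<and> w \<in> L \<and> w \<noteq> c" "(w, \<eta>', x') \<in> rt_edges T \<and> w \<in> L \<and> w \<noteq> c"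
        for w \<eta> x \<eta>' x' using that tD(3)[of w \<eta> x \<eta>' x'] by blast
      show "\<exists>\<eta> x. (w, \<eta>, x) \<in> rt_edges T \<and> w \<in> L \<and> w \<noteq> c" if "w \<in> L" "w \<noteq> c" for w
      proof -
        have "w \<in> A" "w \<noteq> ?r" using that rL by (auto simp: L_def)
        then show ?thesis using tD(4)[of w] that by blast
      qed
      fix w assume "w \<in> L"
      then have "(w, c) \<in> (parent_rel T)\<^sup>*" by (simp add: L_def)
      then show "(w, c) \<in> (parent_rel T1)\<^sup>*" using \<open>w \<in> L\<close>
      proof (induction rule: converse_rtrancl_induct)
        case (step y z)
        show ?case
        proof (cases "y = c")
          case False
          then have "(z, c) \<in> (parent_rel T1)\<^sup>*" using step.IH up[OF step.hyps(1) step.prems] by blast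
          moreover have "(y, z) \<in> parent_rel T1" using step.hyps(1) step.prems False by (simp add: parent_rel_iff E1)
          ultimately show ?thesis by (rule converse_rtrancl_into_rtrancl[rotated])
        qed simp
      qed simp
    qed
    have T2: "T2 \<in> typed_trees (A - L)"
    proof (rule typed_treesI, unfold root E2)
      show "?r \<in> A - L" by (rule rL)
      show "w \<in> A - L \<and> w \<noteq> ?r \<and> x \<in> A - L" if "(w, \<eta>, x) \<in> rt_edges T \<and> w \<in> A \<and> w \<notin> L" for w \<eta> x
      proof -
        have "(w, x) \<in> parent_rel T" using that by (auto simp: parent_rel_iff)
        then show ?thesis using that down[of w x] parent_rel_mem[OF T, of w x] by blast
      qed
      show "\<eta> = \<eta>' \<and> x = x'" if "(w, \<eta>, x) \<in> rt_edges T \<and> w \<in> A \<and> w \<notin> L" "(w, \<eta>', x') \<in> rt_edges T \<and> w \<in> A \<and> w \<notin> L"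
        for w \<eta> x \<eta>' x' using that tD(3)[of w \<eta> x \<eta>' x'] by blast
      show "\<exists>\<eta> x. (w, \<eta>, x) \<in> rt_edges T \<and> w \<in> A \<and> w \<notin> L" if "w \<in> A - L" "w \<noteq> ?r" for w
        using tD(4)[of w] that by blast
      fix w assume w: "w \<in> A - L"
      then have "(w, ?r) \<in> (parent_rel T)\<^sup>*" using tD(5) by blast
      then show "(w, ?r) \<in> (parent_rel T2)\<^sup>*" using w
      proof (induction rule: converse_rtrancl_induct)
        case (step y z)
        then have "(z, ?r) \<in> (parent_rel T2)\<^sup>*" using down[OF step.hyps(1) step.prems] by blast
        moreover have "(y, z) \<in> parent_rel T2" using step.hyps(1) step.prems by (simp add: parent_rel_iff E2)
        ultimately show ?case by (rule converse_rtrancl_into_rtrancl[rotated])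
      qed simp
    qed
    \<comment> \<open>From the root only the root is reached, and no edge leaves it, so no type is
      multiplied.\<close>
    have pm: "path_mult \<omega> ?r T2 w \<eta> = \<eta>" if "(w, \<eta>', x) \<in> rt_edges T2" for w \<eta> \<eta>' x
      using root_rtrancl[OF _ T2, of w] typed_treesD(2)[OF T2 that] root by (auto simp: path_mult_def)
    have hang: "hang \<omega> T1 ?r T2 = T"
    proof (rule rtree_eqI)
      fix w \<eta> x
      have "(w, \<eta>, x) \<in> rt_edges (hang \<omega> T1 ?r T2) \<longleftrightarrow>
          w = c \<and> \<eta> = \<omega> \<and> x = ?r \<or> (w, \<eta>, x) \<in> rt_edges T1 \<or> (w, \<eta>, x) \<in> rt_edges T2"
        unfolding rt_edges_hang root using pm by metis
      also have "\<dots> \<longleftrightarrow> (w, \<eta>, x) \<in> rt_edges T"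
        unfolding E1 E2 using tD(2)[of w \<eta> x] tD(3)[OF e] e cL by blast
      finally show "(w, \<eta>, x) \<in> rt_edges (hang \<omega> T1 ?r T2) \<longleftrightarrow> (w, \<eta>, x) \<in> rt_edges T" .
    qed (simp add: root)
    have "L \<subset> A" "A - L \<subset> A" using cL cA rL by (auto simp: L_def)
    then have "card L < card A" "card (A - L) < card A" "finite L" "finite (A - L)"
      using A by (auto intro: psubset_card_mono finite_subset)
    then obtain l r where lr: "l \<in> pbts L" "lead l = T1" "r \<in> pbts (A - L)" "lead r = T2"
      using less.hyps[of L T1] less.hyps[of "A - L" T2] T1 T2 by blast
    have "tip r = ?r" using rt_root_lead[of r] lr(4) root by simp
    then have "lead (Node \<omega> l r) = T" using lr hang by simp
    moreover have "Node \<omega> l r \<in> pbts A" using lr \<open>L \<subset> A\<close> by (auto simp: pbts_def)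
    ultimately show ?thesis by blast
  qed
qed

text \<open>
  The branches at a vertex of \<open>lead t\<close> can be listed in any order in \<open>t\<close>; normal forms list them
  by increasing value of \<open>enc\<close> at their roots, which makes \<open>lead\<close> injective.
\<close>

primrec below :: "('l \<Rightarrow> nat) \<Rightarrow> nat \<Rightarrow> ('l, 'w) pbt \<Rightarrow> bool" where
  "below enc m (Leaf a) \<longleftrightarrow> True"
| "below enc m (Node \<omega> l r) \<longleftrightarrow> m \<le> enc (tip l)"

primrec normal_form :: "('l \<Rightarrow> nat) \<Rightarrow> ('l, 'w) pbt \<Rightarrow> bool" where
  "normal_form enc (Leaf a) \<longleftrightarrow> True"
| "normal_form enc (Node \<omega> l r) \<longleftrightarrow> normal_form enc l \<and> normal_form enc r \<and> below enc (Suc (enc (tip l))) r"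

section \<open>Normal forms are determined by their leading trees\<close>

lemma rt_edges_lead_Node:
  assumes "distinct (leaves (Node \<omega> l r))"
  shows "(w, \<eta>, x) \<in> rt_edges (lead (Node \<omega> l r)) \<longleftrightarrow>
    w = tip l \<and> \<eta> = \<omega> \<and> x = tip r \<or> (w, \<eta>, x) \<in> rt_edges (lead l) \<or> (w, \<eta>, x) \<in> rt_edges (lead r)"
proof -
  have tr: "lead r \<in> typed_trees (set (leaves r))" by (rule lead_typed) (use assms in simp)
  have "path_mult \<omega> (tip r) (lead r) w \<eta> = \<eta>" if "(w, \<eta>', x) \<in> rt_edges (lead r)" for w \<eta> \<eta>' x
    using root_rtrancl[OF _ tr, of w] typed_treesD(2)[OF tr that] by (auto simp: path_mult_def)
  then show ?thesis unfolding lead.simps rt_edges_hang rt_root_lead by metis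
qed

text \<open>The children of the root are the tips of the branches along the right spine. In a normal
  form these increase, so a bound for the first branch is a bound for all of them.\<close>

lemma below_child:
  "distinct (leaves t) \<Longrightarrow> normal_form enc t \<Longrightarrow> below enc m t \<Longrightarrow> (w, \<eta>, tip t) \<in> rt_edges (lead t) \<Longrightarrow> m \<le> enc w"
proof (induction t arbitrary: m rule: distinct_leaves_induct)
  case (Node \<omega> l r)
  have d: "distinct (leaves (Node \<omega> l r))" using Node.hyps by simp
  have "(w, \<eta>, tip r) \<notin> rt_edges (lead l)"
    using typed_treesD(2)[OF lead_typed[OF Node.hyps(1)], of w \<eta> "tip r"] tip_leaves[of r] Node.hyps(3) by blast
  then consider "w = tip l" | "(w, \<eta>, tip r) \<in> rt_edges (lead r)"
    using Node.prems(3) unfolding rt_edges_lead_Node[OF d] tip.simps by blast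
  then show ?case
  proof cases
    case 2
    then have "Suc (enc (tip l)) \<le> enc w" using Node.prems by (intro Node.IH(2)) simp_all
    then show ?thesis using Node.prems by simp
  qed (use Node.prems in simp)
qed simp

lemma typed_trees_vertices: "T \<in> typed_trees A \<Longrightarrow> A = insert (rt_root T) (fst ` rt_edges T)"
proof (rule Set.set_eqI)
  fix w assume T: "T \<in> typed_trees A"
  show "w \<in> A \<longleftrightarrow> w \<in> insert (rt_root T) (fst ` rt_edges T)"
    using typed_treesD(1,4)[OF T] typed_treesD(2)[OF T] by (force simp: image_iff)
qed

text \<open>A normal form can be read off its leading tree. The first branch is the one at the child
  of the root with the smallest value of \<open>enc\<close>; the type of its edge, its vertices and
  its edges are determined by the tree, and so is the rest.\<close>

lemma lead_inj:
  "distinct (leaves t) \<Longrightarrow> distinct (leaves t') \<Longrightarrow> normal_form enc t \<Longrightarrow> normal_form enc t' \<Longrightarrow>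
    inj_on enc (set (leaves t)) \<Longrightarrow> lead t = lead t' \<Longrightarrow> t = t'"
proof (induction t arbitrary: t' rule: distinct_leaves_induct)
  case (Leaf a)
  show ?case
  proof (cases t')
    case (Leaf b) then show ?thesis using Leaf.prems by simp
  next
    case (Node \<omega> l r)
    have "rt_edges (lead t') \<noteq> {}" unfolding Node lead.simps using rt_edges_hangI(1) by fast
    then show ?thesis using Leaf.prems by (metis lead.simps(1) rtree.sel(2))
  qed
next
  case (Node \<omega> l r)
  let ?t = "Node \<omega> l r"
  have d: "distinct (leaves ?t)" using Node.hyps by simp
  show ?case
  proof (cases t')
    case (Leaf b)
    have "rt_edges (lead ?t) \<noteq> {}" unfolding lead.simps using rt_edges_hangI(1) by fast
    then show ?thesis using Node.prems(5) Leaf by simp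
  next
    case t': (Node \<omega>' l' r')
    note d' = Node.prems(1)[unfolded t']
    note eq = Node.prems(5)[unfolded t']
    have dl': "distinct (leaves l')" "distinct (leaves r')" "set (leaves l') \<inter> set (leaves r') = {}" using d' by simp_all
    note T = lead_typed[OF d] and T' = lead_typed[OF d']
    have V: "set (leaves ?t) = set (leaves (Node \<omega>' l' r'))"
      using typed_trees_vertices[OF T] typed_trees_vertices[OF T'] unfolding eq by simp
    have tr: "tip r = tip r'" using arg_cong[OF eq, of rt_root] by simp
    have e: "(tip l, \<omega>, tip r) \<in> rt_edges (lead ?t)" unfolding rt_edges_lead_Node[OF d] by simp
    have e': "(tip l', \<omega>', tip r) \<in> rt_edges (lead ?t)" unfolding eq rt_edges_lead_Node[OF d'] tr by simp
    \<comment> \<open>Each of the two tips is a child of the root in the common leading tree, so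
      each is bounded by the other.\<close>
    have "enc (tip l) \<le> enc (tip l')"
      by (rule below_child[OF d Node.prems(2), of _ _ \<omega>']) (use e' in simp_all)
    moreover have "enc (tip l') \<le> enc (tip l)"
      by (rule below_child[OF d' Node.prems(3)[unfolded t'], of _ _ \<omega>]) (use e eq tr in simp_all)
    ultimately have "enc (tip l) = enc (tip l')" by simp
    then have tl: "tip l = tip l'"
      by (rule inj_onD[OF Node.prems(4)]) (use V tip_leaves[of l] tip_leaves[of l'] in auto)
    have "(tip l, \<omega>', tip r) \<in> rt_edges (lead ?t)" using e' unfolding tl .
    then have om: "\<omega> = \<omega>'" using typed_treesD(3)[OF T e] by blast
    \<comment> \<open>The labels of the first branch are the vertices with the tip of that branch as
      an ancestor, a condition on the leading tree alone.\<close>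
    have desc: "set (leaves l) = {w \<in> set (leaves (Node \<omega> l r)). (w, tip l) \<in> (parent_rel (lead (Node \<omega> l r)))\<^sup>*}"
      if D: "distinct (leaves (Node \<omega> l r))" for \<omega> and l r :: "('a, 'b) pbt"
    proof -
      have dl: "distinct (leaves l)" "distinct (leaves r)" "set (leaves l) \<inter> set (leaves r) = {}" using D by simp_all
      note iff = rtrancl_hang[OF lead_typed[OF dl(1)] lead_typed[OF dl(2)] dl(3) tip_leaves, of _ "tip l" \<omega>]
      have "(w, tip l) \<in> (parent_rel (lead l))\<^sup>*" if "w \<in> set (leaves l)" for w
        using typed_treesD(5)[OF lead_typed[OF dl(1)] that] by simp
      then show ?thesis using iff tip_leaves[of l] dl(3) by auto
    qed
    have L: "set (leaves l) = set (leaves l')" using desc[OF d, unfolded V eq tl] desc[OF d'] by (rule trans[OF _ sym])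
    have R: "set (leaves r) = set (leaves r')" using L V Node.hyps(3) dl'(3) by auto
    have edges: "(w, \<eta>, x) \<in> rt_edges (lead l) \<longleftrightarrow> (w, \<eta>, x) \<in> rt_edges (lead (Node \<omega> l r)) \<and> w \<in> set (leaves l) \<and> w \<noteq> tip l"
      "(w, \<eta>, x) \<in> rt_edges (lead r) \<longleftrightarrow> (w, \<eta>, x) \<in> rt_edges (lead (Node \<omega> l r)) \<and> w \<in> set (leaves r)"
      if D: "distinct (leaves (Node \<omega> l r))" for w \<eta> x \<omega> and l r :: "('a, 'b) pbt"
    proof -
      have dl: "distinct (leaves l)" "distinct (leaves r)" "set (leaves l) \<inter> set (leaves r) = {}" using D by simp_all
      have "w \<in> set (leaves l) \<and> w \<noteq> tip l" if "(w, \<eta>, x) \<in> rt_edges (lead l)"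
        using typed_treesD(2)[OF lead_typed[OF dl(1)] that] by simp
      moreover have "w \<in> set (leaves r)" if "(w, \<eta>, x) \<in> rt_edges (lead r)"
        using typed_treesD(2)[OF lead_typed[OF dl(2)] that] by simp
      ultimately show "(w, \<eta>, x) \<in> rt_edges (lead l) \<longleftrightarrow> (w, \<eta>, x) \<in> rt_edges (lead (Node \<omega> l r)) \<and> w \<in> set (leaves l) \<and> w \<noteq> tip l"
        "(w, \<eta>, x) \<in> rt_edges (lead r) \<longleftrightarrow> (w, \<eta>, x) \<in> rt_edges (lead (Node \<omega> l r)) \<and> w \<in> set (leaves r)"
        unfolding rt_edges_lead_Node[OF D] using dl(3) tip_leaves[of l] by blast+
    qed
    have "lead l = lead l'"
      by (rule rtree_eqI) (simp_all only: rt_root_lead tl edges(1)[OF d] edges(1)[OF d'] eq L)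
    then have l: "l = l'"
      using Node.prems dl' by (intro Node.IH(1)) (auto simp: t' intro: inj_on_subset)
    have "lead r = lead r'"
      by (rule rtree_eqI) (simp_all only: rt_root_lead tr edges(2)[OF d] edges(2)[OF d'] eq R)
    then have "r = r'"
      using Node.prems dl' by (intro Node.IH(2)) (auto simp: t' intro: inj_on_subset)
    then show ?thesis using l om t' by simp
  qed
qed

section \<open>Normal forms modulo the pre-Lie family relations\<close>

lemma lin_ext_diff: "lin_ext f (p - q) = lin_ext f p - lin_ext f q"
  using lin_ext_add[of f "p - q" q] by simp

lemma free_gen_eq: "free_gen \<omega> a b = basis (Node \<omega> (Leaf a) (Leaf b))"
  by (simp add: free_gen_def free_operad_incl_def)

text \<open>The pre-Lie family relator with trees substituted for its three inputs; sorting
  exchanges whole branches and not just leaves.\<close>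

definition relator :: "'w::ab_semigroup_mult \<Rightarrow> 'w \<Rightarrow> ('l, 'w) pbt \<Rightarrow> ('l, 'w) pbt \<Rightarrow> ('l, 'w) pbt \<Rightarrow>
    (('l, 'w) pbt \<Rightarrow>\<^sub>0 'k::{comm_ring,comm_monoid_mult})" where
  "relator \<alpha> \<beta> t u v =
     basis (Node \<alpha> t (Node \<beta> u v)) - basis (Node (\<alpha> * \<beta>) (Node \<alpha> t u) v) -
     (basis (Node \<beta> u (Node \<alpha> t v)) - basis (Node (\<beta> * \<alpha>) (Node \<beta> u t) v))"

lemma preLie_family_relator_eq:
  "distinct [x, y, z, s] \<Longrightarrow> preLie_family_relator \<alpha> \<beta> x y z s = relator \<alpha> \<beta> (Leaf x) (Leaf y) (Leaf z)"
  by (auto simp: preLie_family_relator_def assoc_family_def free_gen_eq relator_def lin_ext_diff transpose_def)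

lemma keys_relator:
  assumes "t \<in> pbts A" "u \<in> pbts B" "v \<in> pbts C" "A \<inter> B = {}" "A \<inter> C = {}" "B \<inter> C = {}"
  shows "Poly_Mapping.keys (relator \<alpha> \<beta> t u v) \<subseteq> pbts (A \<union> B \<union> C)"
proof -
  have d: "Poly_Mapping.keys (p - q) \<subseteq> X" if "Poly_Mapping.keys p \<subseteq> X" "Poly_Mapping.keys q \<subseteq> X"
    for p q :: "('a, 'b) pbt \<Rightarrow>\<^sub>0 'c" and X
    using that keys_diff[of p q] by blast
  show ?thesis unfolding relator_def
    by (intro d keys_basis_subset) (use assms in \<open>auto simp: pbts_def\<close>)
qed

section \<open>Closure properties of the ideal of relations\<close>

lemma operad_ideal_PLF_ideal:
  "operad_ideal (free_operad :: ('l, 'k::{comm_ring,comm_monoid_mult}, ('l, 'w::ab_semigroup_mult) pbt \<Rightarrow>\<^sub>0 'k) operad) PLF_ideal"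
  unfolding PLF_ideal_def
proof (rule operad.operad_ideal_generated[OF operad_free_operad], rule subsetI)
  fix A :: "'l set" and p :: "('l, 'w) pbt \<Rightarrow>\<^sub>0 'k"
  assume "p \<in> {preLie_family_relator \<alpha> \<beta> x y z s | \<alpha> \<beta> x y z s. distinct [x, y, z, s] \<and> A = {x, y, z}}"
  then obtain \<alpha> \<beta> x y z s where p: "p = preLie_family_relator \<alpha> \<beta> x y z s" "distinct [x, y, z, s]" "A = {x, y, z}"
    by blast
  have "Poly_Mapping.keys (relator \<alpha> \<beta> (Leaf x) (Leaf y) (Leaf z) :: ('l, 'w) pbt \<Rightarrow>\<^sub>0 'k) \<subseteq> pbts ({x} \<union> {y} \<union> {z})"
    by (rule keys_relator) (use p(2) in \<open>auto simp: pbts_def\<close>)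
  then show "p \<in> elts free_operad A"
    unfolding p(1) preLie_family_relator_eq[OF p(2)] using p(3) by (simp add: insert_commute)
qed

lemma operad_with_ideal_PLF: "operad_with_ideal free_operad PLF_ideal"
  by (simp add: operad_with_ideal_def operad_with_ideal_axioms_def operad_free_operad operad_ideal_PLF_ideal)

lemma PLF_ideal_subset: "finite A \<Longrightarrow> x \<in> PLF_ideal A \<Longrightarrow> Poly_Mapping.keys x \<subseteq> pbts A"
  using operad_with_ideal.ideal_subset[OF operad_with_ideal_PLF, of A] by auto

lemma
  assumes A: "finite A"
  shows PLF_ideal_zero: "0 \<in> PLF_ideal A"
    and PLF_ideal_add: "x \<in> PLF_ideal A \<Longrightarrow> y \<in> PLF_ideal A \<Longrightarrow> x + y \<in> PLF_ideal A"
    and PLF_ideal_scale: "x \<in> PLF_ideal A \<Longrightarrow> scale c x \<in> PLF_ideal A"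
proof -
  have sub: "submodule (PLF_ideal A) scalars (free_mod (pbts A))"
    using operad_with_ideal.submodule_ideal[OF operad_with_ideal_PLF A] by simp
  show "0 \<in> PLF_ideal A" using subgroup.one_closed[OF submodule.axioms(1)[OF sub]] by simp
  show "x \<in> PLF_ideal A \<Longrightarrow> y \<in> PLF_ideal A \<Longrightarrow> x + y \<in> PLF_ideal A"
    using subgroup.m_closed[OF submodule.axioms(1)[OF sub], of x y] by simp
  show "x \<in> PLF_ideal A \<Longrightarrow> scale c x \<in> PLF_ideal A"
    using submodule.smult_closed[OF sub, of c x] by simp
qed

lemma scale_uminus_one: "scale (- 1) x = - x"
  by (rule poly_mapping_eqI) simp

lemma PLF_ideal_pcomp_left:
  assumes "finite A" "finite B" "A \<inter> B = {}" "a \<in> A" "x \<in> PLF_ideal A" "s \<in> pbts B"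
  shows "lin_ext (\<lambda>t. basis (subst_leaf a s t)) x \<in> PLF_ideal (A - {a} \<union> B)"
proof -
  have "basis s \<in> elts (free_operad :: ('a, 'c, ('a, 'b) pbt \<Rightarrow>\<^sub>0 'c) operad) B"
    using assms(6) by (simp add: keys_basis_subset)
  then have "pcomp free_operad A a B x (basis s) \<in> PLF_ideal (A - {a} \<union> B)"
    using operad_ideal_PLF_ideal assms(1-5) unfolding operad_ideal_def by meson
  then show ?thesis by simp
qed

lemma PLF_ideal_pcomp_right:
  assumes "finite A" "finite B" "A \<inter> B = {}" "a \<in> A" "t \<in> pbts A" "x \<in> PLF_ideal B"
  shows "lin_ext (\<lambda>s. basis (subst_leaf a s t)) x \<in> PLF_ideal (A - {a} \<union> B)"
proof -
  have "basis t \<in> elts (free_operad :: ('a, 'c, ('a, 'b) pbt \<Rightarrow>\<^sub>0 'c) operad) A"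
    using assms(5) by (simp add: keys_basis_subset)
  then have "pcomp free_operad A a B (basis t) x \<in> PLF_ideal (A - {a} \<union> B)"
    using operad_ideal_PLF_ideal assms(1-4,6) unfolding operad_ideal_def by meson
  then show ?thesis by simp
qed

text \<open>Adding an outer node is a partial composition into
  \<open>Node \<omega> l (Leaf s)\<close> at a fresh label \<open>s\<close>, which the infinite
  label type supplies.\<close>

lemma PLF_ideal_Node_left:
  fixes l :: "('l::infinite, 'w::ab_semigroup_mult) pbt"
  assumes l: "l \<in> pbts L" and x: "x \<in> PLF_ideal R" and fin: "finite L" "finite R" and LR: "L \<inter> R = {}"
  shows "lin_ext (\<lambda>r. basis (Node \<omega> l r)) x \<in> PLF_ideal (L \<union> R)"
proof -
  obtain s where s: "s \<notin> L \<union> R" using arb_element[of "L \<union> R"] fin by blast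
  have "Node \<omega> l (Leaf s) \<in> pbts (insert s L)" using l s by (auto simp: pbts_def)
  then have "lin_ext (\<lambda>r. basis (subst_leaf s r (Node \<omega> l (Leaf s)))) x \<in> PLF_ideal (insert s L - {s} \<union> R)"
    by (intro PLF_ideal_pcomp_right x) (use fin LR s in auto)
  moreover have "insert s L - {s} = L" using s by blast
  moreover have "subst_leaf s r l = l" for r using l s by (auto simp: pbts_def intro: subst_leaf_notin)
  ultimately show ?thesis by simp
qed

lemma PLF_ideal_Node_right:
  fixes r :: "('l::infinite, 'w::ab_semigroup_mult) pbt"
  assumes r: "r \<in> pbts R" and x: "x \<in> PLF_ideal L" and fin: "finite L" "finite R" and LR: "L \<inter> R = {}"
  shows "lin_ext (\<lambda>l. basis (Node \<omega> l r)) x \<in> PLF_ideal (L \<union> R)"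
proof -
  obtain s where s: "s \<notin> L \<union> R" using arb_element[of "L \<union> R"] fin by blast
  have "Node \<omega> (Leaf s) r \<in> pbts (insert s R)" using r s by (auto simp: pbts_def)
  then have "lin_ext (\<lambda>l. basis (subst_leaf s l (Node \<omega> (Leaf s) r))) x \<in> PLF_ideal (insert s R - {s} \<union> L)"
    by (intro PLF_ideal_pcomp_right x) (use fin LR s in auto)
  moreover have "insert s R - {s} = R" using s by blast
  moreover have "subst_leaf s l r = r" for l using r s by (auto simp: pbts_def intro: subst_leaf_notin)
  ultimately show ?thesis by (simp add: Un_commute)
qed

text \<open>The generators of the ideal involve labels only. Four fresh labels give a generator, and
  \<open>t\<close>, \<open>u\<close>, \<open>v\<close> are substituted for its inputs one after the
  other; freshness keeps a later substitution from touching a tree inserted earlier.\<close>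

lemma relator_in_PLF_ideal:
  fixes t u v :: "('l::infinite, 'w::ab_semigroup_mult) pbt"
  assumes t: "t \<in> pbts A" and u: "u \<in> pbts B" and v: "v \<in> pbts C"
    and dis: "A \<inter> B = {}" "A \<inter> C = {}" "B \<inter> C = {}" and fin: "finite A" "finite B" "finite C"
  shows "relator \<alpha> \<beta> t u v \<in> PLF_ideal (A \<union> B \<union> C)"
proof -
  let ?U = "A \<union> B \<union> C"
  obtain x where x: "x \<notin> ?U" using arb_element[of ?U] fin by blast
  obtain y where y: "y \<notin> insert x ?U" using arb_element[of "insert x ?U"] fin by blast
  obtain z where z: "z \<notin> insert y (insert x ?U)" using arb_element[of "insert y (insert x ?U)"] fin by blast
  obtain s where s: "s \<notin> insert z (insert y (insert x ?U))"
    using arb_element[of "insert z (insert y (insert x ?U))"] fin by blast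
  have d: "distinct [x, y, z, s]" using x y z s by auto
  have ne: "x \<noteq> y" "y \<noteq> x" "x \<noteq> z" "z \<noteq> x" "y \<noteq> z" "z \<noteq> y" using d by auto
  have "preLie_family_relator \<alpha> \<beta> x y z s \<in> PLF_ideal {x, y, z}"
    unfolding PLF_ideal_def by (rule subsetD[OF generated_ideal_incl]) (simp, use d in blast)
  then have 0: "relator \<alpha> \<beta> (Leaf x) (Leaf y) (Leaf z) \<in> PLF_ideal {x, y, z}"
    by (simp only: preLie_family_relator_eq[OF d])
  have "x \<notin> set (leaves t)" "y \<notin> set (leaves t)" "z \<notin> set (leaves t)" "z \<notin> set (leaves u)"
    using x y z t u by (auto simp: pbts_def)
  note nl = this[THEN subst_leaf_notin]
  have "lin_ext (\<lambda>p. basis (subst_leaf x t p)) (relator \<alpha> \<beta> (Leaf x) (Leaf y) (Leaf z)) \<in> PLF_ideal ({x, y, z} - {x} \<union> A)"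
    by (rule PLF_ideal_pcomp_left[OF _ fin(1) _ _ 0 t]) (use x y z in auto)
  moreover have "{x, y, z} - {x} \<union> A = {y, z} \<union> A" using d by auto
  ultimately have 1: "relator \<alpha> \<beta> t (Leaf y) (Leaf z) \<in> PLF_ideal ({y, z} \<union> A)"
    using ne by (simp add: relator_def lin_ext_diff)
  have "lin_ext (\<lambda>p. basis (subst_leaf y u p)) (relator \<alpha> \<beta> t (Leaf y) (Leaf z)) \<in> PLF_ideal ({y, z} \<union> A - {y} \<union> B)"
    by (rule PLF_ideal_pcomp_left[OF _ fin(2) _ _ 1 u]) (use x y z fin dis in auto)
  moreover have "{y, z} \<union> A - {y} \<union> B = {z} \<union> A \<union> B" using d y by auto
  ultimately have 2: "relator \<alpha> \<beta> t u (Leaf z) \<in> PLF_ideal ({z} \<union> A \<union> B)"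
    using ne nl by (simp add: relator_def lin_ext_diff)
  have "lin_ext (\<lambda>p. basis (subst_leaf z v p)) (relator \<alpha> \<beta> t u (Leaf z)) \<in> PLF_ideal ({z} \<union> A \<union> B - {z} \<union> C)"
    by (rule PLF_ideal_pcomp_left[OF _ fin(3) _ _ 2 v]) (use x y z fin dis in auto)
  moreover have "{z} \<union> A \<union> B - {z} \<union> C = A \<union> B \<union> C" using z by auto
  ultimately show ?thesis using ne nl by (simp add: relator_def lin_ext_diff)
qed

section \<open>Congruence to combinations of prescribed trees\<close>

text \<open>The statement that trees in \<open>S\<close> represent \<open>x\<close> in the quotient,
  phrased in the free module so that rewriting takes place there and not among cosets.\<close>

definition rep :: "'l set \<Rightarrow> ('l, 'w::ab_semigroup_mult) pbt set \<Rightarrow> (('l, 'w) pbt \<Rightarrow>\<^sub>0 'k::{comm_ring,comm_monoid_mult}) set" where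
  "rep A S = {x. \<exists>y. Poly_Mapping.keys y \<subseteq> S \<inter> pbts A \<and> x - y \<in> PLF_ideal A}"

lemma rep_basis: "finite A \<Longrightarrow> t \<in> S \<Longrightarrow> t \<in> pbts A \<Longrightarrow> basis t \<in> rep A S"
  unfolding rep_def using keys_basis_subset[of t "S \<inter> pbts A"] PLF_ideal_zero[of A] by force

lemma rep_mono: "S \<inter> pbts A \<subseteq> S' \<Longrightarrow> x \<in> rep A S \<Longrightarrow> x \<in> rep A S'"
  unfolding rep_def by blast

lemma rep_ideal: "finite A \<Longrightarrow> x \<in> PLF_ideal A \<Longrightarrow> x \<in> rep A S"
  unfolding rep_def by (rule CollectI, rule exI[of _ 0]) simp

lemma rep_add:
  assumes A: "finite A" and "x \<in> rep A S" "x' \<in> rep A S"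
  shows "x + x' \<in> rep A S"
proof -
  obtain y y' where y: "Poly_Mapping.keys y \<subseteq> S \<inter> pbts A" "x - y \<in> PLF_ideal A"
    and y': "Poly_Mapping.keys y' \<subseteq> S \<inter> pbts A" "x' - y' \<in> PLF_ideal A"
    using assms(2,3) unfolding rep_def by blast
  have "x + x' - (y + y') = (x - y) + (x' - y')" by simp
  then have "x + x' - (y + y') \<in> PLF_ideal A" using PLF_ideal_add[OF A y(2) y'(2)] by (simp only:)
  moreover have "Poly_Mapping.keys (y + y') \<subseteq> S \<inter> pbts A" using Poly_Mapping.keys_add[of y y'] y(1) y'(1) by blast
  ultimately show ?thesis unfolding rep_def by blast
qed

lemma rep_scale:
  assumes A: "finite A" and "x \<in> rep A S"
  shows "scale c x \<in> rep A S"
proof -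
  obtain y where y: "Poly_Mapping.keys y \<subseteq> S \<inter> pbts A" "x - y \<in> PLF_ideal A"
    using assms(2) unfolding rep_def by blast
  have "scale c x - scale c y = scale c (x - y)" by (rule poly_mapping_eqI) (simp add: lookup_minus algebra_simps)
  then have "scale c x - scale c y \<in> PLF_ideal A" using PLF_ideal_scale[OF A y(2)] by simp
  moreover have "Poly_Mapping.keys (scale c y) \<subseteq> S \<inter> pbts A" using keys_scale[of c y] y(1) by blast
  ultimately show ?thesis unfolding rep_def by blast
qed

lemma rep_diff: "finite A \<Longrightarrow> x \<in> rep A S \<Longrightarrow> y \<in> rep A S \<Longrightarrow> x - y \<in> rep A S"
  using rep_add[of A x S "- y"] rep_scale[of A y S "- 1"] by (simp add: scale_uminus_one)

lemma rep_sum: "finite A \<Longrightarrow> (\<And>t. t \<in> X \<Longrightarrow> g t \<in> rep A S) \<Longrightarrow> (\<Sum>t\<in>X. g t) \<in> rep A S"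
  by (induction X rule: infinite_finite_induct) (simp_all add: rep_ideal PLF_ideal_zero rep_add)

text \<open>Rewriting inside a context: when \<open>g\<close> maps relations to relations, its
  argument may first be replaced by a representative, and \<open>g\<close> has to be examined on the
  trees in \<open>S\<close> only.\<close>

lemma rep_lin_ext:
  assumes A: "finite A" and B: "finite B" and x: "x \<in> rep A S"
    and g: "\<And>t. t \<in> S \<Longrightarrow> t \<in> pbts A \<Longrightarrow> g t \<in> rep B S'"
    and ideal: "\<And>z. z \<in> PLF_ideal A \<Longrightarrow> lin_ext g z \<in> PLF_ideal B"
  shows "lin_ext g x \<in> rep B S'"
proof -
  obtain y where y: "Poly_Mapping.keys y \<subseteq> S \<inter> pbts A" "x - y \<in> PLF_ideal A"
    using x unfolding rep_def by blast
  have "lin_ext g x = lin_ext g (x - y) + lin_ext g y" by (simp flip: lin_ext_add)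
  moreover have "lin_ext g y \<in> rep B S'"
    unfolding lin_ext_def by (intro rep_sum rep_scale B g) (use y(1) in auto)
  ultimately show ?thesis using rep_add[OF B rep_ideal[OF B ideal[OF y(2)]]] by simp
qed

section \<open>Sorting branches along the right spine\<close>

primrec spine :: "('l, 'w) pbt \<Rightarrow> nat" where
  "spine (Leaf a) = 0"
| "spine (Node \<omega> l r) = Suc (spine r)"

lemma below_0 [simp]: "below enc 0 t"
  by (cases t) simp_all

text \<open>With \<open>k = spine r\<close>, a tree \<open>Node \<omega> l r\<close> has spine
  \<open>Suc k\<close>. Either branches have been merged and the spine has become shorter, or it has
  its original length and the first branch respects the bound \<open>m\<close>; a shortened tree
  carries no bound.\<close>

definition short_normal :: "('l \<Rightarrow> nat) \<Rightarrow> nat \<Rightarrow> nat \<Rightarrow> ('l, 'w) pbt set" where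
  "short_normal enc k m = {t. normal_form enc t \<and> (spine t \<le> k \<or> spine t = Suc k \<and> below enc m t)}"

lemma finite_pbts: "t \<in> pbts A \<Longrightarrow> finite A"
  by (auto simp: pbts_def)

text \<open>
  Insertion sort along the right spine. Exchanging two neighbouring branches by a relator costs two
  terms in which they are merged into one branch; the bound on the length of the spine says that these
  terms are shorter, and \<open>m\<close> that the insertion creates no branch smaller than those present.
\<close>

lemma straighten:
  fixes l r :: "('l::infinite, 'w::ab_semigroup_mult) pbt"
  assumes "l \<in> pbts L" "r \<in> pbts R" "L \<inter> R = {}" "normal_form enc l" "normal_form enc r"
    "inj_on enc (L \<union> R)" "m \<le> enc (tip l)" "below enc m r"
  shows "(basis (Node \<omega> l r) :: ('l, 'w) pbt \<Rightarrow>\<^sub>0 'k::{comm_ring,comm_monoid_mult}) \<in>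
    rep (L \<union> R) (short_normal enc (spine r) m)"
  using assms
\<comment> \<open>Merging two branches, or inserting into \<open>v\<close> alone, involves fewer
  leaves. The remaining insertions keep all leaves but go into a tree with a shorter spine than
  \<open>r\<close>.\<close>
proof (induction "(card (L \<union> R), spine r)" arbitrary: \<omega> l r L R m
    rule: wf_induct_rule[OF wf_lex_prod[OF wf_less_than wf_less_than]])
  case (1 r L R \<omega> l m)
  note prems = "1.prems"
  have IH: "(basis (Node \<omega>' l' r') :: ('l, 'w) pbt \<Rightarrow>\<^sub>0 'k) \<in> rep (L' \<union> R') (short_normal enc (spine r') m')"
    if "card (L' \<union> R') < card (L \<union> R) \<or> card (L' \<union> R') = card (L \<union> R) \<and> spine r' < spine r"
      "l' \<in> pbts L'" "r' \<in> pbts R'" "L' \<inter> R' = {}" "normal_form enc l'" "normal_form enc r'"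
      "inj_on enc (L' \<union> R')" "m' \<le> enc (tip l')" "below enc m' r'" for L' R' r' l' m' \<omega>'
    by (rule "1.hyps"[OF _ that(2-)]) (use that(1) in auto)
  have fin: "finite L" "finite R" using prems(1,2) finite_pbts by blast+
  have Node: "Node \<omega> l r \<in> pbts (L \<union> R)" using prems(1-3) by (auto simp: pbts_def)
  show ?case
  proof (cases r)
    case (Leaf a)
    then show ?thesis using prems fin Node by (intro rep_basis) (auto simp: short_normal_def)
  next
    case r: (Node \<beta> y v)
    define Y where "Y = set (leaves y)"
    define V where "V = set (leaves v)"
    have yv: "y \<in> pbts Y" "v \<in> pbts V" "Y \<inter> V = {}" and R: "R = Y \<union> V"
      using prems(2) r by (auto simp: pbts_def Y_def V_def)
    have nyv: "normal_form enc y" "normal_form enc v" "below enc (Suc (enc (tip y))) v" using prems(5) r by simp_all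
    have finY: "finite Y" "finite V" using fin R by auto
    have LY: "L \<inter> Y = {}" "L \<inter> V = {}" using prems(3) R by auto
    have my: "m \<le> enc (tip y)" using prems(8) r by simp
    have tips: "tip l \<in> L" "tip y \<in> Y" using tip_leaves[of l] tip_leaves[of y] prems(1) by (auto simp: pbts_def Y_def)
    show ?thesis
    proof (cases "enc (tip l) < enc (tip y)")
      case True
      then show ?thesis using prems fin Node r by (intro rep_basis) (auto simp: short_normal_def)
    next
      case False
      have "tip l \<noteq> tip y" using tips LY by auto
      then have "enc (tip l) \<noteq> enc (tip y)" using inj_onD[OF prems(6), of "tip l" "tip y"] tips R by auto
      then have less: "Suc (enc (tip y)) \<le> enc (tip l)" using False by simp
      let ?A = "L \<union> R" and ?S = "short_normal enc (spine r) m :: ('l, 'w) pbt set"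
      have A: "finite ?A" using fin by simp
      have eqs: "L \<union> Y \<union> V = ?A" "Y \<union> (L \<union> V) = ?A" "L \<union> Y \<union> V = ?A" "Y \<union> L \<union> V = ?A" using R by auto
      have ne: "Y \<noteq> {}" "V \<noteq> {}" using yv by (auto simp: pbts_def) (metis tip_leaves empty_iff empty_set)+
      have cards: "card (L \<union> V) < card ?A" "card (L \<union> Y) < card ?A"
        by (rule psubset_card_mono[OF A], use ne LY yv(3) R in blast)+
      have inj: "inj_on enc (L \<union> V)" "inj_on enc (L \<union> Y)" "inj_on enc (Y \<union> L)"
        by (rule inj_on_subset[OF prems(6)], use R in blast)+
      \<comment> \<open>A result obtained with right spine \<open>k\<close> has spine at most
        \<open>Suc k\<close>, hence at most that of \<open>r\<close>, and falls under the
        alternative of \<open>?S\<close> without a bound.\<close>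
      have small: "x \<in> rep ?A ?S" if "x \<in> rep ?A (short_normal enc k 0)" "Suc k \<le> spine r" for x :: "('l, 'w) pbt \<Rightarrow>\<^sub>0 'k" and k
        by (rule rep_mono[OF _ that(1)]) (use that(2) in \<open>auto simp: short_normal_def\<close>)
      \<comment> \<open>Both merged terms of the relator are treated alike: the merged branch is
        normalised on fewer leaves and then inserted into \<open>v\<close>, whose spine is shorter
        than that of \<open>r\<close>.\<close>
      have swap: "(basis (Node \<gamma> (Node \<delta> a b) v) :: ('l, 'w) pbt \<Rightarrow>\<^sub>0 'k) \<in> rep ?A ?S"
        if ab: "a \<in> pbts P" "b \<in> pbts Q" "P \<inter> Q = {}" "P \<union> Q = L \<union> Y" "normal_form enc a" "normal_form enc b" for \<gamma> \<delta> a b P Q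
      proof -
        have "(basis (Node \<delta> a b) :: ('l, 'w) pbt \<Rightarrow>\<^sub>0 'k) \<in> rep (L \<union> Y) (short_normal enc (spine b) 0)"
          using IH[of P Q b a 0 \<delta>] ab cards(2) inj(2) by simp
        then have "lin_ext (\<lambda>t. basis (Node \<gamma> t v)) (basis (Node \<delta> a b) :: ('l, 'w) pbt \<Rightarrow>\<^sub>0 'k) \<in> rep ?A ?S"
        proof (rule rep_lin_ext[rotated 2])
          fix t :: "('l, 'w) pbt" assume t: "t \<in> short_normal enc (spine b) 0" "t \<in> pbts (L \<union> Y)"
          have "(basis (Node \<gamma> t v) :: ('l, 'w) pbt \<Rightarrow>\<^sub>0 'k) \<in> rep (L \<union> Y \<union> V) (short_normal enc (spine v) 0)"
            by (rule IH) (use t yv nyv LY prems(6) r in \<open>auto simp: eqs short_normal_def\<close>)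
          then show "(basis (Node \<gamma> t v) :: ('l, 'w) pbt \<Rightarrow>\<^sub>0 'k) \<in> rep ?A ?S"
            unfolding eqs by (rule small) (simp add: r)
        next
          fix z :: "('l, 'w) pbt \<Rightarrow>\<^sub>0 'k" assume "z \<in> PLF_ideal (L \<union> Y)"
          then show "lin_ext (\<lambda>t. basis (Node \<gamma> t v)) z \<in> PLF_ideal ?A"
            using PLF_ideal_Node_right[OF yv(2), of z "L \<union> Y" \<gamma>] fin finY LY yv(3) by (auto simp: eqs)
        qed (use fin finY in auto)
        then show ?thesis by simp
      qed
      \<comment> \<open>The bound \<open>Suc (enc (tip y))\<close> holds for \<open>v\<close>
        because \<open>r\<close> is normal, and for \<open>l\<close> by the present case. It lets
        \<open>y\<close> go in front of the result.\<close>
      have "(basis (Node \<omega> l v) :: ('l, 'w) pbt \<Rightarrow>\<^sub>0 'k) \<in> rep (L \<union> V) (short_normal enc (spine v) (Suc (enc (tip y))))"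
        by (rule IH) (use cards(1) prems yv nyv LY inj less in auto)
      then have "lin_ext (\<lambda>t. basis (Node \<beta> y t)) (basis (Node \<omega> l v) :: ('l, 'w) pbt \<Rightarrow>\<^sub>0 'k) \<in> rep ?A ?S"
      proof (rule rep_lin_ext[rotated 2])
        fix t :: "('l, 'w) pbt" assume t: "t \<in> short_normal enc (spine v) (Suc (enc (tip y)))" "t \<in> pbts (L \<union> V)"
        show "(basis (Node \<beta> y t) :: ('l, 'w) pbt \<Rightarrow>\<^sub>0 'k) \<in> rep ?A ?S"
        \<comment> \<open>If the spine of \<open>t\<close> has shrunk, its branches may be out of
          bound and \<open>y\<close> is inserted by induction. Otherwise the bound holds and
          \<open>Node \<beta> y t\<close> is already normal.\<close>
        proof (cases "spine t \<le> spine v")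
          case True
          have "(basis (Node \<beta> y t) :: ('l, 'w) pbt \<Rightarrow>\<^sub>0 'k) \<in> rep (Y \<union> (L \<union> V)) (short_normal enc (spine t) 0)"
            by (rule IH) (use True t yv nyv LY prems(6) r in \<open>auto simp: eqs short_normal_def\<close>)
          then show ?thesis unfolding eqs by (rule small) (use True in \<open>simp add: r\<close>)
        next
          case False
          have "Node \<beta> y t \<in> pbts ?A" using t(2) yv LY R by (auto simp: pbts_def)
          then show ?thesis
            by (intro rep_basis A) (use False t nyv my r in \<open>auto simp: short_normal_def\<close>)
        qed
      next
        fix z :: "('l, 'w) pbt \<Rightarrow>\<^sub>0 'k" assume "z \<in> PLF_ideal (L \<union> V)"
        then show "lin_ext (\<lambda>t. basis (Node \<beta> y t)) z \<in> PLF_ideal ?A"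
          using PLF_ideal_Node_left[OF yv(1), of z "L \<union> V" \<beta>] fin finY LY yv(3) by (auto simp: eqs)
      qed (use fin finY in auto)
      then have p1: "(basis (Node \<beta> y (Node \<omega> l v)) :: ('l, 'w) pbt \<Rightarrow>\<^sub>0 'k) \<in> rep ?A ?S" by simp
      have p2: "(basis (Node (\<omega> * \<beta>) (Node \<omega> l y) v) :: ('l, 'w) pbt \<Rightarrow>\<^sub>0 'k) \<in> rep ?A ?S"
        by (rule swap[OF prems(1) yv(1) LY(1) refl prems(4) nyv(1)])
      have p3: "(basis (Node (\<beta> * \<omega>) (Node \<beta> y l) v) :: ('l, 'w) pbt \<Rightarrow>\<^sub>0 'k) \<in> rep ?A ?S"
        by (rule swap[OF yv(1) prems(1) _ _ nyv(1) prems(4)]) (use LY in auto)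
      have "(relator \<omega> \<beta> l y v :: ('l, 'w) pbt \<Rightarrow>\<^sub>0 'k) \<in> PLF_ideal (L \<union> Y \<union> V)"
        by (rule relator_in_PLF_ideal) (use prems yv LY fin finY in auto)
      then have p4: "(relator \<omega> \<beta> l y v :: ('l, 'w) pbt \<Rightarrow>\<^sub>0 'k) \<in> rep ?A ?S"
        unfolding eqs by (rule rep_ideal[OF A])
      \<comment> \<open>The relator is solved for its first term.\<close>
      have "(basis (Node \<omega> l r) :: ('l, 'w) pbt \<Rightarrow>\<^sub>0 'k) =
          relator \<omega> \<beta> l y v + basis (Node (\<omega> * \<beta>) (Node \<omega> l y) v) +
          (basis (Node \<beta> y (Node \<omega> l v)) - basis (Node (\<beta> * \<omega>) (Node \<beta> y l) v))"
        by (simp add: relator_def r)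
      then show ?thesis using rep_add[OF A rep_add[OF A p4 p2] rep_diff[OF A p1 p3]] by simp
    qed
  qed
qed

text \<open>The two factors are normalised in turn inside the outer node, which is legitimate
  because the ideal is stable under adding a node. The normalised left factor is then inserted by
  \<open>straighten\<close> with the trivial bound 0.\<close>

lemma normal_rep:
  fixes t :: "('l::infinite, 'w::ab_semigroup_mult) pbt"
  assumes "distinct (leaves t)" "inj_on enc (set (leaves t))"
  shows "(basis t :: ('l, 'w) pbt \<Rightarrow>\<^sub>0 'k::{comm_ring,comm_monoid_mult}) \<in> rep (set (leaves t)) {t. normal_form enc t}"
  using assms
proof (induction t rule: distinct_leaves_induct)
  case (Leaf a)
  then show ?case by (intro rep_basis) (simp_all add: pbts_def)
next
  case (Node \<omega> l r)
  let ?L = "set (leaves l)" and ?R = "set (leaves r)" and ?N = "{t. normal_form enc t} :: ('l, 'w) pbt set"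
  have r: "r \<in> pbts ?R" using Node.hyps by (simp add: pbts_def)
  have inj: "inj_on enc (?L \<union> ?R)" "inj_on enc ?L" "inj_on enc ?R" using Node.prems by (auto intro: inj_on_subset)
  have "lin_ext (\<lambda>l'. basis (Node \<omega> l' r)) (basis l :: ('l, 'w) pbt \<Rightarrow>\<^sub>0 'k) \<in> rep (?L \<union> ?R) ?N"
  proof (rule rep_lin_ext[OF _ _ Node.IH(1)[OF inj(2)]])
    fix l' assume l': "l' \<in> ?N" "l' \<in> pbts ?L"
    have "lin_ext (\<lambda>r'. basis (Node \<omega> l' r')) (basis r :: ('l, 'w) pbt \<Rightarrow>\<^sub>0 'k) \<in> rep (?L \<union> ?R) ?N"
    proof (rule rep_lin_ext[OF _ _ Node.IH(2)[OF inj(3)]])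
      fix r' assume r': "r' \<in> ?N" "r' \<in> pbts ?R"
      have "(basis (Node \<omega> l' r') :: ('l, 'w) pbt \<Rightarrow>\<^sub>0 'k) \<in> rep (?L \<union> ?R) (short_normal enc (spine r') 0)"
        by (rule straighten) (use l' r' Node.hyps inj in auto)
      then show "(basis (Node \<omega> l' r') :: ('l, 'w) pbt \<Rightarrow>\<^sub>0 'k) \<in> rep (?L \<union> ?R) ?N"
        by (rule rep_mono[rotated]) (auto simp: short_normal_def)
    next
      fix z :: "('l, 'w) pbt \<Rightarrow>\<^sub>0 'k" assume "z \<in> PLF_ideal ?R"
      then show "lin_ext (\<lambda>r'. basis (Node \<omega> l' r')) z \<in> PLF_ideal (?L \<union> ?R)"
        by (intro PLF_ideal_Node_left l'(2)) (use Node.hyps in auto)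
    qed simp_all
    then show "(basis (Node \<omega> l' r) :: ('l, 'w) pbt \<Rightarrow>\<^sub>0 'k) \<in> rep (?L \<union> ?R) ?N" by simp
  next
    fix z :: "('l, 'w) pbt \<Rightarrow>\<^sub>0 'k" assume "z \<in> PLF_ideal ?L"
    then show "lin_ext (\<lambda>l'. basis (Node \<omega> l' r)) z \<in> PLF_ideal (?L \<union> ?R)"
      by (intro PLF_ideal_Node_right r) (use Node.hyps in auto)
  qed simp_all
  then show ?case by simp
qed

section \<open>The isomorphism\<close>

abbreviation FO :: "('l, 'k::{comm_ring,comm_monoid_mult}, ('l, 'w::ab_semigroup_mult) pbt \<Rightarrow>\<^sub>0 'k) operad" where
  "FO \<equiv> free_operad"

section \<open>Surjectivity of evaluation\<close>

lemma tev_image: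
  fixes A :: "'l set"
  assumes A: "finite A"
  shows "lin_ext tev ` {p :: ('l, 'w::ab_semigroup_mult) pbt \<Rightarrow>\<^sub>0 'k::{comm_ring,comm_monoid_mult}. Poly_Mapping.keys p \<subseteq> pbts A} =
    {q. Poly_Mapping.keys q \<subseteq> typed_trees A}" (is "_ ` ?X = ?Y")
proof (rule subset_antisym; rule subsetI)
  fix q assume "q \<in> lin_ext tev ` ?X"
  then obtain p where p: "Poly_Mapping.keys p \<subseteq> pbts A" "q = lin_ext tev p" by blast
  have "Poly_Mapping.keys (tev t :: ('l, 'w) rtree \<Rightarrow>\<^sub>0 'k) \<subseteq> typed_trees A" if "t \<in> pbts A" for t
    using keys_tev[of t] that by (auto simp: pbts_def)
  then show "q \<in> ?Y" unfolding p(2) mem_Collect_eq by (intro keys_lin_ext) (use p(1) in blast)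
next
  let ?J = "lin_ext tev ` ?X :: (('l, 'w) rtree \<Rightarrow>\<^sub>0 'k) set"
  have add: "p + q \<in> ?J" if pq: "p \<in> ?J" "q \<in> ?J" for p q
  proof -
    obtain p' q' where p': "Poly_Mapping.keys p' \<subseteq> pbts A" "p = lin_ext tev p'"
      and q': "Poly_Mapping.keys q' \<subseteq> pbts A" "q = lin_ext tev q'" using pq by blast
    show ?thesis
    proof (rule image_eqI[of _ _ "p' + q'"])
      show "p + q = lin_ext tev (p' + q')" unfolding p'(2) q'(2) lin_ext_add ..
      show "p' + q' \<in> ?X" using subset_trans[OF Poly_Mapping.keys_add[of p' q']] p'(1) q'(1) by simp
    qed
  qed
  have scale: "scale c p \<in> ?J" if pJ: "p \<in> ?J" for c p
  proof -
    obtain p' where p': "Poly_Mapping.keys p' \<subseteq> pbts A" "p = lin_ext tev p'" using pJ by blast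
    show ?thesis
    proof (rule image_eqI[of _ _ "scale c p'"])
      show "scale c p = lin_ext tev (scale c p')" unfolding p'(2) lin_ext_scale ..
      show "scale c p' \<in> ?X" using subset_trans[OF keys_scale p'(1)] by simp
    qed
  qed
  have zero: "0 \<in> ?J" by (rule image_eqI[of _ _ 0]) simp_all
  have span: "q \<in> ?J" if q: "\<And>T. T \<in> Poly_Mapping.keys q \<Longrightarrow> basis T \<in> ?J" for q
  proof -
    have "sum (\<lambda>T. scale (Poly_Mapping.lookup q T) (basis T)) X \<in> ?J" if "X \<subseteq> Poly_Mapping.keys q" for X
      using finite_subset[OF that finite_keys] that
    proof (induction X rule: finite_induct)
      case (insert T X)
      then have "basis T \<in> ?J" "sum (\<lambda>T. scale (Poly_Mapping.lookup q T) (basis T)) X \<in> ?J" using q by simp_all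
      then show ?case unfolding sum.insert[OF insert.hyps] by (intro add scale)
    qed (simp add: zero)
    from this[OF subset_refl] show ?thesis using lin_ext_basis_id[of q] by (simp only: lin_ext_def)
  qed
  have bound: "ancestor_count A T \<le> card (A \<times> A)" for T :: "('l, 'w) rtree"
    unfolding ancestor_count_def by (rule card_mono) (use A in auto)
  have basis: "basis T \<in> ?J" if "T \<in> typed_trees A" for T :: "('l, 'w) rtree"
    using that
  \<comment> \<open>The count never exceeds \<open>card (A \<times> A)\<close>, and the remainder
    \<open>y\<close> contains only trees of larger count, so the distance to this bound
    decreases.\<close>
  proof (induction "card (A \<times> A) - ancestor_count A T" arbitrary: T rule: less_induct)
    case less
    obtain t where t: "t \<in> pbts A" "lead t = T" using lead_surj[OF A less.prems] by blast
    then have A': "distinct (leaves t)" "A = set (leaves t)" by (auto simp: pbts_def)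
    obtain y :: "('l, 'w) rtree \<Rightarrow>\<^sub>0 'k" where y: "tev t = basis T + y"
      "Poly_Mapping.keys y \<subseteq> {S \<in> typed_trees A. ancestor_count A T < ancestor_count A S}"
      using tev_lead[OF A'(1)] unfolding A'(2)[symmetric] t(2) by blast
    have "y \<in> ?J"
    proof (rule span)
      fix S assume "S \<in> Poly_Mapping.keys y"
      then have S: "S \<in> typed_trees A" "ancestor_count A T < ancestor_count A S" using y(2) by auto
      show "basis S \<in> ?J"
        by (rule less.hyps[OF _ S(1)]) (use S(2) bound[of S] in linarith)
    qed
    moreover have "tev t \<in> ?J"
      by (rule image_eqI[of _ _ "basis t"]) (use t in \<open>simp_all add: keys_basis_subset\<close>)
    ultimately have "tev t + scale (- 1) y \<in> ?J" by (intro add scale)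
    then show ?case unfolding y(1) by (simp add: scale_uminus_one)
  qed
  fix q :: "('l, 'w) rtree \<Rightarrow>\<^sub>0 'k" assume "q \<in> ?Y"
  then show "q \<in> ?J" using span[of q] basis by blast
qed

section \<open>The operad structure of \<open>RTF\<close>\<close>

lemma tev_relabel:
  assumes "inj_on \<sigma> A" "Poly_Mapping.keys p \<subseteq> pbts A"
  shows "lin_ext tev (relabel FO \<sigma> A p) = relabel RTF \<sigma> A (lin_ext tev p)"
  unfolding free_operad_simps RTF_simps lin_ext_lin_ext lin_ext_basis
  by (rule lin_ext_cong[OF refl], rule tev_map) (use assms in \<open>auto simp: pbts_def\<close>)

lemma tev_pcomp:
  assumes AB: "A \<inter> B = {}" "a \<in> A" and p: "Poly_Mapping.keys p \<subseteq> pbts A" and q: "Poly_Mapping.keys q \<subseteq> pbts B"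
  shows "lin_ext tev (pcomp FO A a B p q) = pcomp RTF A a B (lin_ext tev p) (lin_ext tev q)"
proof -
  have "lin_ext tev (pcomp FO A a B p q) = lin_ext (\<lambda>t. lin_ext (\<lambda>s. tev (subst_leaf a s t)) q) p"
    by (simp add: lin_ext_lin_ext)
  also have "\<dots> = lin_ext (\<lambda>t. lin_ext (\<lambda>s. lin_ext (\<lambda>T. lin_ext (graft_sum a B T) (tev s)) (tev t)) q) p"
  proof (rule lin_ext_cong[OF refl], rule lin_ext_cong[OF refl])
    fix t s assume "t \<in> Poly_Mapping.keys p" "s \<in> Poly_Mapping.keys q"
    then have "t \<in> pbts A" "s \<in> pbts B" using p q by blast+
    then show "tev (subst_leaf a s t) = lin_ext (\<lambda>T. lin_ext (graft_sum a B T) (tev s)) (tev t)"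
      using tev_subst[of t s a] AB by (auto simp: pbts_def)
  qed
  also have "\<dots> = lin_ext (\<lambda>t. lin_ext (\<lambda>T. lin_ext (\<lambda>s. lin_ext (graft_sum a B T) (tev s)) q) (tev t)) p"
    by (subst lin_ext_swap) (rule refl)
  also have "\<dots> = pcomp RTF A a B (lin_ext tev p) (lin_ext tev q)"
    by (simp add: RTF_simps lin_ext_lin_ext)
  finally show ?thesis .
qed

lemma operad_RTF: "operad (RTF :: ('l, 'k::{comm_ring,comm_monoid_mult}, ('l, 'w::ab_semigroup_mult) rtree \<Rightarrow>\<^sub>0 'k) operad)"
proof (rule operad_image[where P = "FO :: ('l, 'k, ('l, 'w) pbt \<Rightarrow>\<^sub>0 'k) operad" and f = "\<lambda>A. lin_ext tev", OF operad_free_operad])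
  fix A :: "'l set" assume "finite A"
  then show "lin_ext tev ` elts (FO :: ('l, 'k, ('l, 'w) pbt \<Rightarrow>\<^sub>0 'k) operad) A = elts (RTF :: ('l, 'k, ('l, 'w) rtree \<Rightarrow>\<^sub>0 'k) operad) A"
    using tev_image by (simp add: RTF_simps)
qed (simp_all only: free_operad_simps(1) RTF_simps(1) free_mod_simps mem_Collect_eq lin_ext_add lin_ext_scale lin_ext_zero
    tev_relabel tev_pcomp free_operad_simps(3) RTF_simps(3) lin_ext_basis tev.simps)

lemma operad_hom_tev: "operad_hom (FO :: ('l, 'k::{comm_ring,comm_monoid_mult}, ('l, 'w::ab_semigroup_mult) pbt \<Rightarrow>\<^sub>0 'k) operad) RTF (\<lambda>A. lin_ext tev)"
  unfolding operad_hom_def species_hom_def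
proof (intro conjI allI impI; (elim conjE)?)
  fix A :: "'l set"
  show "lin_ext tev \<in> mod_hom scalars (component FO A) (component RTF A)"
    unfolding free_operad_simps RTF_simps
    by (rule lin_ext_mod_hom) (use keys_tev in \<open>auto simp: pbts_def\<close>)
qed (simp_all only: free_operad_simps(1) free_mod_simps mem_Collect_eq
    tev_relabel tev_pcomp free_operad_simps(3) RTF_simps(3) lin_ext_basis tev.simps)

section \<open>The kernel of evaluation\<close>

lemma hang_single_right: "hang \<omega> (RTree a E) z (RTree z {}) = RTree z (insert (a, \<omega>, z) E)"
  by (simp add: hang_def)

text \<open>Hanging \<open>x\<close> below \<open>y\<close> in the tree with root \<open>z\<close>
  turns the type \<beta> into \<alpha> * \<beta>, and this term cancels against the one with
  generator \<alpha> * \<beta>. What remains is the tree with \<open>x\<close> and \<open>y\<close>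
  both below \<open>z\<close>, which is symmetric under exchanging the two together with their
  types.\<close>

lemma tev_relator:
  assumes "distinct [x, y, z]"
  shows "lin_ext tev (relator \<alpha> \<beta> (Leaf x) (Leaf y) (Leaf z)) = 0"
proof -
  have *: "tev (Node \<alpha> (Leaf x) (Node \<beta> (Leaf y) (Leaf z))) - tev (Node (\<alpha> * \<beta>) (Node \<alpha> (Leaf x) (Leaf y)) (Leaf z)) =
      (basis (RTree z {(x, \<alpha>, z), (y, \<beta>, z)}) :: ('a, 'b) rtree \<Rightarrow>\<^sub>0 'c)"
    if d: "x \<noteq> y" "y \<noteq> z" "x \<noteq> z" for x y z :: 'a and \<alpha> \<beta> :: 'b
  proof -
    let ?S = "RTree z {(y, \<beta>, z)}"
    have P: "parent_rel ?S = {(y, z)}" by (auto simp: parent_rel_def)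
    have "(z, y) \<notin> {(y, z)}\<^sup>*" using d by (auto elim: converse_rtranclE)
    then have pm: "path_mult \<alpha> y ?S y \<beta> = \<alpha> * \<beta>" "path_mult \<alpha> z ?S y \<beta> = \<beta>"
      unfolding path_mult_def P by simp_all
    have h: "hang \<alpha> (RTree x {}) y ?S = RTree z {(x, \<alpha>, y), (y, \<alpha> * \<beta>, z)}"
      "hang \<alpha> (RTree x {}) z ?S = RTree z {(x, \<alpha>, z), (y, \<beta>, z)}"
      using pm by (auto simp: hang_def)
    show ?thesis
      using d by (simp add: hang_sum_def hang_single_right h insert_commute)
  qed
  show ?thesis
    unfolding relator_def lin_ext_diff lin_ext_basis
    using *[of x y z \<alpha> \<beta>] *[of y x z \<beta> \<alpha>] assms by (auto simp: insert_commute simp del: tev.simps)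
qed

text \<open>The kernel of a morphism is an operadic ideal; containing the relators, it contains the
  ideal that they generate.\<close>

lemma tev_PLF_ideal:
  fixes p :: "('l, 'w::ab_semigroup_mult) pbt \<Rightarrow>\<^sub>0 'k::{comm_ring,comm_monoid_mult}"
  assumes A: "finite A" and p: "p \<in> PLF_ideal A"
  shows "lin_ext tev p = 0"
proof -
  interpret operad_morphism "FO :: ('l, 'k, ('l, 'w) pbt \<Rightarrow>\<^sub>0 'k) operad" RTF "\<lambda>A. lin_ext tev"
    by (simp add: operad_morphism_def operad_morphism_axioms_def operad_free_operad operad_RTF operad_hom_tev)
  have "PLF_ideal A \<subseteq> kernel A"
    unfolding PLF_ideal_def
  proof (rule generated_ideal_least[OF operad_ideal_kernel], rule subsetI)
    fix B :: "'l set" and p :: "('l, 'w) pbt \<Rightarrow>\<^sub>0 'k" assume B: "finite B"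
      and "p \<in> {preLie_family_relator \<alpha> \<beta> x y z s | \<alpha> \<beta> x y z s. distinct [x, y, z, s] \<and> B = {x, y, z}}"
    then obtain \<alpha> \<beta> x y z s where q: "p = preLie_family_relator \<alpha> \<beta> x y z s" "distinct [x, y, z, s]" "B = {x, y, z}"
      by blast
    have "p \<in> PLF_ideal B"
      unfolding PLF_ideal_def by (rule subsetD[OF generated_ideal_incl[OF B]]) (use q in blast)
    then have "p \<in> elts FO B" using PLF_ideal_subset[OF B] by simp
    moreover have "lin_ext tev p = 0"
      unfolding q(1) preLie_family_relator_eq[OF q(2)] by (rule tev_relator) (use q(2) in simp)
    ultimately show "p \<in> kernel B" by (simp add: kernel_def RTF_simps)
  qed
  then show ?thesis using p by (auto simp: kernel_def RTF_simps)
qed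

lemma tev_kernel:
  fixes p :: "('l::infinite, 'w::ab_semigroup_mult) pbt \<Rightarrow>\<^sub>0 'k::{comm_ring,comm_monoid_mult}"
  assumes A: "finite A" and p: "Poly_Mapping.keys p \<subseteq> pbts A" and 0: "lin_ext tev p = 0"
  shows "p \<in> PLF_ideal A"
proof -
  \<comment> \<open>The order induced by \<open>enc\<close> is arbitrary; it serves to single out
    one binary tree for each leading tree.\<close>
  obtain enc :: "'l \<Rightarrow> nat" where enc: "inj_on enc A" using finite_imp_inj_to_nat_seg[OF A] by blast
  let ?N = "{t. normal_form enc t} :: ('l, 'w) pbt set"
  have "(\<Sum>t\<in>Poly_Mapping.keys p. scale (Poly_Mapping.lookup p t) (basis t)) \<in> rep A ?N"
  proof (intro rep_sum rep_scale A)
    fix t assume "t \<in> Poly_Mapping.keys p"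
    then have "distinct (leaves t)" "set (leaves t) = A" using p by (auto simp: pbts_def)
    then show "(basis t :: ('l, 'w) pbt \<Rightarrow>\<^sub>0 'k) \<in> rep A ?N" using normal_rep[of t enc] enc by simp
  qed
  then have "p \<in> rep A ?N" using lin_ext_basis_id[of p] by (simp only: lin_ext_def)
  then obtain y where y: "Poly_Mapping.keys y \<subseteq> ?N \<inter> pbts A" "p - y \<in> PLF_ideal A" unfolding rep_def by blast
  have ty: "lin_ext tev y = 0" using tev_PLF_ideal[OF A y(2)] 0 by (simp add: lin_ext_diff)
  have "y = 0"
  proof (rule ccontr)
    assume "y \<noteq> 0"
    then have "Poly_Mapping.keys y \<noteq> {}" by simp
    let ?c = "\<lambda>t. ancestor_count A (lead t)"
    \<comment> \<open>By minimality no remainder of any other tree in \<open>y\<close> can contain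
      \<open>lead t\<close>, and leading trees of distinct normal forms differ. The coefficient of
      \<open>lead t\<close> in the evaluation is therefore that of \<open>t\<close> in
      \<open>y\<close>.\<close>
    obtain t where t: "t \<in> Poly_Mapping.keys y" and min: "\<And>s. s \<in> Poly_Mapping.keys y \<Longrightarrow> ?c t \<le> ?c s"
      using ex_is_arg_min_if_finite[OF finite_keys \<open>Poly_Mapping.keys y \<noteq> {}\<close>, of ?c]
      unfolding is_arg_min_linorder by blast
    have dA: "distinct (leaves s)" "set (leaves s) = A" "normal_form enc s" if "s \<in> Poly_Mapping.keys y" for s
      using y(1) that by (auto simp: pbts_def)
    have look: "Poly_Mapping.lookup (tev s :: ('l, 'w) rtree \<Rightarrow>\<^sub>0 'k) (lead t) = (if s = t then 1 else 0)"
      if s: "s \<in> Poly_Mapping.keys y" for s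
    proof -
      obtain z :: "('l, 'w) rtree \<Rightarrow>\<^sub>0 'k" where z: "tev s = basis (lead s) + z"
        "Poly_Mapping.keys z \<subseteq> {T \<in> typed_trees A. ?c s < ancestor_count A T}"
        using tev_lead[OF dA(1)[OF s]] unfolding dA(2)[OF s] by blast
      have "lead t \<notin> Poly_Mapping.keys z" using z(2) min[OF s] by auto
      then have "Poly_Mapping.lookup z (lead t) = 0" by (simp add: in_keys_iff)
      moreover have "lead s = lead t \<longleftrightarrow> s = t"
        using lead_inj[of s t enc] dA[OF s] dA[OF t] enc by auto
      ultimately show ?thesis unfolding z(1) by (simp add: lookup_add lookup_basis)
    qed
    have "Poly_Mapping.lookup (lin_ext tev y :: ('l, 'w) rtree \<Rightarrow>\<^sub>0 'k) (lead t) =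
        (\<Sum>s\<in>Poly_Mapping.keys y. Poly_Mapping.lookup y s * (if s = t then 1 else 0))"
      unfolding lin_ext_def lookup_sum by (rule sum.cong) (simp_all add: look)
    also have "\<dots> = Poly_Mapping.lookup y t"
      using t by (simp add: if_distrib[of "(*) _"] cong: if_cong)
    finally show False using ty t by (simp add: in_keys_iff)
  qed
  then show ?thesis using y(2) by simp
qed

section \<open>Composition of morphisms and uniqueness on generators\<close>

lemma species_hom_comp:
  assumes f: "species_hom P Q f" and g: "species_hom Q R g"
  shows "species_hom P R (\<lambda>A x. g A (f A x))"
  unfolding species_hom_def
proof (intro conjI allI impI; (elim conjE)?)
  fix A :: "'a set" assume A: "finite A"
  show "(\<lambda>x. g A (f A x)) \<in> mod_hom scalars (component P A) (component R A)"
    by (rule mod_hom_comp[OF species_hom_mod_hom[OF f A] species_hom_mod_hom[OF g A]])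
next
  fix A :: "'a set" and \<sigma> :: "'a \<Rightarrow> 'a" and x assume A: "finite A" "inj_on \<sigma> A" and x: "x \<in> elts P A"
  have "f A x \<in> elts Q A" by (rule mod_homD(1)[OF species_hom_mod_hom[OF f A(1)] x])
  then show "g (\<sigma> ` A) (f (\<sigma> ` A) (relabel P \<sigma> A x)) = relabel R \<sigma> A (g A (f A x))"
    using f g A x by (simp add: species_hom_def)
qed

lemma operad_hom_comp:
  assumes f: "operad_hom P Q f" and g: "operad_hom Q R g"
  shows "operad_hom P R (\<lambda>A x. g A (f A x))"
proof -
  have sf: "species_hom P Q f" and sg: "species_hom Q R g" using f g by (simp_all add: operad_hom_def)
  have cl: "f A x \<in> elts Q A" if "finite A" "x \<in> elts P A" for A x
    by (rule mod_homD(1)[OF species_hom_mod_hom[OF sf that(1)] that(2)])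
  show ?thesis unfolding operad_hom_def
  proof (intro conjI allI impI; (elim conjE)?)
    show "species_hom P R (\<lambda>A x. g A (f A x))" by (rule species_hom_comp[OF sf sg])
    show "g {a} (f {a} (ident P a)) = ident R a" for a using f g by (simp add: operad_hom_def)
    fix A B a x y
    assume "finite A" "finite B" "A \<inter> B = {}" "a \<in> A" "x \<in> elts P A" "y \<in> elts P B"
    then show "g (A - {a} \<union> B) (f (A - {a} \<union> B) (pcomp P A a B x y)) = pcomp R A a B (g A (f A x)) (g B (f B y))"
      using f g cl by (simp add: operad_hom_def)
  qed
qed

text \<open>Agreement on the basic generators extends by linearity to the species of generators. The
  universal property, applied to the restriction of \<open>\<Psi>'\<close>, then identifies both
  morphisms with the same extension.\<close>

lemma operad_hom_unique_on_generators:
  fixes \<Psi> \<Psi>' :: "'l::infinite set \<Rightarrow> (('l, 'w) pbt \<Rightarrow>\<^sub>0 'k::{comm_ring,comm_monoid_mult}) \<Rightarrow> 'q"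
  assumes Q: "operad Q" and \<Psi>: "operad_hom free_operad Q \<Psi>" and \<Psi>': "operad_hom free_operad Q \<Psi>'"
    and gens: "\<And>\<omega> a b. a \<noteq> b \<Longrightarrow>
      \<Psi> {a, b} (basis (Node \<omega> (Leaf a) (Leaf b))) = \<Psi>' {a, b} (basis (Node \<omega> (Leaf a) (Leaf b)))"
    and A: "finite A" and x: "x \<in> elts free_operad A"
  shows "\<Psi> A x = \<Psi>' A x"
proof -
  let ?G = "gen_species :: ('l, 'k, ('w \<times> 'l \<times> 'l) \<Rightarrow>\<^sub>0 'k) species"
  let ?\<phi> = "\<lambda>A x. \<Psi>' A (free_operad_incl A x)"
  have sh: "species_hom ?G Q (\<lambda>A x. \<Psi>' A (free_operad_incl A x))" if "operad_hom free_operad Q \<Psi>'" for \<Psi>' :: "'l set \<Rightarrow> (('l, 'w) pbt \<Rightarrow>\<^sub>0 'k) \<Rightarrow> 'q"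
    by (rule species_hom_comp[OF species_hom_free_operad_incl that[unfolded operad_hom_def, THEN conjunct1]])
  have agree: "\<Psi> A (free_operad_incl A x) = \<Psi>' A (free_operad_incl A x)" if A: "finite A" and x: "x \<in> elts ?G A" for A x
  proof -
    note h1 = species_hom_mod_hom[OF sh[OF \<Psi>] A, unfolded gen_species_simps]
      and h2 = species_hom_mod_hom[OF sh[OF \<Psi>'] A, unfolded gen_species_simps]
    show ?thesis
    proof (rule mod_hom_free_eq[OF species.module_component[OF operad.axioms(1)[OF Q] A] h1 h2])
      show "Poly_Mapping.keys x \<subseteq> {(\<omega>, a, b) | \<omega> a b. a \<noteq> b \<and> A = {a, b}}"
        using x by (simp add: gen_species_simps)
      fix e :: "'w \<times> 'l \<times> 'l" assume "e \<in> {(\<omega>, a, b) | \<omega> a b. a \<noteq> b \<and> A = {a, b}}"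
      then obtain \<omega> a b where e: "e = (\<omega>, a, b)" "a \<noteq> b" "A = {a, b}" by blast
      then show "\<Psi> A (free_operad_incl A (basis e)) = \<Psi>' A (free_operad_incl A (basis e))"
        using gens[OF e(2), of \<omega>] by (simp add: free_operad_incl_def)
    qed
  qed
  obtain \<Xi> where \<Xi>: "\<And>\<Psi>''. operad_hom free_operad Q \<Psi>'' \<Longrightarrow>
      (\<And>A x. finite A \<Longrightarrow> x \<in> elts ?G A \<Longrightarrow> \<Psi>'' A (free_operad_incl A x) = ?\<phi> A x) \<Longrightarrow> \<Psi>'' A x = \<Xi> A x"
    using free_operad_is_free[OF Q sh[OF \<Psi>']] A x by meson
  show ?thesis using \<Xi>[OF \<Psi> agree] \<Xi>[OF \<Psi>' refl] by simp
qed

theorem theorem4p9: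
  shows "operad (PLF :: ('l::infinite, 'k::{comm_ring,comm_monoid_mult},
                          (('l, 'w::ab_semigroup_mult) pbt \<Rightarrow>\<^sub>0 'k) set) operad) \<and>
    operad (RTF :: ('l, 'k, ('l, 'w) rtree \<Rightarrow>\<^sub>0 'k) operad) \<and>
    (\<exists>\<Phi> :: 'l set \<Rightarrow> (('l, 'w) pbt \<Rightarrow>\<^sub>0 'k) set \<Rightarrow> (('l, 'w) rtree \<Rightarrow>\<^sub>0 'k).
       operad_iso PLF RTF \<Phi> \<and>
       (\<forall>\<omega> a b. a \<noteq> b \<longrightarrow> \<Phi> {a, b} (PLF_gen \<omega> a b) = basis (RTree b {(a, \<omega>, b)})) \<and>
       (\<forall>\<Psi>. operad_hom PLF RTF \<Psi> \<and>
          (\<forall>\<omega> a b. a \<noteq> b \<longrightarrow> \<Psi> {a, b} (PLF_gen \<omega> a b) = basis (RTree b {(a, \<omega>, b)})) \<longrightarrow>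
          (\<forall>A. finite A \<longrightarrow> (\<forall>x \<in> elts PLF A. \<Psi> A x = \<Phi> A x))))"
proof -
  let ?F = "FO :: ('l, 'k, ('l, 'w) pbt \<Rightarrow>\<^sub>0 'k) operad" and ?R = "RTF :: ('l, 'k, ('l, 'w) rtree \<Rightarrow>\<^sub>0 'k) operad"
  let ?P = "PLF :: ('l, 'k, (('l, 'w) pbt \<Rightarrow>\<^sub>0 'k) set) operad"
  interpret operad_with_ideal ?F PLF_ideal by (rule operad_with_ideal_PLF)
  have opP: "operad ?P" unfolding PLF_def by (rule operad_quotient)
  have opR: "operad ?R" by (rule operad_RTF)
  obtain \<Phi> where \<Phi>: "operad_hom ?P ?R \<Phi>"
    and \<Phi>_proj: "\<And>A x. finite A \<Longrightarrow> x \<in> elts ?F A \<Longrightarrow> \<Phi> A (proj A x) = lin_ext tev x"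
    unfolding PLF_def
    by (rule operad_hom_quotient[OF operad_free_operad opR ideal operad_hom_tev])
      (auto simp: RTF_simps tev_PLF_ideal)
  have eltsP: "elts ?P A = proj A ` elts ?F A" for A unfolding PLF_def by (rule quotient_operad_simps)
  have "bij_betw (\<Phi> A) (elts ?P A) (elts ?R A)" if A: "finite A" for A
    unfolding bij_betw_def
  proof
    show "inj_on (\<Phi> A) (elts ?P A)"
    proof (rule inj_onI)
      fix X Y assume "X \<in> elts ?P A" "Y \<in> elts ?P A" and eq: "\<Phi> A X = \<Phi> A Y"
      then obtain x y where x: "x \<in> elts ?F A" "X = proj A x" and y: "y \<in> elts ?F A" "Y = proj A y"
        unfolding eltsP by blast
      have "lin_ext tev (x - y) = 0" using eq \<Phi>_proj[OF A x(1)] \<Phi>_proj[OF A y(1)] x(2) y(2) by (simp add: lin_ext_diff)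
      moreover have "Poly_Mapping.keys (x - y) \<subseteq> pbts A" using x(1) y(1) keys_diff[of x y] by auto
      ultimately have "x - y \<in> PLF_ideal A" by (intro tev_kernel[OF A])
      then have "x \<in> proj A y" unfolding proj_iff[OF A y(1)] by (intro bexI[of _ "x - y"]) simp_all
      then show "X = Y" using proj_eq[OF A y(1)] x(2) y(2) by simp
    qed
    have "\<Phi> A ` elts ?P A = lin_ext tev ` elts ?F A"
      unfolding eltsP image_image by (rule image_cong[OF refl \<Phi>_proj[OF A]])
    also have "\<dots> = elts ?R A" using tev_image[OF A] by (simp add: RTF_simps)
    finally show "\<Phi> A ` elts ?P A = elts ?R A" .
  qed
  then have iso: "operad_iso ?P ?R \<Phi>" using \<Phi> by (simp add: operad_iso_def)
  have gen: "PLF_gen \<omega> a b = proj {a, b} (basis (Node \<omega> (Leaf a) (Leaf b)))" for \<omega> a b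
    by (simp add: PLF_gen_def free_gen_eq)
  have gen_in: "basis (Node \<omega> (Leaf a) (Leaf b)) \<in> elts ?F {a, b}" if "a \<noteq> b" for \<omega> a b
    using that by (simp add: keys_basis_subset pbts_def)
  have \<Phi>_gen: "\<Phi> {a, b} (PLF_gen \<omega> a b) = basis (RTree b {(a, \<omega>, b)})" if "a \<noteq> b" for \<omega> a b
    unfolding gen using \<Phi>_proj[OF _ gen_in[OF that]] by (simp add: hang_sum_def hang_single_right)
  have "\<Psi> A X = \<Phi> A X"
    if \<Psi>: "operad_hom ?P ?R \<Psi>" and \<Psi>_gen: "\<And>\<omega> a b. a \<noteq> b \<Longrightarrow> \<Psi> {a, b} (PLF_gen \<omega> a b) = basis (RTree b {(a, \<omega>, b)})"
      and A: "finite A" and X: "X \<in> elts ?P A" for \<Psi> A X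
  proof -
    obtain x where x: "x \<in> elts ?F A" "X = proj A x" using X unfolding eltsP by blast
    note proj_hom = operad_hom_proj[folded PLF_def]
    \<comment> \<open>Composition with the projection transfers the comparison to the free operad,
      where morphisms are determined by their values on generators.\<close>
    have "\<Psi> A (proj A x) = \<Phi> A (proj A x)"
      by (rule operad_hom_unique_on_generators[OF opR operad_hom_comp[OF proj_hom \<Psi>] operad_hom_comp[OF proj_hom \<Phi>] _ A x(1)])
        (unfold gen[symmetric], simp add: \<Psi>_gen \<Phi>_gen)
    then show ?thesis by (simp add: x(2))
  qed
  then have unique: "\<forall>\<Psi>. operad_hom ?P ?R \<Psi> \<and>
      (\<forall>\<omega> a b. a \<noteq> b \<longrightarrow> \<Psi> {a, b} (PLF_gen \<omega> a b) = basis (RTree b {(a, \<omega>, b)})) \<longrightarrow>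
      (\<forall>A. finite A \<longrightarrow> (\<forall>x \<in> elts ?P A. \<Psi> A x = \<Phi> A x))" by simp
  show ?thesis
    by (intro conjI opP opR exI[of _ \<Phi>] iso unique allI impI \<Phi>_gen)
qed

end
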